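(* Let $\mathbb H^3(c)$ be the hyperbolic 3-space of sectional curvature $c<0$. Then the unit tangent sphere bundle $\mathrm U\mathbb H^3(c)$ is a 4-symmetric space. Moreover, a surface $f:\mathbb D\to\mathbb H^3(c)$ is minimal if and only if its Gauss map $F=(f,n):\mathbb D\to\mathrm U\mathbb H^3(c)$ is a primitive map with respect to the 4-symmetric structure of $\mathrm U\mathbb H^3(c)$.
   Context: $\mathrm{Her}_2\mathbb C$: Hermitian $2\times2$ matrices with Lorentzian scalar product determined by $\langle\xi,\xi\rangle=-\det\xi$, with orthonormal basis $e_0=\mathrm{Id}$, $e_1=\mathrm{diag}(1,-1)$, $e_2=\begin{pmatrix}0&-i\\i&0\end{pmatrix}$, $e_3=\begin{pmatrix}0&1\\1&0\end{pmatrix}$. $\mathbb H^3(c)=\{\xi:\det\xi=1/|c|,\ \mathrm{tr}\,\xi>0\}$, and $\mathrm U\mathbb H^3(c)=\{(x,v):x\in\mathbb H^3(c),\langle v,v\rangle=1,\langle x,v\rangle=0\}$. $\mathrm{SL}_2\mathbb C$ (as a real Lie group) acts transitively by $g\cdot(x,v)=(gxg^*,gvg^* )$, with isotropy group $\mathrm U_1=\{\mathrm{diag}(e^{i\theta},e^{-i\theta})\}$ at $(e_0/\sqrt{|c|},e_1)$, so $\mathrm U\mathbb H^3(c)\cong\mathrm{SL}_2\mathbb C/\mathrm U_1$; its invariant semi-Riemannian metric is induced from a constant multiple of the Killing form of the real Lie algebra $\mathfrak{sl}_2\mathbb C$. A normal semi-Riemannian homogeneous space $G/H$ ($G$ semisimple,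 metric induced from a multiple of the Killing form) is $k$-symmetric ($k>2$) with respect to an automorphism $\tau$ of $G$ of order $k$ if $G_\tau^\circ\subset H\subset G_\tau$, where $G_\tau$ is the fixed point group and $G^\circ_\tau$ its identity component. Here $k=4$ and the 4-symmetric structure is given by $\tau(g)=\mathrm{Ad}(\mathscr R)(g^* )^{-1}$ with $\mathscr R=\mathrm{diag}(1/\sqrt i,\sqrt i)$; on $\mathfrak g=\mathfrak{sl}_2\mathbb C$ it reads $\tau(X)=-\mathrm{Ad}(\mathscr R)X^*$, i.e. $\tau\begin{pmatrix}a&b\\c&-a\end{pmatrix}=\begin{pmatrix}-\bar a&i\bar c\\-i\bar b&\bar a\end{pmatrix}$. The complexification $\mathfrak g^{\mathbb C}$ is realized as $\mathfrak{sl}_2\mathbb C\times\mathfrak{sl}_2\mathbb C$ with real form $\{(X,\bar X)\}$, and the complex linear extension of $\tau$ is $\hat\tau(X,Y)=(\tau(\bar Y),\overline{\tau(X)})$. Let $\mathfrak g_k^{\mathbb C}$ ($k$ mod 4) be the eigenspace of $\hat\tau$ for the eigenvalue $i^k$, and $\mathfrak p^{\mathbb C}=\mathfrak g_1^{\mathbb C}\oplus\mathfrak g_2^{\mathbb C}\oplus\mathfrak g_3^{\mathbb C}$. $\mathbb D\subset\mathbb C$ is a simply connected domain with coordinate $z=x+iy$; "surface" means a conformal immersion $f$, with induced metric $e^u\mathrm dz\mathrm d\bar z$ and unit normal $n$, oriented so that the coordinate frame $(\sqrt{|c|}\,f,n,e^{-u/2}f_y,e^{-u/2}f_x)$ takes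 values in $\mathrm{SO}^+_{1,3}$ with respect to the basis $(e_0,e_1,e_2,e_3)$. A frame of $F$ is a smooth map $\Phi:\mathbb D\to\mathrm{SL}_2\mathbb C$ with $\sqrt{|c|}\,f=\Phi\Phi^*$, $n=\Phi e_1\Phi^*$; put $\alpha=\Phi^{-1}\mathrm d\Phi$, viewed as the $\mathfrak g^{\mathbb C}$-valued form $(\alpha,\bar\alpha)$, and let $\alpha_{\mathfrak p}'$ be the $(1,0)$-part of its $\mathfrak p^{\mathbb C}$-component. $F$ is primitive if, for any frame, $\alpha_{\mathfrak p}'$ takes values in $\mathfrak g_{-1}^{\mathbb C}=\mathfrak g_3^{\mathbb C}$ (the eigenspace for the eigenvalue $-i$). *)

theory Defs
  imports "HOL-Analysis.Analysis"
begin

section \<open>Smooth maps, submanifolds and tangent spaces\<close>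

text \<open>On an open set \<open>S\<close> the following is class \<open>C\<^sup>n\<close>; the definition is only used
  for open \<open>S\<close>.\<close>

primrec Ck_on :: "nat \<Rightarrow> 'a::real_normed_vector set \<Rightarrow> ('a \<Rightarrow> 'b::real_normed_vector) \<Rightarrow> bool"
  where
    "Ck_on 0 S f \<longleftrightarrow> continuous_on S f"
  | "Ck_on (Suc n) S f \<longleftrightarrow>
       (\<forall>x\<in>S. f differentiable (at x)) \<and>
       (\<forall>v. Ck_on n S (\<lambda>x. frechet_derivative f (at x) v))"

definition smooth_on :: "'a::real_normed_vector set \<Rightarrow> ('a \<Rightarrow> 'b::real_normed_vector) \<Rightarrow> bool"
  where "smooth_on S f \<longleftrightarrow> (\<forall>n. Ck_on n S f)"

text \<open>Smoothness on an arbitrary subset: local existence of smooth extensions.\<close>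

definition smooth_map_on ::
    "'a::real_normed_vector set \<Rightarrow> ('a \<Rightarrow> 'b::real_normed_vector) \<Rightarrow> bool"
  where "smooth_map_on S f \<longleftrightarrow>
    (\<forall>x\<in>S. \<exists>U g. open U \<and> x \<in> U \<and> smooth_on U g \<and> (\<forall>y\<in>S \<inter> U. g y = f y))"

text \<open>Locally \<open>M\<close> is a regular level set of a smooth map into a vector space \<open>W\<close>. Since the
  codimension never exceeds the dimension of the ambient space, \<open>W\<close> may be taken inside it.\<close>

definition embedded_submanifold :: "'b::euclidean_space set \<Rightarrow> bool"
  where "embedded_submanifold M \<longleftrightarrow>
    (\<forall>p\<in>M. \<exists>U (F :: 'b \<Rightarrow> 'b) W. open U \<and> p \<in> U \<and> smooth_on U F \<and> subspace W \<and> F ` U \<subseteq> W \<and>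
       M \<inter> U = {q \<in> U. F q = 0} \<and>
       (\<forall>q\<in>M \<inter> U. range (frechet_derivative F (at q)) = W))"

definition curve_in :: "'b::real_normed_vector set \<Rightarrow> 'b \<Rightarrow> 'b \<Rightarrow> (real \<Rightarrow> 'b) \<Rightarrow> bool"
  where "curve_in M p v \<gamma> \<longleftrightarrow>
    (\<exists>\<epsilon>>0. smooth_on {-\<epsilon><..<\<epsilon>} \<gamma> \<and> \<gamma> ` {-\<epsilon><..<\<epsilon>} \<subseteq> M) \<and>
    \<gamma> 0 = p \<and> (\<gamma> has_vector_derivative v) (at 0)"

definition tangent_space :: "'b::real_normed_vector set \<Rightarrow> 'b \<Rightarrow> 'b set"
  where "tangent_space M p = {v. \<exists>\<gamma>. curve_in M p v \<gamma>}"


section \<open>Semi-Riemannian metrics on submanifolds\<close>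

text \<open>A metric is given as \<open>g p v w\<close> and only matters for \<open>p \<in> M\<close> and \<open>v, w\<close> tangent
  to \<open>M\<close> at \<open>p\<close>.\<close>

definition metric_index :: "'b::euclidean_space set \<Rightarrow> ('b \<Rightarrow> 'b \<Rightarrow> 'b \<Rightarrow> real) \<Rightarrow> 'b \<Rightarrow> nat"
  where "metric_index M g p =
    Max {dim V | V. subspace V \<and> V \<subseteq> tangent_space M p \<and> (\<forall>v\<in>V. v \<noteq> 0 \<longrightarrow> g p v v < 0)}"

definition semi_riemannian_metric ::
    "'b::euclidean_space set \<Rightarrow> ('b \<Rightarrow> 'b \<Rightarrow> 'b \<Rightarrow> real) \<Rightarrow> bool"
  where "semi_riemannian_metric M g \<longleftrightarrow>
    (\<forall>p\<in>M. \<exists>U B. open U \<and> p \<in> U \<and> (\<forall>q\<in>U. bilinear (B q)) \<and>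
        (\<forall>v w. smooth_on U (\<lambda>q. B q v w)) \<and>
        (\<forall>q\<in>M \<inter> U. \<forall>v\<in>tangent_space M q. \<forall>w\<in>tangent_space M q. g q v w = (B q v w :: real))) \<and>
    (\<forall>p\<in>M. \<forall>v\<in>tangent_space M p. \<forall>w\<in>tangent_space M p. g p v w = g p w v) \<and>
    (\<forall>p\<in>M. \<forall>v\<in>tangent_space M p. (\<forall>w\<in>tangent_space M p. g p v w = 0) \<longrightarrow> v = 0) \<and>
    (\<forall>p\<in>M. \<forall>q\<in>M. metric_index M g p = metric_index M g q)"


section \<open>Matrix Lie groups and their real Lie algebras\<close>

text \<open>Matrix multiplication is \<open>**\<close> and the identity matrix is \<open>mat 1\<close>: on these types the
  symbols \<open>*\<close> and \<open>1\<close> are componentwise. Linear notions (\<open>subspace\<close>, \<open>span\<close>,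
  \<open>independent\<close>, \<open>representation\<close>) are those over the real numbers.\<close>

definition matrix_lie_group :: "(complex^'n^'n) set \<Rightarrow> bool"
  where "matrix_lie_group G \<longleftrightarrow>
    mat 1 \<in> G \<and> (\<forall>g\<in>G. \<forall>h\<in>G. g ** h \<in> G) \<and>
    (\<forall>g\<in>G. invertible g \<and> matrix_inv g \<in> G) \<and>
    closedin (top_of_set {g. invertible g}) G"

definition lie_algebra :: "(complex^'n^'n) set \<Rightarrow> (complex^'n^'n) set"
  where "lie_algebra G = tangent_space G (mat 1)"

definition lie_bracket :: "complex^'n^'n \<Rightarrow> complex^'n^'n \<Rightarrow> complex^'n^'n"
  where "lie_bracket X Y = X ** Y - Y ** X"

definition lie_ideal :: "(complex^'n^'n) set \<Rightarrow> (complex^'n^'n) set \<Rightarrow> bool"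
  where "lie_ideal \<gg> \<aa> \<longleftrightarrow>
    subspace \<aa> \<and> \<aa> \<subseteq> \<gg> \<and> (\<forall>X\<in>\<gg>. \<forall>Y\<in>\<aa>. lie_bracket X Y \<in> \<aa>)"

definition derived_algebra :: "(complex^'n^'n) set \<Rightarrow> (complex^'n^'n) set"
  where "derived_algebra \<aa> = span {lie_bracket X Y | X Y. X \<in> \<aa> \<and> Y \<in> \<aa>}"

definition solvable_lie_algebra :: "(complex^'n^'n) set \<Rightarrow> bool"
  where "solvable_lie_algebra \<aa> \<longleftrightarrow> (\<exists>m. (derived_algebra ^^ m) \<aa> = {0})"

definition semisimple_lie_algebra :: "(complex^'n^'n) set \<Rightarrow> bool"
  where "semisimple_lie_algebra \<gg> \<longleftrightarrow>
    (\<forall>\<aa>. lie_ideal \<gg> \<aa> \<and> solvable_lie_algebra \<aa> \<longrightarrow> \<aa> = {0})"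

text \<open>Trace of an endomorphism \<open>T\<close> of a finite-dimensional real subspace \<open>V\<close>, computed in
  some basis of \<open>V\<close> (it does not depend on which).\<close>

definition trace_on :: "'b::euclidean_space set \<Rightarrow> ('b \<Rightarrow> 'b) \<Rightarrow> real"
  where "trace_on V T =
    (let B = (SOME B. independent B \<and> span B = V) in \<Sum>b\<in>B. representation B (T b) b)"

definition killing_form ::
    "(complex^'n^'n) set \<Rightarrow> complex^'n^'n \<Rightarrow> complex^'n^'n \<Rightarrow> real"
  where "killing_form \<gg> X Y = trace_on \<gg> (\<lambda>Z. lie_bracket X (lie_bracket Y Z))"


section \<open>Normal homogeneous and k-symmetric spaces\<close>

text \<open>\<open>M\<close> is a submanifold on which \<open>G\<close> acts smoothly and transitively with isotropy group
  \<open>H\<close> at \<open>p0\<close> and with submersive orbit maps, so that \<open>M\<close> is \<open>G/H\<close>.\<close>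

definition homogeneous_space ::
    "(complex^'n^'n) set \<Rightarrow> (complex^'n^'n) set \<Rightarrow> (complex^'n^'n \<Rightarrow> 'b \<Rightarrow> 'b) \<Rightarrow>
     'b::euclidean_space set \<Rightarrow> 'b \<Rightarrow> bool"
  where "homogeneous_space G H act M p0 \<longleftrightarrow>
    matrix_lie_group G \<and> embedded_submanifold M \<and> p0 \<in> M \<and>
    smooth_map_on (G \<times> M) (\<lambda>(g, p). act g p) \<and>
    (\<forall>p\<in>M. act (mat 1) p = p) \<and>
    (\<forall>g\<in>G. \<forall>p\<in>M. act g p \<in> M) \<and>
    (\<forall>g\<in>G. \<forall>h\<in>G. \<forall>p\<in>M. act (g ** h) p = act g (act h p)) \<and>
    (\<forall>p\<in>M. \<forall>q\<in>M. \<exists>g\<in>G. act g p = q) \<and>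
    H = {g \<in> G. act g p0 = p0} \<and>
    (\<forall>p\<in>M. \<forall>v\<in>tangent_space M p. \<exists>X \<gamma>. curve_in G (mat 1) X \<gamma> \<and>
       ((\<lambda>t. act (\<gamma> t) p) has_vector_derivative v) (at 0))"

definition killing_complement :: "(complex^'n^'n) set \<Rightarrow> (complex^'n^'n) set \<Rightarrow> (complex^'n^'n) set"
  where "killing_complement \<gg> \<hh> = {X \<in> \<gg>. \<forall>Y\<in>\<hh>. killing_form \<gg> X Y = 0}"

text \<open>The metric on \<open>G/H\<close> induced from \<open>r\<close> times the Killing form: the Killing-orthogonal
  complement of the isotropy algebra is identified with the tangent space at \<open>p0\<close>, and the
  resulting scalar product is transported to \<open>act a p0\<close> by \<open>a\<close>.\<close>

definition induced_from_killing ::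
    "(complex^'n^'n) set \<Rightarrow> (complex^'n^'n) set \<Rightarrow> (complex^'n^'n \<Rightarrow> 'b \<Rightarrow> 'b) \<Rightarrow>
     'b::euclidean_space \<Rightarrow> real \<Rightarrow> ('b \<Rightarrow> 'b \<Rightarrow> 'b \<Rightarrow> real) \<Rightarrow> bool"
  where "induced_from_killing G H act p0 r g \<longleftrightarrow>
    (\<forall>a\<in>G. \<forall>X \<in> killing_complement (lie_algebra G) (lie_algebra H).
      \<forall>Y \<in> killing_complement (lie_algebra G) (lie_algebra H).
      \<forall>\<gamma> \<delta>. curve_in G (mat 1) X \<gamma> \<longrightarrow> curve_in G (mat 1) Y \<delta> \<longrightarrow>
        g (act a p0) (vector_derivative (\<lambda>t. act (a ** \<gamma> t) p0) (at 0))
                     (vector_derivative (\<lambda>t. act (a ** \<delta> t) p0) (at 0))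
          = r * killing_form (lie_algebra G) X Y)"

definition normal_homogeneous_space ::
    "(complex^'n^'n) set \<Rightarrow> (complex^'n^'n) set \<Rightarrow> (complex^'n^'n \<Rightarrow> 'b \<Rightarrow> 'b) \<Rightarrow>
     'b::euclidean_space set \<Rightarrow> 'b \<Rightarrow> real \<Rightarrow> ('b \<Rightarrow> 'b \<Rightarrow> 'b \<Rightarrow> real) \<Rightarrow> bool"
  where "normal_homogeneous_space G H act M p0 r g \<longleftrightarrow>
    homogeneous_space G H act M p0 \<and> semisimple_lie_algebra (lie_algebra G) \<and>
    semi_riemannian_metric M g \<and> r \<noteq> 0 \<and> induced_from_killing G H act p0 r g"

definition automorphism_of_order ::
    "nat \<Rightarrow> (complex^'n^'n) set \<Rightarrow> (complex^'n^'n \<Rightarrow> complex^'n^'n) \<Rightarrow> bool"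
  where "automorphism_of_order k G \<tau> \<longleftrightarrow>
    bij_betw \<tau> G G \<and> (\<forall>g\<in>G. \<forall>h\<in>G. \<tau> (g ** h) = \<tau> g ** \<tau> h) \<and> smooth_map_on G \<tau> \<and>
    (\<forall>g\<in>G. (\<tau> ^^ k) g = g) \<and> (\<forall>j. 0 < j \<and> j < k \<longrightarrow> (\<exists>g\<in>G. (\<tau> ^^ j) g \<noteq> g))"

definition k_symmetric_space ::
    "nat \<Rightarrow> (complex^'n^'n \<Rightarrow> complex^'n^'n) \<Rightarrow>
     (complex^'n^'n) set \<Rightarrow> (complex^'n^'n) set \<Rightarrow> (complex^'n^'n \<Rightarrow> 'b \<Rightarrow> 'b) \<Rightarrow>
     'b::euclidean_space set \<Rightarrow> 'b \<Rightarrow> real \<Rightarrow> ('b \<Rightarrow> 'b \<Rightarrow> 'b \<Rightarrow> real) \<Rightarrow> bool"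
  where "k_symmetric_space k \<tau> G H act M p0 r g \<longleftrightarrow>
    k > 2 \<and> normal_homogeneous_space G H act M p0 r g \<and> automorphism_of_order k G \<tau> \<and>
    connected_component_set {a \<in> G. \<tau> a = a} (mat 1) \<subseteq> H \<and> H \<subseteq> {a \<in> G. \<tau> a = a}"


section \<open>The unit tangent sphere bundle of hyperbolic 3-space\<close>

type_synonym cmat2 = "complex^2^2"

definition mat2 :: "complex \<Rightarrow> complex \<Rightarrow> complex \<Rightarrow> complex \<Rightarrow> cmat2"
  where "mat2 a b c d = vector [vector [a, b], vector [c, d]]"

definition madj :: "cmat2 \<Rightarrow> cmat2"
  where "madj A = (\<chi> i j. cnj (A $ j $ i))"

definition mcnj :: "cmat2 \<Rightarrow> cmat2"
  where "mcnj A = (\<chi> i j. cnj (A $ i $ j))"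

definition Her2 :: "cmat2 set"
  where "Her2 = {\<xi>. madj \<xi> = \<xi>}"

text \<open>Polarization of \<open>\<xi> \<mapsto> - det \<xi>\<close>, which is real on Hermitian matrices.\<close>

definition lor :: "cmat2 \<Rightarrow> cmat2 \<Rightarrow> real"
  where "lor \<xi> \<eta> = - Re (det (\<xi> + \<eta>) - det \<xi> - det \<eta>) / 2"

definition e0 :: cmat2 where "e0 = mat2 1 0 0 1"
definition e1 :: cmat2 where "e1 = mat2 1 0 0 (-1)"
definition e2 :: cmat2 where "e2 = mat2 0 (-\<i>) \<i> 0"
definition e3 :: cmat2 where "e3 = mat2 0 1 1 0"

definition H3 :: "real \<Rightarrow> cmat2 set"
  where "H3 c = {\<xi> \<in> Her2. det \<xi> = of_real (1 / \<bar>c\<bar>) \<and> Re (trace \<xi>) > 0}"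

definition UH3 :: "real \<Rightarrow> (cmat2 \<times> cmat2) set"
  where "UH3 c = {(x, v). x \<in> H3 c \<and> v \<in> Her2 \<and> lor v v = 1 \<and> lor x v = 0}"

definition SL2C :: "cmat2 set"
  where "SL2C = {g. det g = 1}"

definition U1 :: "cmat2 set"
  where "U1 = {mat2 (exp (\<i> * of_real \<theta>)) 0 0 (exp (- \<i> * of_real \<theta>)) | \<theta>. True}"

definition SL2C_act :: "cmat2 \<Rightarrow> cmat2 \<times> cmat2 \<Rightarrow> cmat2 \<times> cmat2"
  where "SL2C_act g p = (g ** fst p ** madj g, g ** snd p ** madj g)"

definition UH3_base :: "real \<Rightarrow> cmat2 \<times> cmat2"
  where "UH3_base c = ((1 / sqrt \<bar>c\<bar>) *\<^sub>R e0, e1)"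

definition R4 :: cmat2
  where "R4 = mat2 (1 / csqrt \<i>) 0 0 (csqrt \<i>)"

definition tau_group :: "cmat2 \<Rightarrow> cmat2"
  where "tau_group g = R4 ** matrix_inv (madj g) ** matrix_inv R4"


section \<open>Eigenspaces on the complexified Lie algebra\<close>

text \<open>The differential of \<open>tau_group\<close> at the identity.\<close>

definition tau_alg :: "cmat2 \<Rightarrow> cmat2"
  where "tau_alg X = - (R4 ** madj X ** matrix_inv R4)"

text \<open>The complexification is \<open>sl\<^sub>2 \<times> sl\<^sub>2\<close> with the real form \<open>{(X, mcnj X)}\<close>; complex
  scalars act diagonally, on each entry of both matrices.\<close>

type_synonym gC = "cmat2 \<times> cmat2"

definition sl2C :: "cmat2 set"
  where "sl2C = {X. trace X = 0}"

definition gC_scale :: "complex \<Rightarrow> gC \<Rightarrow> gC"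
  where "gC_scale s Z = ((\<chi> i j. s * fst Z $ i $ j), (\<chi> i j. s * snd Z $ i $ j))"

definition tau_hat :: "gC \<Rightarrow> gC"
  where "tau_hat Z = (tau_alg (mcnj (snd Z)), mcnj (tau_alg (fst Z)))"

definition g_eig :: "int \<Rightarrow> gC set"
  where "g_eig k = {Z \<in> sl2C \<times> sl2C. tau_hat Z = gC_scale (\<i> powi k) Z}"

definition pC :: "gC set"
  where "pC = {A + B + C | A B C. A \<in> g_eig 1 \<and> B \<in> g_eig 2 \<and> C \<in> g_eig 3}"

text \<open>Projection onto \<open>pC\<close> along the fixed space \<open>g_eig 0\<close>.\<close>

definition p_part :: "gC \<Rightarrow> gC"
  where "p_part Z = (THE P. P \<in> pC \<and> Z - P \<in> g_eig 0)"

text \<open>The (1,0)-part of a real-linear form on the complex line with values in a complex vector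
  space: \<open>\<omega>'(v) = (\<omega>(v) - i \<omega>(i v)) / 2\<close>, that is \<open>\<omega>(\<partial>/\<partial>z) dz\<close>.\<close>

definition part10 :: "(complex \<Rightarrow> gC) \<Rightarrow> complex \<Rightarrow> gC"
  where "part10 \<omega> v = (1/2) *\<^sub>R (\<omega> v - gC_scale \<i> (\<omega> (\<i> * v)))"

lemma mat2_nth [simp]:
  "mat2 a b c d $ 1 $ 1 = a" "mat2 a b c d $ 1 $ 2 = b"
  "mat2 a b c d $ 2 $ 1 = c" "mat2 a b c d $ 2 $ 2 = d"
  by (simp_all add: mat2_def)

lemma tau_alg_mat2: "tau_alg (mat2 a b c (-a)) = mat2 (- cnj a) (\<i> * cnj c) (- \<i> * cnj b) (cnj a)"
proof -
  obtain r where r: "csqrt \<i> = r" "r * r = \<i>"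
    by (metis power2_csqrt power2_eq_square)
  then have nz: "r \<noteq> 0" by auto
  then have R: "R4 = mat2 (inverse r) 0 0 r" "inverse r * inverse r = - \<i>"
    using r by (simp_all add: R4_def inverse_eq_divide flip: inverse_mult_distrib del: csqrt_ii)
  have inv: "matrix_inv R4 = mat2 r 0 0 (inverse r)"
  proof -
    let ?S = "mat2 r 0 0 (inverse r)"
    have RS: "R4 ** ?S = mat 1" "?S ** R4 = mat 1"
      using nz by (simp_all add: R vec_eq_iff forall_2 matrix_matrix_mult_def sum_2 mat_def)
    have "R4 ** matrix_inv R4 = mat 1"
      unfolding matrix_inv_def by (rule someI2[where a = ?S]) (simp_all add: RS)
    then show ?thesis
      using RS(2) by (metis matrix_mul_assoc matrix_mul_lid matrix_mul_rid)
  qed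
  have eqs: "inverse r * x * inverse r = - \<i> * x" "r * x * r = \<i> * x" for x
    using R(2) r(2) by (metis mult.assoc mult.commute)+
  show ?thesis
    unfolding tau_alg_def inv unfolding R(1)
    using nz by (simp add: vec_eq_iff forall_2 matrix_matrix_mult_def sum_2 madj_def eqs)
qed

lemma tau_hat_real_form: "tau_hat (X, mcnj X) = (tau_alg X, mcnj (tau_alg X))"
  by (simp add: tau_hat_def mcnj_def)


section \<open>Surfaces, minimality and primitive maps\<close>

definition d_x :: "(complex \<Rightarrow> 'b::real_normed_vector) \<Rightarrow> complex \<Rightarrow> 'b"
  where "d_x f z = frechet_derivative f (at z) 1"

definition d_y :: "(complex \<Rightarrow> 'b::real_normed_vector) \<Rightarrow> complex \<Rightarrow> 'b"
  where "d_y f z = frechet_derivative f (at z) \<i>"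

text \<open>The proper orthochronous Lorentz group; index 1 is the timelike direction.\<close>

definition minkowski :: "real^4^4"
  where "minkowski = (\<chi> i j. if i = j then (if i = 1 then -1 else 1) else 0)"

definition SO13_plus :: "(real^4^4) set"
  where "SO13_plus = {A. transpose A ** minkowski ** A = minkowski \<and> det A = 1 \<and> A $ 1 $ 1 > 0}"

definition her_basis :: "cmat2^4"
  where "her_basis = vector [e0, e1, e2, e3]"

text \<open>A tuple of four vectors is read as the matrix whose columns are their coordinates with
  respect to \<open>her_basis\<close>.\<close>

definition in_SO13_plus :: "cmat2^4 \<Rightarrow> bool"
  where "in_SO13_plus E \<longleftrightarrow>
    (\<exists>A\<in>SO13_plus. \<forall>j. E $ j = (\<Sum>i\<in>UNIV. A $ i $ j *\<^sub>R her_basis $ i))"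

definition surface ::
    "real \<Rightarrow> complex set \<Rightarrow> (complex \<Rightarrow> cmat2) \<Rightarrow> (complex \<Rightarrow> cmat2) \<Rightarrow> (complex \<Rightarrow> real) \<Rightarrow> bool"
  where "surface c D f n u \<longleftrightarrow>
    smooth_on D f \<and> smooth_on D n \<and>
    (\<forall>z\<in>D. f z \<in> H3 c \<and>
       lor (d_x f z) (d_x f z) = exp (u z) \<and> lor (d_y f z) (d_y f z) = exp (u z) \<and>
       lor (d_x f z) (d_y f z) = 0 \<and>
       (f z, n z) \<in> UH3 c \<and> lor (n z) (d_x f z) = 0 \<and> lor (n z) (d_y f z) = 0 \<and>
       in_SO13_plus (vector [sqrt \<bar>c\<bar> *\<^sub>R f z, n z,
                             exp (- u z / 2) *\<^sub>R d_y f z, exp (- u z / 2) *\<^sub>R d_x f z]))"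

text \<open>The second fundamental form of \<open>f\<close> in \<open>H3 c\<close> has coefficients \<open>\<langle>f\<^sub>i\<^sub>j, n\<rangle>\<close>: the Levi-Civita
  connection of \<open>H3 c\<close> differs from the flat one by multiples of \<open>f\<close>, which is orthogonal
  to \<open>n\<close>.\<close>

definition mean_curvature :: "(complex \<Rightarrow> cmat2) \<Rightarrow> (complex \<Rightarrow> cmat2) \<Rightarrow> complex \<Rightarrow> real"
  where "mean_curvature f n z =
    (let E = lor (d_x f z) (d_x f z); F = lor (d_x f z) (d_y f z); G = lor (d_y f z) (d_y f z);
         L = lor (d_x (d_x f) z) (n z); M = lor (d_x (d_y f) z) (n z);
         N = lor (d_y (d_y f) z) (n z)
     in (E * N - 2 * F * M + G * L) / (2 * (E * G - F\<^sup>2)))"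

definition minimal_surface :: "complex set \<Rightarrow> (complex \<Rightarrow> cmat2) \<Rightarrow> (complex \<Rightarrow> cmat2) \<Rightarrow> bool"
  where "minimal_surface D f n \<longleftrightarrow> (\<forall>z\<in>D. mean_curvature f n z = 0)"

definition frame_of ::
    "real \<Rightarrow> complex set \<Rightarrow> (complex \<Rightarrow> cmat2 \<times> cmat2) \<Rightarrow> (complex \<Rightarrow> cmat2) \<Rightarrow> bool"
  where "frame_of c D F \<Phi> \<longleftrightarrow>
    smooth_on D \<Phi> \<and> \<Phi> ` D \<subseteq> SL2C \<and>
    (\<forall>z\<in>D. sqrt \<bar>c\<bar> *\<^sub>R fst (F z) = \<Phi> z ** madj (\<Phi> z) \<and>
           snd (F z) = \<Phi> z ** e1 ** madj (\<Phi> z))"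

definition maurer_cartan :: "(complex \<Rightarrow> cmat2) \<Rightarrow> complex \<Rightarrow> complex \<Rightarrow> cmat2"
  where "maurer_cartan \<Phi> z v = matrix_inv (\<Phi> z) ** frechet_derivative \<Phi> (at z) v"

definition maurer_cartan_C :: "(complex \<Rightarrow> cmat2) \<Rightarrow> complex \<Rightarrow> complex \<Rightarrow> gC"
  where "maurer_cartan_C \<Phi> z v = (maurer_cartan \<Phi> z v, mcnj (maurer_cartan \<Phi> z v))"

definition primitive_map :: "real \<Rightarrow> complex set \<Rightarrow> (complex \<Rightarrow> cmat2 \<times> cmat2) \<Rightarrow> bool"
  where "primitive_map c D F \<longleftrightarrow>
    (\<forall>\<Phi>. frame_of c D F \<Phi> \<longrightarrow>
      (\<forall>z\<in>D. \<forall>v. part10 (\<lambda>w. p_part (maurer_cartan_C \<Phi> z w)) v \<in> g_eig (-1)))"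

end

theory Submission
  imports Defs
begin

text \<open>
  \<^bold>\<open>The symmetric space.\<close> With \<open>congr g \<xi> = g \<xi> g\<^sup>*\<close> the special linear group acts on Hermitian matrices
  by isometries of the Lorentzian product, since it preserves determinants. Cholesky decomposition and
  the Hopf map show that it is transitive on the unit tangent bundle, and the stabilizer of the base
  point consists of the unitary diagonal matrices. The automorphism sends a matrix with rows
  \<open>(a, b)\<close>, \<open>(c, d)\<close> to the one with rows \<open>(cnj d, i cnj c)\<close>, \<open>(- i cnj b, cnj a)\<close>
  (\<open>tau_group_mat2\<close>); its square is conjugation by \<open>e1\<close>, so that it has order four, and its fixed points
  are exactly the isotropy group. The real Killing form is \<open>8 Re tr (X Y)\<close> (\<open>killing_form_sl2C\<close>). The
  orthogonal complement of the isotropy algebra consists of the traceless matrices with real diagonal, and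
  on the tangent vectors that these generate the Killing form can be expressed by the Lorentzian product
  (\<open>UH3_metric_base\<close>). The resulting expression makes sense for all ambient vectors and is invariant under the group,
  which yields the metric; nondegeneracy and constancy of the index follow by moving to the base point.

  \<^bold>\<open>Minimality and primitivity.\<close> In a frame, let \<open>a\<close>, \<open>b\<close>, \<open>c\<close> be the entries of the Maurer-Cartan form.
  The differentials of \<open>f\<close> and \<open>n\<close> are described by \<open>p = b + cnj c\<close> and \<open>q = cnj c - b\<close>, and the
  eigenspace condition becomes \<open>Re a = 0\<close>, \<open>p(1) = i p(i)\<close>, \<open>q(1) = - i q(i)\<close> for the values at the two coordinate
  directions 1 and \<open>i\<close> (\<open>primitive_at_iff\<close>). Normality, conformality and orientation give the first two conditions, and the third
  one says that the trace of the second fundamental form vanishes (\<open>minimal_at_iff_primitive_at\<close>).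
  The orientation enters through a trace of an alternating product of four Hermitian matrices, which is invariant
  under the group and computes the determinant of their coordinates (\<open>volume_trace_oriented\<close>).

  \<^bold>\<open>Existence of frames.\<close> Primitivity quantifies over all frames, so that it implies minimality only once a
  frame exists (\<open>frame_exists\<close>). The pair \<open>(f, n)\<close> and the normalized vector \<open>f\<^sub>x\<close> determine a matrix up to sign at every point.
  The map \<open>w \<mapsto> w w\<^sup>T\<close> is a two-fold covering away from zero, and its values at these matrices
  are polynomials in \<open>f\<close>, \<open>n\<close>, the normalized \<open>f\<^sub>x\<close> and their conjugates; over a simply connected domain they
  can be lifted.
\<close>


section \<open>Smooth maps\<close>

lemma frechet_derivative_cong_open:
  assumes "open S" "x \<in> S" "\<And>y. y \<in> S \<Longrightarrow> f y = g y"
  shows "frechet_derivative f (at x) = frechet_derivative g (at x)"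
proof -
  have "(f has_derivative D) (at x) \<longleftrightarrow> (g has_derivative D) (at x)" for D
    using has_derivative_transform_within_open[OF _ assms(1,2), of f D UNIV g]
      has_derivative_transform_within_open[OF _ assms(1,2), of g D UNIV f] assms(3) by auto
  then show ?thesis by (simp add: frechet_derivative_def)
qed

lemma frechet_derivative_eqI:
  "(f has_derivative D) (at x) \<Longrightarrow> frechet_derivative f (at x) v = D v"
  using frechet_derivative_at by metis

lemma Ck_on_cong:
  assumes "open S" "\<And>x. x \<in> S \<Longrightarrow> f x = g x"
  shows "Ck_on n S f \<longleftrightarrow> Ck_on n S g"
  using assms(2)
proof (induction n arbitrary: f g)
  case 0
  then show ?case using continuous_on_cong by (metis Ck_on.simps(1))
next
  case (Suc n)
  have "f differentiable (at x) \<longleftrightarrow> g differentiable (at x)" if "x \<in> S" for x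
    unfolding differentiable_def
    using has_derivative_transform_within_open[OF _ assms(1) that, of f _ UNIV g]
      has_derivative_transform_within_open[OF _ assms(1) that, of g _ UNIV f] Suc.prems by metis
  moreover have "frechet_derivative f (at x) v = frechet_derivative g (at x) v" if "x \<in> S" for x v
    using frechet_derivative_cong_open[OF assms(1) that Suc.prems] by simp
  then have "Ck_on n S (\<lambda>x. frechet_derivative f (at x) v) =
      Ck_on n S (\<lambda>x. frechet_derivative g (at x) v)" for v
    by (rule Suc.IH)
  ultimately show ?case by auto
qed

lemma smooth_on_cong:
  assumes "open S" "\<And>x. x \<in> S \<Longrightarrow> f x = g x"
  shows "smooth_on S f \<longleftrightarrow> smooth_on S g"
  using Ck_on_cong[OF assms] by (simp add: smooth_on_def)

lemma Ck_on_Suc_imp: "Ck_on (Suc n) S f \<Longrightarrow> Ck_on n S f"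
proof (induction n arbitrary: f)
  case 0
  then show ?case
    by (auto intro!: continuous_at_imp_continuous_on differentiable_imp_continuous_within)
qed auto

lemma Ck_on_SucI:
  assumes "open S" "\<And>x. x \<in> S \<Longrightarrow> (f has_derivative D x) (at x)" "\<And>v. Ck_on n S (\<lambda>x. D x v)"
  shows "Ck_on (Suc n) S f"
proof -
  have "Ck_on n S (\<lambda>x. frechet_derivative f (at x) v)" for v
    using Ck_on_cong[OF assms(1), of "\<lambda>x. frechet_derivative f (at x) v" "\<lambda>x. D x v"]
      frechet_derivative_eqI[OF assms(2)] assms(3) by auto
  then show ?thesis using assms(2) by (auto simp: differentiable_def)
qed

lemma Ck_on_Suc_has_derivative:
  "Ck_on (Suc n) S f \<Longrightarrow> x \<in> S \<Longrightarrow> (f has_derivative frechet_derivative f (at x)) (at x)"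
  using frechet_derivative_works by auto

lemma Ck_on_subset: "Ck_on n S f \<Longrightarrow> T \<subseteq> S \<Longrightarrow> Ck_on n T f"
  by (induction n arbitrary: f) (auto intro: continuous_on_subset)

lemma Ck_on_local:
  assumes "\<And>x. x \<in> S \<Longrightarrow> \<exists>U. open U \<and> x \<in> U \<and> Ck_on n U f"
  shows "Ck_on n S f"
  using assms
proof (induction n arbitrary: f)
  case 0
  then show ?case
    by (metis Ck_on.simps(1) continuous_at_imp_continuous_on continuous_on_eq_continuous_at)
next
  case (Suc n)
  have "f differentiable (at x)" if "x \<in> S" for x
    using Suc.prems[OF that] by auto
  moreover have "Ck_on n S (\<lambda>x. frechet_derivative f (at x) v)" for v
    using Suc.prems by (intro Suc.IH) fastforce
  ultimately show ?case by simp
qed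

lemma smooth_on_subset: "smooth_on S f \<Longrightarrow> T \<subseteq> S \<Longrightarrow> smooth_on T f"
  by (auto simp: smooth_on_def intro: Ck_on_subset)

lemma smooth_on_local:
  assumes "\<And>x. x \<in> S \<Longrightarrow> \<exists>U. open U \<and> x \<in> U \<and> smooth_on U f"
  shows "smooth_on S f"
  using Ck_on_local[of S _ f] assms unfolding smooth_on_def by blast

lemma smooth_on_imp_continuous_on: "smooth_on S f \<Longrightarrow> continuous_on S f"
  unfolding smooth_on_def by (metis Ck_on.simps(1))

lemma smooth_on_has_derivative:
  "smooth_on S f \<Longrightarrow> x \<in> S \<Longrightarrow> (f has_derivative frechet_derivative f (at x)) (at x)"
  unfolding smooth_on_def by (metis Ck_on.simps(2) frechet_derivative_works)

lemma smooth_on_frechet_derivative: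
  "smooth_on S f \<Longrightarrow> smooth_on S (\<lambda>x. frechet_derivative f (at x) v)"
  unfolding smooth_on_def by (metis Ck_on.simps(2))

lemma Ck_on_const: "Ck_on n S (\<lambda>x. k)"
  by (induction n arbitrary: k) auto

lemma smooth_on_const [simp]: "smooth_on S (\<lambda>x. k)"
  by (simp add: smooth_on_def Ck_on_const)

lemma Ck_on_linear_compose:
  assumes L: "bounded_linear L" and "open S"
  shows "Ck_on n S f \<Longrightarrow> Ck_on n S (\<lambda>x. L (f x))"
proof (induction n arbitrary: f)
  case 0
  then show ?case using bounded_linear.continuous_on[OF L] by auto
next
  case (Suc n)
  show ?case
  proof (rule Ck_on_SucI[OF \<open>open S\<close>, where D = "\<lambda>x v. L (frechet_derivative f (at x) v)"])
    show "((\<lambda>x. L (f x)) has_derivative (\<lambda>v. L (frechet_derivative f (at x) v))) (at x)"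
      if "x \<in> S" for x
      by (intro bounded_linear.has_derivative[OF L] Ck_on_Suc_has_derivative[OF Suc.prems that])
    show "Ck_on n S (\<lambda>x. L (frechet_derivative f (at x) v))" for v
      using Suc by auto
  qed
qed

lemma smooth_on_linear_compose:
  "bounded_linear L \<Longrightarrow> open S \<Longrightarrow> smooth_on S f \<Longrightarrow> smooth_on S (\<lambda>x. L (f x))"
  by (simp add: smooth_on_def Ck_on_linear_compose)

lemma Ck_on_id: "open S \<Longrightarrow> Ck_on n S (\<lambda>x. x)"
proof (cases n)
  case (Suc m)
  assume "open S"
  then show ?thesis unfolding Suc
    by (intro Ck_on_SucI[where D = "\<lambda>x v. v"]) (auto simp: Ck_on_const)
qed auto

lemma smooth_on_linear: "bounded_linear L \<Longrightarrow> open S \<Longrightarrow> smooth_on S L"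
  using Ck_on_linear_compose[of L S _ "\<lambda>x. x"] by (simp add: smooth_on_def Ck_on_id)

lemma Ck_on_add:
  "open S \<Longrightarrow> Ck_on n S f \<Longrightarrow> Ck_on n S g \<Longrightarrow> Ck_on n S (\<lambda>x. f x + g x)"
proof (induction n arbitrary: f g)
  case (Suc n)
  show ?case
  proof (rule Ck_on_SucI[OF \<open>open S\<close>, where
        D = "\<lambda>x v. frechet_derivative f (at x) v + frechet_derivative g (at x) v"])
    show "((\<lambda>x. f x + g x) has_derivative
        (\<lambda>v. frechet_derivative f (at x) v + frechet_derivative g (at x) v)) (at x)"
      if "x \<in> S" for x
      using Suc.prems that by (intro has_derivative_add Ck_on_Suc_has_derivative)
  qed (use Suc in auto)
qed (auto intro: continuous_intros)

lemma smooth_on_add: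
  "open S \<Longrightarrow> smooth_on S f \<Longrightarrow> smooth_on S g \<Longrightarrow> smooth_on S (\<lambda>x. f x + g x)"
  by (simp add: smooth_on_def Ck_on_add)

lemma smooth_on_minus: "open S \<Longrightarrow> smooth_on S f \<Longrightarrow> smooth_on S (\<lambda>x. - f x)"
  by (rule smooth_on_linear_compose[OF bounded_linear_minus[OF bounded_linear_ident]])

lemma smooth_on_diff:
  "open S \<Longrightarrow> smooth_on S f \<Longrightarrow> smooth_on S g \<Longrightarrow> smooth_on S (\<lambda>x. f x - g x)"
  using smooth_on_add[OF _ _ smooth_on_minus] by fastforce

lemma Ck_on_bilinear:
  assumes "bounded_bilinear b" and "open S"
  shows "Ck_on n S f \<Longrightarrow> Ck_on n S g \<Longrightarrow> Ck_on n S (\<lambda>x. b (f x) (g x))"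
proof (induction n arbitrary: f g)
  case 0
  then show ?case using bounded_bilinear.continuous_on[OF assms(1)] by auto
next
  case (Suc n)
  show ?case
  proof (rule Ck_on_SucI[OF \<open>open S\<close>, where
        D = "\<lambda>x v. b (f x) (frechet_derivative g (at x) v) + b (frechet_derivative f (at x) v) (g x)"])
    show "((\<lambda>x. b (f x) (g x)) has_derivative
        (\<lambda>v. b (f x) (frechet_derivative g (at x) v) + b (frechet_derivative f (at x) v) (g x))) (at x)"
      if "x \<in> S" for x
      using Suc.prems that by (intro bounded_bilinear.FDERIV[OF assms(1)] Ck_on_Suc_has_derivative)
    show "Ck_on n S (\<lambda>x. b (f x) (frechet_derivative g (at x) v) + b (frechet_derivative f (at x) v) (g x))" for v
      using Suc.prems Ck_on_Suc_imp[OF Suc.prems(1)] Ck_on_Suc_imp[OF Suc.prems(2)]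
      by (intro Ck_on_add[OF \<open>open S\<close>] Suc.IH) auto
  qed
qed

lemma smooth_on_bilinear:
  "bounded_bilinear b \<Longrightarrow> open S \<Longrightarrow> smooth_on S f \<Longrightarrow> smooth_on S g \<Longrightarrow>
    smooth_on S (\<lambda>x. b (f x) (g x))"
  by (simp add: smooth_on_def Ck_on_bilinear)

lemmas smooth_on_mult = smooth_on_bilinear[OF bounded_bilinear_mult]
lemmas smooth_on_scaleR = smooth_on_bilinear[OF bounded_bilinear_scaleR]

text \<open>Inverse and inverse square root are smooth because their derivatives are products of their own
  powers with the derivative of the argument, so that smoothness improves by one order at a time.\<close>

lemma smooth_on_inverse:
  fixes f :: "'a::real_normed_vector \<Rightarrow> 'b::real_normed_field"
  assumes "open S" "smooth_on S f" "\<And>x. x \<in> S \<Longrightarrow> f x \<noteq> 0"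
  shows "smooth_on S (\<lambda>x. inverse (f x))"
proof -
  have "Ck_on n S (\<lambda>x. inverse (f x))" for n
  proof (induction n)
    case 0
    then show ?case
      using smooth_on_imp_continuous_on[OF assms(2)] assms(3) by (auto intro!: continuous_intros)
  next
    case (Suc n)
    show ?case
    proof (rule Ck_on_SucI[OF \<open>open S\<close>, where
          D = "\<lambda>x v. - (inverse (f x) * frechet_derivative f (at x) v * inverse (f x))"])
      show "((\<lambda>x. inverse (f x)) has_derivative
        (\<lambda>v. - (inverse (f x) * frechet_derivative f (at x) v * inverse (f x)))) (at x)"
        if "x \<in> S" for x
        by (intro Deriv.has_derivative_inverse assms(3) smooth_on_has_derivative[OF assms(2)] that)
      have "Ck_on n S (\<lambda>x. frechet_derivative f (at x) v)" for v
        using smooth_on_frechet_derivative[OF assms(2)] by (auto simp: smooth_on_def)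
      then show "Ck_on n S (\<lambda>x. - (inverse (f x) * frechet_derivative f (at x) v * inverse (f x)))" for v
        by (intro Ck_on_linear_compose[OF bounded_linear_minus[OF bounded_linear_ident]]
            Ck_on_bilinear[OF bounded_bilinear_mult] Suc \<open>open S\<close>)
    qed
  qed
  then show ?thesis by (simp add: smooth_on_def)
qed

lemma smooth_on_inverse_sqrt:
  fixes f :: "'a::real_normed_vector \<Rightarrow> real"
  assumes "open S" "smooth_on S f" "\<And>x. x \<in> S \<Longrightarrow> f x > 0"
  shows "smooth_on S (\<lambda>x. inverse (sqrt (f x)))"
proof -
  have "Ck_on n S (\<lambda>x. inverse (sqrt (f x)))" for n
  proof (induction n)
    case 0
    then show ?case
      using smooth_on_imp_continuous_on[OF assms(2)] assms(3)
      by (force intro!: continuous_intros)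
  next
    case (Suc n)
    let ?r = "\<lambda>x. inverse (sqrt (f x))"
    let ?D = "\<lambda>x v. (-1/2) * (?r x * ?r x * ?r x * frechet_derivative f (at x) v)"
    show ?case
    proof (rule Ck_on_SucI[OF \<open>open S\<close>, where D = ?D])
      show "(?r has_derivative ?D x) (at x)" if "x \<in> S" for x
      proof -
        have "((\<lambda>y. inverse (sqrt y)) has_real_derivative (-1/2) * (?r x * ?r x * ?r x)) (at (f x))"
          using assms(3)[OF that]
          by (auto intro!: derivative_eq_intros simp: field_simps power2_eq_square)
        from has_derivative_compose[OF smooth_on_has_derivative[OF assms(2) that]
            this[unfolded has_field_derivative_def]]
        show ?thesis by (simp add: mult.assoc)
      qed
      have "Ck_on n S (\<lambda>x. frechet_derivative f (at x) v)" for v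
        using smooth_on_frechet_derivative[OF assms(2)] by (auto simp: smooth_on_def)
      then show "Ck_on n S (\<lambda>x. ?D x v)" for v
        by (intro Ck_on_bilinear[OF bounded_bilinear_mult] Suc \<open>open S\<close> Ck_on_const)
    qed
  qed
  then show ?thesis by (simp add: smooth_on_def)
qed

lemma smooth_on_Pair:
  assumes "open S" "smooth_on S f" "smooth_on S g"
  shows "smooth_on S (\<lambda>x. (f x, g x))"
proof -
  have "smooth_on S (\<lambda>x. (f x, 0) + (0, g x))"
    using assms by (intro smooth_on_add)
      (auto intro!: smooth_on_linear_compose[of "\<lambda>y. (y, 0)"] smooth_on_linear_compose[of "\<lambda>y. (0, y)"]
        bounded_linear_Pair bounded_linear_ident bounded_linear_zero)
  then show ?thesis by simp
qed

lemma smooth_map_onI: "smooth_on UNIV f \<Longrightarrow> smooth_map_on S f"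
  unfolding smooth_map_on_def by (metis open_UNIV UNIV_I)

section \<open>Symmetry of the second derivative\<close>

text \<open>The mean value theorem, applied first along \<open>v\<close> and then along \<open>w\<close>. The left-hand side is
  symmetric in \<open>v\<close> and \<open>w\<close>, so that the two mixed derivatives agree at two points near \<open>x\<close>; this
  is what makes them equal at \<open>x\<close> by continuity.\<close>

lemma mixed_second_difference:
  fixes f :: "'a::real_normed_vector \<Rightarrow> real"
  assumes "\<And>y. y \<in> ball x r \<Longrightarrow> f differentiable (at y)"
    and "\<And>y. y \<in> ball x r \<Longrightarrow> (\<lambda>y. frechet_derivative f (at y) v) differentiable (at y)"
    and "h > 0" "h * (norm v + norm w) < r"
  shows "\<exists>s t. 0 < s \<and> s < h \<and> 0 < t \<and> t < h \<and>
    f (x + h *\<^sub>R v + h *\<^sub>R w) - f (x + h *\<^sub>R v) - f (x + h *\<^sub>R w) + f x =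
    h * h * frechet_derivative (\<lambda>y. frechet_derivative f (at y) v) (at (x + s *\<^sub>R v + t *\<^sub>R w)) w"
proof -
  define D where "D y = frechet_derivative f (at y) v" for y
  have ball: "x + s *\<^sub>R v + t *\<^sub>R w \<in> ball x r" if "0 \<le> s" "s \<le> h" "0 \<le> t" "t \<le> h" for s t
  proof -
    have "norm (s *\<^sub>R v + t *\<^sub>R w) \<le> s * norm v + t * norm w"
      using norm_triangle_ineq[of "s *\<^sub>R v" "t *\<^sub>R w"] that by simp
    also have "\<dots> \<le> h * norm v + h * norm w"
      using that by (intro add_mono mult_right_mono) auto
    also have "\<dots> < r" using assms(4) by (simp add: algebra_simps)
    finally have "dist x (x + (s *\<^sub>R v + t *\<^sub>R w)) < r"
      by (simp only: dist_norm add_diff_cancel_left' norm_minus_commute[of x])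
    then show ?thesis by (simp add: add.assoc)
  qed
  define G where "G s = f (x + s *\<^sub>R v + h *\<^sub>R w) - f (x + s *\<^sub>R v + 0 *\<^sub>R w)" for s
  have fd: "((\<lambda>s. f (x + s *\<^sub>R v + t *\<^sub>R w)) has_real_derivative D (x + s *\<^sub>R v + t *\<^sub>R w)) (at s)"
    if "0 \<le> s" "s \<le> h" "0 \<le> t" "t \<le> h" for s t
  proof -
    have "(f has_derivative frechet_derivative f (at (x + s *\<^sub>R v + t *\<^sub>R w))) (at (x + s *\<^sub>R v + t *\<^sub>R w))"
      using assms(1)[OF ball[OF that]] frechet_derivative_works by blast
    then have "((\<lambda>s. f (x + s *\<^sub>R v + t *\<^sub>R w)) has_derivative
        (\<lambda>d. frechet_derivative f (at (x + s *\<^sub>R v + t *\<^sub>R w)) (d *\<^sub>R v))) (at s)"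
      by (rule has_derivative_compose[rotated]) (auto intro!: derivative_eq_intros)
    moreover have "linear (frechet_derivative f (at (x + s *\<^sub>R v + t *\<^sub>R w)))"
      using assms(1)[OF ball[OF that]] linear_frechet_derivative by blast
    ultimately show ?thesis
      by (simp add: has_field_derivative_def D_def linear_cmul mult.commute[of _ "frechet_derivative _ _ _"] mult_commute_abs)
  qed
  have "\<exists>s. 0 < s \<and> s < h \<and> G h - G 0 = (h - 0) * (D (x + s *\<^sub>R v + h *\<^sub>R w) - D (x + s *\<^sub>R v + 0 *\<^sub>R w))"
    unfolding G_def using \<open>h > 0\<close>
    by (intro MVT2 DERIV_diff fd) auto
  then obtain s where s: "0 < s" "s < h"
    "G h - G 0 = h * (D (x + s *\<^sub>R v + h *\<^sub>R w) - D (x + s *\<^sub>R v + 0 *\<^sub>R w))" by auto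
  have Dd: "((\<lambda>t. D (x + s *\<^sub>R v + t *\<^sub>R w)) has_real_derivative
      frechet_derivative D (at (x + s *\<^sub>R v + t *\<^sub>R w)) w) (at t)"
    if "0 \<le> t" "t \<le> h" for t
  proof -
    have b: "D differentiable (at (x + s *\<^sub>R v + t *\<^sub>R w))"
      using assms(2)[OF ball, of s t] s that unfolding D_def by auto
    then have "(D has_derivative frechet_derivative D (at (x + s *\<^sub>R v + t *\<^sub>R w))) (at (x + s *\<^sub>R v + t *\<^sub>R w))"
      using frechet_derivative_works by blast
    then have "((\<lambda>t. D (x + s *\<^sub>R v + t *\<^sub>R w)) has_derivative
        (\<lambda>d. frechet_derivative D (at (x + s *\<^sub>R v + t *\<^sub>R w)) (d *\<^sub>R w))) (at t)"
      by (rule has_derivative_compose[rotated]) (auto intro!: derivative_eq_intros)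
    moreover have "linear (frechet_derivative D (at (x + s *\<^sub>R v + t *\<^sub>R w)))"
      using b linear_frechet_derivative by blast
    ultimately show ?thesis
      by (simp add: has_field_derivative_def linear_cmul mult_commute_abs)
  qed
  have "\<exists>t. 0 < t \<and> t < h \<and> D (x + s *\<^sub>R v + h *\<^sub>R w) - D (x + s *\<^sub>R v + 0 *\<^sub>R w) =
      (h - 0) * frechet_derivative D (at (x + s *\<^sub>R v + t *\<^sub>R w)) w"
    using \<open>h > 0\<close> by (intro MVT2 Dd) auto
  then obtain t where t: "0 < t" "t < h" "D (x + s *\<^sub>R v + h *\<^sub>R w) - D (x + s *\<^sub>R v + 0 *\<^sub>R w) =
      h * frechet_derivative D (at (x + s *\<^sub>R v + t *\<^sub>R w)) w" by auto
  have "f (x + h *\<^sub>R v + h *\<^sub>R w) - f (x + h *\<^sub>R v) - f (x + h *\<^sub>R w) + f x = G h - G 0"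
    by (simp add: G_def)
  with s t show ?thesis unfolding D_def[abs_def]
    by (intro exI[of _ s] exI[of _ t]) simp
qed

lemma frechet_derivative_symmetric_real:
  fixes f :: "'a::real_normed_vector \<Rightarrow> real"
  assumes "open S" "x \<in> S" "smooth_on S f"
  shows "frechet_derivative (\<lambda>y. frechet_derivative f (at y) v) (at x) w =
         frechet_derivative (\<lambda>y. frechet_derivative f (at y) w) (at x) v"
proof (rule ccontr)
  define A where "A = (\<lambda>y. frechet_derivative (\<lambda>y. frechet_derivative f (at y) v) (at y) w)"
  define B where "B = (\<lambda>y. frechet_derivative (\<lambda>y. frechet_derivative f (at y) w) (at y) v)"
  assume "\<not> ?thesis"
  then have ne: "A x \<noteq> B x" by (simp add: A_def B_def)
  have diff: "g differentiable (at y)" if "smooth_on S g" "y \<in> S" for g :: "'a \<Rightarrow> real" and y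
    using smooth_on_has_derivative[OF that] by (auto simp: differentiable_def)
  define e where "e = \<bar>A x - B x\<bar> / 2"
  have "e > 0" using ne by (simp add: e_def)
  have "continuous_on S A" "continuous_on S B"
    unfolding A_def B_def
    by (intro smooth_on_imp_continuous_on smooth_on_frechet_derivative assms(3))+
  then have "isCont A x" "isCont B x"
    using assms(1,2) continuous_on_eq_continuous_at by blast+
  then have "\<exists>d>0. \<forall>y. dist y x < d \<longrightarrow> dist (A y) (A x) < e"
    "\<exists>d>0. \<forall>y. dist y x < d \<longrightarrow> dist (B y) (B x) < e"
    using \<open>e > 0\<close> unfolding continuous_at_eps_delta by auto
  then obtain d1 d2 where d: "d1 > 0" "d2 > 0"
    "\<And>y. dist y x < d1 \<Longrightarrow> dist (A y) (A x) < e" "\<And>y. dist y x < d2 \<Longrightarrow> dist (B y) (B x) < e"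
    by blast
  obtain d3 where d3: "d3 > 0" "ball x d3 \<subseteq> S" using assms(1,2) open_contains_ball by blast
  define r where "r = min d1 (min d2 d3)"
  have r: "r > 0" "r \<le> d1" "r \<le> d2" "r \<le> d3" using d d3 by (auto simp: r_def)
  define h where "h = r / (2 * (norm v + norm w + 1))"
  have pos: "norm v + norm w + 1 > 0" by (simp add: add_nonneg_pos)
  then have h: "h > 0" using r by (simp add: h_def)
  have "h * (norm v + norm w + 1) = r / 2" using pos by (simp add: h_def field_simps)
  then have hr: "h * (norm v + norm w) < r" using r h by (simp add: algebra_simps)
  then have hr': "h * (norm w + norm v) < r" by (simp add: add.commute)
  have near: "dist (x + (s *\<^sub>R v + t *\<^sub>R w)) x < r" if "0 < s" "s < h" "0 < t" "t < h" for s t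
  proof -
    have "norm (s *\<^sub>R v + t *\<^sub>R w) \<le> s * norm v + t * norm w"
      using norm_triangle_ineq[of "s *\<^sub>R v" "t *\<^sub>R w"] that by simp
    also have "\<dots> \<le> h * norm v + h * norm w"
      using that by (intro add_mono mult_right_mono) auto
    finally show ?thesis using hr by (simp add: dist_norm algebra_simps)
  qed
  have inS: "y \<in> S" if "y \<in> ball x r" for y using that r d3 by auto
  obtain s t where st: "0 < s" "s < h" "0 < t" "t < h"
    "f (x + h *\<^sub>R v + h *\<^sub>R w) - f (x + h *\<^sub>R v) - f (x + h *\<^sub>R w) + f x = h * h * A (x + s *\<^sub>R v + t *\<^sub>R w)"
    using mixed_second_difference[of x r f v h w, OF diff[OF assms(3) inS]
        diff[OF smooth_on_frechet_derivative[OF assms(3)] inS] h hr] unfolding A_def by blast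
  obtain s' t' where st': "0 < s'" "s' < h" "0 < t'" "t' < h"
    "f (x + h *\<^sub>R w + h *\<^sub>R v) - f (x + h *\<^sub>R w) - f (x + h *\<^sub>R v) + f x = h * h * B (x + s' *\<^sub>R w + t' *\<^sub>R v)"
    using mixed_second_difference[of x r f w h v, OF diff[OF assms(3) inS]
        diff[OF smooth_on_frechet_derivative[OF assms(3)] inS] h hr'] unfolding B_def by blast
  have "h * h * A (x + s *\<^sub>R v + t *\<^sub>R w) = h * h * B (x + s' *\<^sub>R w + t' *\<^sub>R v)"
    using st(5) st'(5) by (simp add: algebra_simps)
  then have "A (x + s *\<^sub>R v + t *\<^sub>R w) = B (x + s' *\<^sub>R w + t' *\<^sub>R v)" using h by simp
  moreover have "dist (A (x + s *\<^sub>R v + t *\<^sub>R w)) (A x) < e"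
    using d(3) near[OF st(1-4)] r by (auto simp: add.assoc)
  moreover have "dist (B (x + s' *\<^sub>R w + t' *\<^sub>R v)) (B x) < e"
    using d(4) near[OF st'(3,4) st'(1,2)] r by (auto simp: add.assoc add.commute[of "s' *\<^sub>R w"])
  ultimately have "\<bar>A x - B x\<bar> < 2 * e" unfolding dist_real_def by linarith
  then show False by (simp add: e_def)
qed

lemma frechet_derivative_symmetric:
  fixes f :: "'a::real_normed_vector \<Rightarrow> 'b::euclidean_space"
  assumes "open S" "x \<in> S" "smooth_on S f"
  shows "frechet_derivative (\<lambda>y. frechet_derivative f (at y) v) (at x) w =
         frechet_derivative (\<lambda>y. frechet_derivative f (at y) w) (at x) v"
proof (rule euclidean_eqI)
  fix b :: 'b
  assume "b \<in> Basis"
  have bl: "bounded_linear (\<lambda>y. y \<bullet> b)" by (rule bounded_linear_inner_left)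
  have 1: "frechet_derivative (\<lambda>y. g y \<bullet> b) (at y) u = frechet_derivative g (at y) u \<bullet> b"
    if "smooth_on S g" "y \<in> S" for g :: "'a \<Rightarrow> 'b" and y u
    by (rule frechet_derivative_eqI)
      (intro bounded_linear.has_derivative[OF bl] smooth_on_has_derivative[OF that])
  have 2: "frechet_derivative (\<lambda>y. frechet_derivative (\<lambda>y. f y \<bullet> b) (at y) v) (at x) w =
     frechet_derivative (\<lambda>y. frechet_derivative f (at y) v) (at x) w \<bullet> b" for v w
  proof -
    have "frechet_derivative (\<lambda>y. frechet_derivative (\<lambda>y. f y \<bullet> b) (at y) v) (at x)
      = frechet_derivative (\<lambda>y. frechet_derivative f (at y) v \<bullet> b) (at x)"
      using 1[OF assms(3)] by (intro frechet_derivative_cong_open[OF assms(1,2)]) auto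
    then show ?thesis using 1[OF smooth_on_frechet_derivative[OF assms(3)] assms(2)] by simp
  qed
  show "frechet_derivative (\<lambda>y. frechet_derivative f (at y) v) (at x) w \<bullet> b =
         frechet_derivative (\<lambda>y. frechet_derivative f (at y) w) (at x) v \<bullet> b"
    using frechet_derivative_symmetric_real[OF assms(1,2) smooth_on_linear_compose[OF bl assms(1,3)], of v w]
    by (simp add: 2)
qed


section \<open>Two-by-two matrices\<close>

lemma mat2_exhaust: obtains a b c d where "A = mat2 a b c d"
proof
  show "A = mat2 (A $ 1 $ 1) (A $ 1 $ 2) (A $ 2 $ 1) (A $ 2 $ 2)"
    by (simp add: vec_eq_iff forall_2)
qed

lemma mat2_eq_iff [simp]:
  "mat2 a b c d = mat2 a' b' c' d' \<longleftrightarrow> a = a' \<and> b = b' \<and> c = c' \<and> d = d'"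
  by (auto simp: vec_eq_iff forall_2)

lemma mat2_simps [simp]:
  "mat2 a b c d + mat2 a' b' c' d' = mat2 (a + a') (b + b') (c + c') (d + d')"
  "mat2 a b c d - mat2 a' b' c' d' = mat2 (a - a') (b - b') (c - c') (d - d')"
  "- mat2 a b c d = mat2 (- a) (- b) (- c) (- d)"
  "r *\<^sub>R mat2 a b c d = mat2 (r *\<^sub>R a) (r *\<^sub>R b) (r *\<^sub>R c) (r *\<^sub>R d)"
  "mat2 a b c d ** mat2 a' b' c' d' =
     mat2 (a * a' + b * c') (a * b' + b * d') (c * a' + d * c') (c * b' + d * d')"
  "madj (mat2 a b c d) = mat2 (cnj a) (cnj c) (cnj b) (cnj d)"
  "mcnj (mat2 a b c d) = mat2 (cnj a) (cnj b) (cnj c) (cnj d)"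
  "det (mat2 a b c d) = a * d - b * c"
  "trace (mat2 a b c d) = a + d"
  "mat2 a b c d \<bullet> mat2 a' b' c' d' = a \<bullet> a' + b \<bullet> b' + c \<bullet> c' + d \<bullet> d'"
  by (simp_all add: vec_eq_iff forall_2 matrix_matrix_mult_def sum_2 madj_def mcnj_def det_2
      trace_def inner_vec_def)

lemma zero_mat2: "0 = mat2 0 0 0 0" and one_mat2: "mat 1 = mat2 1 0 0 1"
  by (simp_all add: vec_eq_iff forall_2 mat_def)

lemma mat2_eq_0_iff [simp]: "mat2 a b c d = 0 \<longleftrightarrow> a = 0 \<and> b = 0 \<and> c = 0 \<and> d = 0"
  by (simp add: zero_mat2)

lemma det_scaleR: "det (r *\<^sub>R A) = of_real (r * r) * det A" for A :: cmat2
  by (cases A rule: mat2_exhaust) (simp add: scaleR_conv_of_real[where ?'a = complex] algebra_simps)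

lemma trace_scaleR: "trace (r *\<^sub>R A) = r *\<^sub>R trace A" for A :: cmat2
  by (cases A rule: mat2_exhaust) (simp add: scaleR_add_right)

lemma matrix_inv_eqI:
  fixes A B :: "complex^'n^'n"
  assumes "A ** B = mat 1" "B ** A = mat 1"
  shows "matrix_inv A = B"
proof -
  have "A ** matrix_inv A = mat 1"
    unfolding matrix_inv_def by (rule someI2[where a = B]) (use assms in auto)
  then show ?thesis
    using assms(2) by (metis matrix_mul_assoc matrix_mul_lid matrix_mul_rid)
qed

lemma matrix_inv_mat2: "a * d - b * c = 1 \<Longrightarrow> matrix_inv (mat2 a b c d) = mat2 d (- b) (- c) a"
  by (rule matrix_inv_eqI) (auto simp: one_mat2 algebra_simps)

lemma SL2C_iff [simp]: "mat2 a b c d \<in> SL2C \<longleftrightarrow> a * d - b * c = 1"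
  by (simp add: SL2C_def)

lemma SL2C_exhaust:
  assumes "g \<in> SL2C"
  obtains a b c d where "g = mat2 a b c d" "a * d - b * c = 1"
  using assms by (cases g rule: mat2_exhaust) auto

lemma SL2C_inv:
  assumes "g \<in> SL2C"
  shows "matrix_inv g \<in> SL2C" "g ** matrix_inv g = mat 1" "matrix_inv g ** g = mat 1"
proof -
  from assms obtain a b c d where g: "g = mat2 a b c d" "a * d - b * c = 1" by (rule SL2C_exhaust)
  then show "matrix_inv g \<in> SL2C" "g ** matrix_inv g = mat 1" "matrix_inv g ** g = mat 1"
    by (auto simp: matrix_inv_mat2 one_mat2 algebra_simps)
qed

lemma SL2C_mult: "g \<in> SL2C \<Longrightarrow> h \<in> SL2C \<Longrightarrow> g ** h \<in> SL2C"
  by (simp add: SL2C_def det_mul)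

lemma SL2C_one: "mat 1 \<in> SL2C"
  by (simp add: SL2C_def)

lemma SL2C_madj: "g \<in> SL2C \<Longrightarrow> madj g \<in> SL2C"
  by (erule SL2C_exhaust) (simp, metis complex_cnj_diff complex_cnj_mult complex_cnj_one mult.commute)

lemma madj_add: "madj (A + B) = madj A + madj B"
  and madj_scaleR: "madj (r *\<^sub>R A) = r *\<^sub>R madj A"
  and madj_mult: "madj (A ** B) = madj B ** madj A"
  and madj_madj [simp]: "madj (madj A) = A"
  and det_madj: "det (madj A) = cnj (det A)"
  by (cases A rule: mat2_exhaust; cases B rule: mat2_exhaust; simp add: mult.commute)+

lemma bounded_linear_madj: "bounded_linear madj"
  by (intro linear_conv_bounded_linear[THEN iffD1] linearI madj_add madj_scaleR)

lemma bounded_bilinear_matrix_mult: "bounded_bilinear ((**) :: cmat2 \<Rightarrow> cmat2 \<Rightarrow> cmat2)"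
proof -
  have "(A + B) ** C = A ** C + B ** C" "C ** (A + B) = C ** A + C ** B"
    "(r *\<^sub>R A) ** C = r *\<^sub>R (A ** C)" "C ** (r *\<^sub>R A) = r *\<^sub>R (C ** A)" for A B C :: cmat2 and r
    by (cases A rule: mat2_exhaust; cases B rule: mat2_exhaust; cases C rule: mat2_exhaust;
        simp add: algebra_simps scaleR_add_right)+
  then show ?thesis
    unfolding bilinear_conv_bounded_bilinear[symmetric] bilinear_def by (auto intro!: linearI)
qed

lemma smooth_on_mat2:
  assumes "open S" "smooth_on S a" "smooth_on S b" "smooth_on S c" "smooth_on S d"
  shows "smooth_on S (\<lambda>x. mat2 (a x) (b x) (c x) (d x))"
proof -
  have "bounded_linear (\<lambda>z. mat2 z 0 0 0)" "bounded_linear (\<lambda>z. mat2 0 z 0 0)"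
    "bounded_linear (\<lambda>z. mat2 0 0 z 0)" "bounded_linear (\<lambda>z. mat2 0 0 0 z)"
    by (intro linear_conv_bounded_linear[THEN iffD1] linearI; simp)+
  then have "smooth_on S (\<lambda>x. mat2 (a x) 0 0 0 + mat2 0 (b x) 0 0 + mat2 0 0 (c x) 0 + mat2 0 0 0 (d x))"
    using assms by (intro smooth_on_add)
      (auto intro: smooth_on_linear_compose[of "\<lambda>z. mat2 z 0 0 0"]
        smooth_on_linear_compose[of "\<lambda>z. mat2 0 z 0 0"]
        smooth_on_linear_compose[of "\<lambda>z. mat2 0 0 z 0"] smooth_on_linear_compose[of "\<lambda>z. mat2 0 0 0 z"])
  then show ?thesis by simp
qed

lemma bounded_linear_entry: "bounded_linear (\<lambda>A :: cmat2. A $ i $ j)"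
  by (rule bounded_linear_compose[OF bounded_linear_vec_nth bounded_linear_vec_nth])


section \<open>The action of the special linear group on Hermitian matrices\<close>

definition congr :: "cmat2 \<Rightarrow> cmat2 \<Rightarrow> cmat2"
  where "congr g \<xi> = g ** \<xi> ** madj g"

lemma congr_add: "congr g (\<xi> + \<eta>) = congr g \<xi> + congr g \<eta>"
  and congr_scaleR: "congr g (r *\<^sub>R \<xi>) = r *\<^sub>R congr g \<xi>"
  unfolding congr_def
  using bounded_bilinear.add_left[OF bounded_bilinear_matrix_mult] bounded_bilinear.add_right[OF bounded_bilinear_matrix_mult]
    bounded_bilinear.scaleR_left[OF bounded_bilinear_matrix_mult] bounded_bilinear.scaleR_right[OF bounded_bilinear_matrix_mult]
  by simp_all

lemma bounded_linear_congr: "bounded_linear (congr g)"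
  by (intro linear_conv_bounded_linear[THEN iffD1] linearI congr_add congr_scaleR)

lemma congr_congr: "congr g (congr h \<xi>) = congr (g ** h) \<xi>"
  by (simp add: congr_def madj_mult matrix_mul_assoc)

lemma congr_one [simp]: "congr (mat 1) \<xi> = \<xi>"
proof -
  have "madj (mat 1) = mat 1" by (simp add: one_mat2)
  then show ?thesis by (simp add: congr_def)
qed

lemma congr_inv:
  assumes "g \<in> SL2C"
  shows "congr (matrix_inv g) (congr g \<xi>) = \<xi>" "congr g (congr (matrix_inv g) \<xi>) = \<xi>"
  using SL2C_inv[OF assms] by (simp_all add: congr_congr)

lemma congr_madj: "madj (congr g \<xi>) = congr g (madj \<xi>)"
  by (simp add: congr_def madj_mult matrix_mul_assoc)

lemma det_congr: "g \<in> SL2C \<Longrightarrow> det (congr g \<xi>) = det \<xi>"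
  by (simp add: congr_def det_mul det_madj SL2C_def)

lemma lor_congr: "g \<in> SL2C \<Longrightarrow> lor (congr g \<xi>) (congr g \<eta>) = lor \<xi> \<eta>"
  by (simp add: lor_def det_congr flip: congr_add)

lemma lor_mat2: "lor (mat2 a b c d) (mat2 a' b' c' d') = - Re (a * d' + a' * d - b * c' - b' * c) / 2"
  by (simp add: lor_def algebra_simps)

lemma lor_self: "lor y y = - Re (det y)"
  by (cases y rule: mat2_exhaust) (simp add: lor_mat2)

lemma lor_commute: "lor \<xi> \<eta> = lor \<eta> \<xi>"
  by (simp add: lor_def add.commute)

lemma bounded_bilinear_lor: "bounded_bilinear lor"
proof -
  have "lor (A + B) C = lor A C + lor B C" "lor (r *\<^sub>R A) C = r * lor A C" for A B C r
    by (cases A rule: mat2_exhaust; cases B rule: mat2_exhaust; cases C rule: mat2_exhaust;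
        simp add: lor_mat2 field_simps)+
  then show ?thesis
    unfolding bilinear_conv_bounded_bilinear[symmetric] bilinear_def
    by (auto intro!: linearI simp: lor_commute[of _ "_ + _"] lor_commute[of _ "_ *\<^sub>R _"]) (simp_all add: lor_commute)
qed

lemma Her2_exhaust:
  assumes "\<xi> \<in> Her2"
  obtains p q z where "\<xi> = mat2 (of_real p) z (cnj z) (of_real q)"
proof -
  obtain a b c d where \<xi>: "\<xi> = mat2 a b c d" by (rule mat2_exhaust)
  with assms have "cnj a = a" "cnj d = d" "c = cnj b" by (auto simp: Her2_def)
  then have "\<xi> = mat2 (of_real (Re a)) b (cnj b) (of_real (Re d))"
    by (simp add: \<xi> complex_eq_iff)
  then show ?thesis by (rule that)
qed

lemma Her2_iff [simp]: "mat2 a b c d \<in> Her2 \<longleftrightarrow> Im a = 0 \<and> Im d = 0 \<and> c = cnj b"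
  by (auto simp: Her2_def complex_eq_iff)

lemma Her2_congr: "\<xi> \<in> Her2 \<Longrightarrow> congr g \<xi> \<in> Her2"
  by (simp add: Her2_def congr_madj)

lemma Her2_congr_iff: "g \<in> SL2C \<Longrightarrow> congr g \<xi> \<in> Her2 \<longleftrightarrow> \<xi> \<in> Her2"
  using Her2_congr congr_inv(1) by metis

text \<open>The Cholesky decomposition: the factor \<open>g\<close> is lower triangular, and its first column is that of \<open>x\<close>
  divided by the square root of the upper left entry.\<close>

lemma Cholesky:
  assumes "x \<in> Her2" "det x = 1" "Re (trace x) > 0"
  obtains g where "g \<in> SL2C" "congr g (mat 1) = x"
proof -
  from assms(1) obtain p q z where x: "x = mat2 (of_real p) z (cnj z) (of_real q)" by (rule Her2_exhaust)
  have det: "of_real p * of_real q - z * cnj z = (1 :: complex)" and "p + q > 0"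
    using assms x by simp_all
  then have pq: "p * q = 1 + (cmod z)\<^sup>2" "p + q > 0"
    unfolding cmod_power2 by (auto simp: complex_eq_iff power2_eq_square)
  have "p * q > 0" using pq(1) by (simp add: add_pos_nonneg)
  then have p: "p > 0" using pq(2) by (smt (verit) zero_less_mult_iff)
  define r where "r = complex_of_real (sqrt p)"
  have r: "r * r = of_real p" "r \<noteq> 0" "cnj r = r" using p by (auto simp: r_def simp flip: of_real_mult)
  have q: "of_real q = (1 + cnj z * z) / (r * r)"
    using p det unfolding r(1) by (simp add: field_simps)
  show ?thesis
  proof (rule that)
    show "mat2 r 0 (cnj z / r) (1 / r) \<in> SL2C" using r by simp
    show "congr (mat2 r 0 (cnj z / r) (1 / r)) (mat 1) = x"
      using r by (simp add: x congr_def one_mat2 q add_divide_distrib mult.commute)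
  qed
qed

text \<open>The Hopf map: the unitary matrix with first column \<open>(r, b)\<close> moves \<open>e1\<close> to the matrix with
  entries \<open>r\<^sup>2 - \<bar>b\<bar>\<^sup>2\<close> and \<open>2 r cnj b\<close>. With \<open>r\<close> real this can be solved for every point of the sphere
  except the antipode of \<open>e1\<close>, which is treated separately.\<close>

lemma spinor_of_unit_vector:
  assumes "v \<in> Her2" "lor v v = 1" "lor e0 v = 0"
  obtains h where "h \<in> SL2C" "congr h (mat 1) = mat 1" "congr h e1 = v"
proof -
  from assms(1) obtain t t' w where v: "v = mat2 (of_real t) w (cnj w) (of_real t')" by (rule Her2_exhaust)
  have "t' = - t" using assms(3) by (simp add: v e0_def lor_mat2)
  with v have v: "v = mat2 (of_real t) w (cnj w) (- of_real t)" by simp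
  have "t * t + (Re w)\<^sup>2 + (Im w)\<^sup>2 = 1"
    using assms(2) by (simp add: v lor_mat2 power2_eq_square)
  then have n: "t * t + (cmod w)\<^sup>2 = 1"
    by (simp add: cmod_power2)
  show ?thesis
  proof (cases "t = -1")
    case True
    then have "w = 0" using n by simp
    with True show ?thesis
      by (intro that[of "mat2 0 (-1) 1 0"]) (simp_all add: v congr_def one_mat2 e1_def)
  next
    case False
    have "t\<^sup>2 \<le> 1" using n zero_le_power2[of "cmod w"] unfolding power2_eq_square by linarith
    then have "\<bar>t\<bar> \<le> 1" by (simp only: abs_square_le_1)
    then have "t > -1" using False by linarith
    define r where "r = complex_of_real (sqrt ((1 + t) / 2))"
    have r: "r * r = of_real ((1 + t) / 2)" "r \<noteq> 0" "cnj r = r"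
      using \<open>t > -1\<close> by (auto simp: r_def simp flip: of_real_mult)
    have nw: "w * cnj w = (1 - of_real t) * (1 + of_real t)"
    proof -
      have "w * cnj w = of_real ((cmod w)\<^sup>2)" by (rule complex_norm_square[symmetric])
      also have "(cmod w)\<^sup>2 = (1 - t) * (1 + t)" using n by (simp add: algebra_simps)
      finally show ?thesis by simp
    qed
    have t: "of_real t = 2 * (r * r) - 1" by (simp add: r(1) field_simps)
    define b where "b = cnj w / (2 * r)"
    have b: "b * cnj b = 1 - r * r"
    proof -
      have "b * cnj b = (w * cnj w) / (4 * (r * r))" by (simp add: b_def r(3))
      also have "w * cnj w = 4 * (r * r) * (1 - r * r)" unfolding nw t by algebra
      finally show ?thesis using r(2) by simp
    qed
    have w: "2 * r * cnj b = w" "2 * r * b = cnj w" using r by (simp_all add: b_def)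
    show ?thesis
    proof (rule that)
      show "mat2 r (- cnj b) b r \<in> SL2C" using b by (simp add: algebra_simps)
      show "congr (mat2 r (- cnj b) b r) (mat 1) = mat 1"
        using b r(3) by (simp add: congr_def one_mat2 algebra_simps)
      show "congr (mat2 r (- cnj b) b r) e1 = v"
        using b r(3) w by (simp add: congr_def e1_def v t algebra_simps)
    qed
  qed
qed

lemma UH3_congr:
  assumes "g \<in> SL2C" "(x, v) \<in> UH3 c" "c < 0"
  shows "(congr g x, congr g v) \<in> UH3 c"
proof -
  let ?x = "sqrt \<bar>c\<bar> *\<^sub>R x"
  have x: "x \<in> Her2" "det x = of_real (1 / \<bar>c\<bar>)" "Re (trace x) > 0"
    using assms(2) by (auto simp: UH3_def H3_def)
  \<comment> \<open>A rescaled \<open>x\<close> has the form \<open>h h\<^sup>*\<close>, so that its image is \<open>(g h) (g h)\<^sup>*\<close>, whose trace is a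
    sum of squared absolute values.\<close>
  have "?x \<in> Her2" using x(1) by (simp add: Her2_def madj_scaleR)
  moreover have "det ?x = 1" using x(2) assms(3) by (simp add: det_scaleR flip: of_real_mult)
  moreover have "Re (trace ?x) > 0" using x(3) assms(3) by (simp add: trace_scaleR)
  ultimately obtain h where h: "h \<in> SL2C" "congr h (mat 1) = ?x" by (rule Cholesky)
  have pos: "Re (trace (congr k (mat 1))) > 0" if "k \<in> SL2C" for k
  proof -
    obtain a b c d where k: "k = mat2 a b c d" by (rule mat2_exhaust)
    have "a \<noteq> 0 \<or> b \<noteq> 0" using that by (auto simp: k)
    moreover have "Re (trace (congr k (mat 1))) = (cmod a)\<^sup>2 + (cmod b)\<^sup>2 + (cmod c)\<^sup>2 + (cmod d)\<^sup>2"
      unfolding cmod_power2 by (simp add: k congr_def one_mat2 power2_eq_square)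
    ultimately show ?thesis
      by (smt (verit) zero_le_power2 zero_less_norm_iff zero_less_power)
  qed
  have "Re (trace (congr (g ** h) (mat 1))) > 0" by (intro pos SL2C_mult assms(1) h(1))
  then have "Re (trace (congr g x)) > 0"
    using assms(3) by (simp add: h(2) congr_scaleR trace_scaleR flip: congr_congr) (simp add: zero_less_mult_iff)
  then show ?thesis
    using assms by (simp add: UH3_def H3_def Her2_congr det_congr lor_congr)
qed

lemma UH3_transitive:
  assumes "c < 0" "(x, v) \<in> UH3 c"
  obtains g where "g \<in> SL2C" "congr g (mat 1) = sqrt \<bar>c\<bar> *\<^sub>R x" "congr g e1 = v"
proof -
  let ?x = "sqrt \<bar>c\<bar> *\<^sub>R x"
  have x: "x \<in> Her2" "det x = of_real (1 / \<bar>c\<bar>)" "Re (trace x) > 0"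
    and v: "v \<in> Her2" "lor v v = 1" "lor x v = 0"
    using assms(2) by (auto simp: UH3_def H3_def)
  have "?x \<in> Her2" using x(1) by (simp add: Her2_def madj_scaleR)
  moreover have "det ?x = 1" using x(2) assms(1) by (simp add: det_scaleR flip: of_real_mult)
  moreover have "Re (trace ?x) > 0" using x(3) assms(1) by (simp add: trace_scaleR)
  ultimately obtain g where g: "g \<in> SL2C" "congr g (mat 1) = ?x" by (rule Cholesky)
  define w where "w = congr (matrix_inv g) v"
  have gw: "congr g w = v" by (simp add: w_def congr_inv[OF g(1)])
  have "w \<in> Her2" "lor w w = 1" using g(1) v Her2_congr_iff[of g w] lor_congr[of g w w] by (simp_all add: gw)
  moreover have "lor (mat 1) w = lor ?x v" using lor_congr[of g "mat 1" w] g by (simp add: gw)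
  then have "lor e0 w = 0"
    using v(3) by (simp add: e0_def one_mat2 bounded_bilinear.scaleR_left[OF bounded_bilinear_lor])
  ultimately obtain h where h: "h \<in> SL2C" "congr h (mat 1) = mat 1" "congr h e1 = w"
    by (rule spinor_of_unit_vector)
  show ?thesis
    by (rule that[of "g ** h"]) (simp_all only: SL2C_mult g h gw congr_congr[symmetric])
qed

text \<open>Fixing the identity makes \<open>g\<close> unitary, and then fixing \<open>e1\<close> compares the squared lengths of the
  entries of each row: their sum is 1 and their difference is 1 or -1, so that one entry vanishes.\<close>

lemma stabilizer_of_base:
  assumes "g \<in> SL2C" "congr g (mat 1) = mat 1" "congr g e1 = e1"
  obtains a where "cmod a = 1" "g = mat2 a 0 0 (cnj a)"
proof -
  obtain a b c d where g: "g = mat2 a b c d" by (rule mat2_exhaust)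
  have 1: "a * cnj a + b * cnj b = 1" "c * cnj c + d * cnj d = 1"
    "a * cnj a - b * cnj b = 1" "c * cnj c - d * cnj d = - 1"
    using arg_cong[OF assms(2), of "\<lambda>A. A $ 1 $ 1"] arg_cong[OF assms(2), of "\<lambda>A. A $ 2 $ 2"]
      arg_cong[OF assms(3), of "\<lambda>A. A $ 1 $ 1"] arg_cong[OF assms(3), of "\<lambda>A. A $ 2 $ 2"]
    unfolding g congr_def one_mat2 e1_def by simp_all
  have "b * cnj b = ((a * cnj a + b * cnj b) - (a * cnj a - b * cnj b)) / 2"
    "c * cnj c = ((c * cnj c + d * cnj d) + (c * cnj c - d * cnj d)) / 2" by simp_all
  then have "b * cnj b = 0" "c * cnj c = 0" unfolding 1 by simp_all
  then have bc: "b = 0" "c = 0" by auto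
  have a: "a * cnj a = 1" "a * d = 1" using 1(1) assms(1) bc by (simp_all add: g)
  have "d = (a * cnj a) * d" by (simp add: a(1))
  also have "\<dots> = cnj a * (a * d)" by (simp only: ac_simps)
  finally have "d = cnj a" by (simp add: a(2))
  moreover have "of_real ((cmod a)\<^sup>2) = (1 :: complex)" using a(1) by (simp only: complex_norm_square)
  then have "(cmod a)\<^sup>2 = 1" using of_real_eq_1_iff by blast
  then have "cmod a = 1" by (simp add: power2_eq_1_iff) (metis norm_ge_zero not_one_le_zero le_minus_one_simps(3))
  ultimately show ?thesis using that g bc by blast
qed

lemma U1_iff: "g \<in> U1 \<longleftrightarrow> (\<exists>a. cmod a = 1 \<and> g = mat2 a 0 0 (cnj a))"
proof
  assume "g \<in> U1"
  then obtain \<theta> where "g = mat2 (exp (\<i> * of_real \<theta>)) 0 0 (exp (- \<i> * of_real \<theta>))"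
    by (auto simp: U1_def)
  then show "\<exists>a. cmod a = 1 \<and> g = mat2 a 0 0 (cnj a)"
    by (intro exI[of _ "exp (\<i> * of_real \<theta>)"]) (simp add: exp_cnj)
next
  assume "\<exists>a. cmod a = 1 \<and> g = mat2 a 0 0 (cnj a)"
  then obtain a where a: "cmod a = 1" "g = mat2 a 0 0 (cnj a)" by blast
  then have "a \<noteq> 0" by auto
  then have e: "exp (\<i> * of_real (Arg a)) = a" using Arg_eq[of a] a(1) by simp
  have "exp (- \<i> * of_real (Arg a)) = cnj (exp (\<i> * of_real (Arg a)))" by (simp add: exp_cnj)
  then have "exp (- \<i> * of_real (Arg a)) = cnj a" by (simp only: e)
  with e show "g \<in> U1" unfolding U1_def a(2) mem_Collect_eq by (intro exI[of _ "Arg a"]) simp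
qed


section \<open>Curves in the special linear group and its Lie algebra\<close>

lemma curve_in_level_set:
  assumes "curve_in M p v \<gamma>" "\<And>q. q \<in> M \<Longrightarrow> h q = k"
    "((\<lambda>t. h (\<gamma> t)) has_vector_derivative w) (at 0)"
  shows "w = 0"
proof -
  obtain \<epsilon> where \<epsilon>: "\<epsilon> > 0" "\<gamma> ` {-\<epsilon><..<\<epsilon>} \<subseteq> M"
    using assms(1) by (auto simp: curve_in_def)
  have "h (\<gamma> t) = k" if "t \<in> {-\<epsilon><..<\<epsilon>}" for t
    using \<epsilon>(2) assms(2) that by blast
  then have "((\<lambda>t. k) has_vector_derivative w) (at 0)"
    using \<epsilon>(1) by (intro has_vector_derivative_transform_within_open[OF assms(3), of "{-\<epsilon><..<\<epsilon>}"]) auto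
  then show ?thesis
    using vector_derivative_unique_at has_vector_derivative_const by blast
qed

lemma has_vector_derivative_bilinear:
  assumes "bounded_bilinear b" "(f has_vector_derivative f') (at t)" "(g has_vector_derivative g') (at t)"
  shows "((\<lambda>t. b (f t) (g t)) has_vector_derivative b (f t) g' + b f' (g t)) (at t)"
proof -
  interpret bounded_bilinear b by fact
  show ?thesis
    using FDERIV[OF assms(2,3)[unfolded has_vector_derivative_def]]
    by (simp add: has_vector_derivative_def scaleR_left scaleR_right scaleR_add_right)
qed

lemma has_vector_derivative_mat2:
  assumes "(a has_vector_derivative a') (at t)" "(b has_vector_derivative b') (at t)"
    "(c has_vector_derivative c') (at t)" "(d has_vector_derivative d') (at t)"
  shows "((\<lambda>t. mat2 (a t) (b t) (c t) (d t)) has_vector_derivative mat2 a' b' c' d') (at t)"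
proof -
  have bl: "bounded_linear (\<lambda>z. mat2 z 0 0 0)" "bounded_linear (\<lambda>z. mat2 0 z 0 0)"
    "bounded_linear (\<lambda>z. mat2 0 0 z 0)" "bounded_linear (\<lambda>z. mat2 0 0 0 z)"
    by (intro linear_conv_bounded_linear[THEN iffD1] linearI; simp)+
  have "((\<lambda>t. mat2 (a t) 0 0 0 + mat2 0 (b t) 0 0 + mat2 0 0 (c t) 0 + mat2 0 0 0 (d t))
      has_vector_derivative mat2 a' 0 0 0 + mat2 0 b' 0 0 + mat2 0 0 c' 0 + mat2 0 0 0 d') (at t)"
    by (intro has_vector_derivative_add bounded_linear.has_vector_derivative[OF bl(1)]
        bounded_linear.has_vector_derivative[OF bl(2)] bounded_linear.has_vector_derivative[OF bl(3)]
        bounded_linear.has_vector_derivative[OF bl(4)] assms)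
  then show ?thesis by simp
qed

text \<open>The curve with first entry \<open>1 + t a\<close> and off-diagonal entries \<open>t b\<close>, \<open>t c\<close>; the last entry is
  determined by the determinant. Being rational, it is smooth near 0.\<close>

lemma curve_in_SL2C:
  assumes "X \<in> sl2C"
  obtains \<gamma> where "curve_in SL2C (mat 1) X \<gamma>"
proof -
  obtain a b c d where X: "X = mat2 a b c d" by (rule mat2_exhaust)
  with assms have d: "d = - a" by (simp add: sl2C_def add_eq_0_iff)
  define p where "p t = 1 + of_real t * a" for t
  define \<gamma> where "\<gamma> t = mat2 (p t) (of_real t * b) (of_real t * c)
      ((1 + of_real t * of_real t * (b * c)) * inverse (p t))" for t
  define \<epsilon> where "\<epsilon> = 1 / (cmod a + 1)"
  have \<epsilon>: "\<epsilon> > 0" by (simp add: \<epsilon>_def add_nonneg_pos)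
  have p: "p t \<noteq> 0" if "t \<in> {-\<epsilon><..<\<epsilon>}" for t
  proof
    assume "p t = 0"
    then have "cmod (of_real t * a) = 1" unfolding p_def
      by (metis add.commute add_eq_0_iff norm_minus_cancel norm_one)
    moreover have "\<bar>t\<bar> * cmod a \<le> \<bar>t\<bar> * (cmod a + 1)" by (simp add: algebra_simps)
    moreover have "\<bar>t\<bar> < 1 / (cmod a + 1)" using that by (auto simp: \<epsilon>_def)
    then have "\<bar>t\<bar> * (cmod a + 1) < 1"
      by (simp add: pos_less_divide_eq add_nonneg_pos)
    ultimately show False by (simp add: norm_mult)
  qed
  let ?S = "{-\<epsilon><..<\<epsilon>}"
  have t: "smooth_on ?S (\<lambda>t. complex_of_real t)"
    by (intro smooth_on_linear bounded_linear_of_real) auto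
  have pS: "smooth_on ?S p" unfolding p_def[abs_def]
    by (intro smooth_on_add smooth_on_mult t smooth_on_const) auto
  have "smooth_on ?S \<gamma>" unfolding \<gamma>_def[abs_def]
    by (intro smooth_on_mat2 smooth_on_add smooth_on_mult smooth_on_inverse t pS p smooth_on_const) auto
  moreover have "\<gamma> ` ?S \<subseteq> SL2C"
    using p by (auto simp: \<gamma>_def field_simps)
  moreover have "\<gamma> 0 = mat 1" by (simp add: \<gamma>_def p_def one_mat2)
  moreover have "(\<gamma> has_vector_derivative X) (at 0)"
  proof -
    have dt: "((\<lambda>t. complex_of_real t) has_vector_derivative 1) (at 0)"
      using has_vector_derivative_of_real[OF DERIV_ident] by simp
    have dp: "(p has_vector_derivative a) (at 0)"
      unfolding p_def[abs_def] by (rule derivative_eq_intros dt refl | simp)+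
    have di: "((\<lambda>t. inverse (p t)) has_vector_derivative - a) (at 0)"
      using Deriv.has_derivative_inverse[of p 0 "\<lambda>t. t *\<^sub>R a" UNIV] dp
      by (simp add: has_vector_derivative_def p_def)
    have "((\<lambda>t. (1 + of_real t * of_real t * (b * c)) * inverse (p t)) has_vector_derivative - a) (at 0)"
      by (rule derivative_eq_intros dt di refl | simp add: p_def)+
    moreover have "((\<lambda>t. of_real t * z) has_vector_derivative z) (at 0)" for z :: complex
      by (rule derivative_eq_intros dt refl | simp)+
    ultimately show ?thesis unfolding \<gamma>_def[abs_def] X d
      by (intro has_vector_derivative_mat2 dp)
  qed
  ultimately have "curve_in SL2C (mat 1) X \<gamma>"
    unfolding curve_in_def using \<epsilon> by blast
  then show ?thesis by (rule that)
qed

lemma lie_algebra_SL2C: "lie_algebra SL2C = sl2C"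
proof
  show "sl2C \<subseteq> lie_algebra SL2C"
    unfolding lie_algebra_def tangent_space_def using curve_in_SL2C by blast
  show "lie_algebra SL2C \<subseteq> sl2C"
  proof
    fix X assume "X \<in> lie_algebra SL2C"
    then obtain \<gamma> where \<gamma>: "curve_in SL2C (mat 1) X \<gamma>"
      by (auto simp: lie_algebra_def tangent_space_def)
    then have d: "(\<gamma> has_vector_derivative X) (at 0)" and 0: "\<gamma> 0 = mat 1"
      by (auto simp: curve_in_def)
    have de: "((\<lambda>t. \<gamma> t $ i $ j) has_vector_derivative X $ i $ j) (at 0)" for i j
      by (rule bounded_linear.has_vector_derivative[OF bounded_linear_entry d])
    have "((\<lambda>t. det (\<gamma> t)) has_vector_derivative trace X) (at 0)"
      unfolding det_2
      by (rule derivative_eq_intros de refl | simp add: 0 one_mat2 trace_def sum_2)+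
    from curve_in_level_set[OF \<gamma> _ this] show "X \<in> sl2C"
      by (simp add: SL2C_def sl2C_def)
  qed
qed

lemma sl2C_exhaust:
  assumes "X \<in> sl2C"
  obtains a b c where "X = mat2 a b c (- a)"
  using assms by (cases X rule: mat2_exhaust) (auto simp: sl2C_def add_eq_0_iff)

lemma sl2C_iff [simp]: "mat2 a b c d \<in> sl2C \<longleftrightarrow> d = - a"
  by (auto simp: sl2C_def add_eq_0_iff)

lemma curve_in_linear_image:
  assumes "curve_in M p v \<gamma>" "bounded_linear L" "\<And>q. q \<in> M \<Longrightarrow> L q \<in> N"
  shows "curve_in N (L p) (L v) (\<lambda>t. L (\<gamma> t))"
proof -
  obtain \<epsilon> where \<epsilon>: "\<epsilon> > 0" "smooth_on {-\<epsilon><..<\<epsilon>} \<gamma>" "\<gamma> ` {-\<epsilon><..<\<epsilon>} \<subseteq> M"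
    using assms(1) by (auto simp: curve_in_def)
  have "smooth_on {-\<epsilon><..<\<epsilon>} (\<lambda>t. L (\<gamma> t))"
    by (rule smooth_on_linear_compose[OF assms(2) _ \<epsilon>(2)]) simp
  moreover have "(\<lambda>t. L (\<gamma> t)) ` {-\<epsilon><..<\<epsilon>} \<subseteq> N" using \<epsilon>(3) assms(3) by blast
  moreover have "((\<lambda>t. L (\<gamma> t)) has_vector_derivative L v) (at 0)" "\<gamma> 0 = p"
    using assms(1) by (auto simp: curve_in_def intro: bounded_linear.has_vector_derivative[OF assms(2)])
  ultimately show ?thesis using \<epsilon>(1) unfolding curve_in_def by blast
qed


section \<open>Tangent spaces of the unit tangent bundle\<close>

text \<open>The derivative of \<open>g \<mapsto> congr g \<xi>\<close> at the identity in the direction \<open>X\<close>.\<close>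

definition inf_congr :: "cmat2 \<Rightarrow> cmat2 \<Rightarrow> cmat2"
  where "inf_congr X \<xi> = X ** \<xi> + \<xi> ** madj X"

definition congr2 :: "cmat2 \<Rightarrow> cmat2 \<times> cmat2 \<Rightarrow> cmat2 \<times> cmat2"
  where "congr2 g w = (congr g (fst w), congr g (snd w))"

lemma SL2C_act_congr2: "SL2C_act = congr2"
  by (intro ext) (simp add: SL2C_act_def congr2_def congr_def)

lemma bounded_linear_congr2: "bounded_linear (congr2 g)"
  unfolding congr2_def
  by (intro bounded_linear_Pair bounded_linear_compose[OF bounded_linear_congr]
      bounded_linear_fst bounded_linear_snd)

lemma congr2_congr2: "congr2 g (congr2 h w) = congr2 (g ** h) w"
  by (simp add: congr2_def congr_congr)

lemma congr2_one [simp]: "congr2 (mat 1) w = w"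
  by (simp add: congr2_def)

lemma congr2_inv:
  assumes "g \<in> SL2C"
  shows "congr2 (matrix_inv g) (congr2 g w) = w" "congr2 g (congr2 (matrix_inv g) w) = w"
  using congr_inv[OF assms] by (simp_all add: congr2_def)

lemma UH3_congr2: "g \<in> SL2C \<Longrightarrow> p \<in> UH3 c \<Longrightarrow> c < 0 \<Longrightarrow> congr2 g p \<in> UH3 c"
  using UH3_congr[of g "fst p" "snd p" c] by (simp add: congr2_def)

lemma UH3_base_in: "c < 0 \<Longrightarrow> UH3_base c \<in> UH3 c"
  by (simp add: UH3_base_def UH3_def H3_def e0_def e1_def lor_mat2 flip: of_real_mult)
     (simp add: scaleR_conv_of_real field_simps)

lemma UH3_orbit:
  assumes "c < 0" "p \<in> UH3 c"
  obtains g where "g \<in> SL2C" "congr2 g (UH3_base c) = p"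
proof -
  obtain x v where p: "p = (x, v)" by fastforce
  obtain g where g: "g \<in> SL2C" "congr g (mat 1) = sqrt \<bar>c\<bar> *\<^sub>R x" "congr g e1 = v"
    using UH3_transitive assms p by metis
  have "congr g e0 = sqrt \<bar>c\<bar> *\<^sub>R x" using g(2) by (simp add: e0_def one_mat2)
  then have "congr2 g (UH3_base c) = p"
    using assms(1) g(3) by (simp add: p congr2_def UH3_base_def congr_scaleR)
  with g(1) show ?thesis by (rule that)
qed

lemma orbit_has_vector_derivative:
  assumes "curve_in SL2C (mat 1) X \<gamma>"
  shows "((\<lambda>t. congr2 (\<gamma> t) w) has_vector_derivative
    (inf_congr X (fst w), inf_congr X (snd w))) (at 0)"
proof -
  have d: "(\<gamma> has_vector_derivative X) (at 0)" and 0: "\<gamma> 0 = mat 1"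
    using assms by (auto simp: curve_in_def)
  have "((\<lambda>t. congr (\<gamma> t) \<xi>) has_vector_derivative inf_congr X \<xi>) (at 0)" for \<xi>
  proof -
    have 1: "((\<lambda>t. \<gamma> t ** \<xi>) has_vector_derivative X ** \<xi>) (at 0)"
      by (rule bounded_linear.has_vector_derivative[OF
            bounded_bilinear.bounded_linear_left[OF bounded_bilinear_matrix_mult] d])
    have 2: "((\<lambda>t. madj (\<gamma> t)) has_vector_derivative madj X) (at 0)"
      by (rule bounded_linear.has_vector_derivative[OF bounded_linear_madj d])
    have "madj (mat 1) = mat 1" by (simp add: one_mat2)
    then show ?thesis
      using has_vector_derivative_bilinear[OF bounded_bilinear_matrix_mult 1 2]
      by (simp add: congr_def inf_congr_def 0 add.commute)
  qed
  then show ?thesis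
    unfolding congr2_def by (intro has_vector_derivative_Pair)
qed

lemma orbit_curve:
  assumes "curve_in SL2C (mat 1) X \<gamma>" "c < 0" "w \<in> UH3 c"
  shows "curve_in (UH3 c) w (inf_congr X (fst w), inf_congr X (snd w)) (\<lambda>t. congr2 (\<gamma> t) w)"
proof -
  obtain \<epsilon> where \<epsilon>: "\<epsilon> > 0" "smooth_on {-\<epsilon><..<\<epsilon>} \<gamma>" "\<gamma> ` {-\<epsilon><..<\<epsilon>} \<subseteq> SL2C"
    using assms(1) by (auto simp: curve_in_def)
  have "smooth_on {-\<epsilon><..<\<epsilon>} (\<lambda>t. congr2 (\<gamma> t) w)"
    unfolding congr2_def congr_def
    by (intro smooth_on_Pair smooth_on_bilinear[OF bounded_bilinear_matrix_mult]
        smooth_on_linear_compose[OF bounded_linear_madj] \<epsilon>(2) smooth_on_const) auto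
  moreover have "congr2 (\<gamma> 0) w = w" using assms(1) by (simp add: curve_in_def)
  ultimately show ?thesis
    using \<epsilon> orbit_has_vector_derivative[OF assms(1)] UH3_congr2[OF _ assms(3,2)]
    unfolding curve_in_def by blast
qed

text \<open>Each of the five defining equations of the bundle is constant along a curve in it; its
  derivative along the curve vanishes.\<close>

lemma UH3_tangent_equations:
  assumes "(\<xi>, \<eta>) \<in> tangent_space (UH3 c) (x, v)"
  shows "\<xi> \<in> Her2" "\<eta> \<in> Her2" "lor x \<xi> = 0" "lor v \<eta> = 0" "lor \<xi> v + lor x \<eta> = 0"
proof -
  obtain \<gamma> where \<gamma>: "curve_in (UH3 c) (x, v) (\<xi>, \<eta>) \<gamma>"
    using assms by (auto simp: tangent_space_def)
  then have d: "(\<gamma> has_vector_derivative (\<xi>, \<eta>)) (at 0)" and 0: "\<gamma> 0 = (x, v)"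
    by (auto simp: curve_in_def)
  have d1: "((\<lambda>t. fst (\<gamma> t)) has_vector_derivative \<xi>) (at 0)"
    and d2: "((\<lambda>t. snd (\<gamma> t)) has_vector_derivative \<eta>) (at 0)"
    using bounded_linear.has_vector_derivative[OF bounded_linear_fst d]
      bounded_linear.has_vector_derivative[OF bounded_linear_snd d] by simp_all
  have bm: "bounded_linear (\<lambda>A. A - madj A)"
    by (intro bounded_linear_sub bounded_linear_ident bounded_linear_madj)
  have "\<xi> - madj \<xi> = 0"
    using bounded_linear.has_vector_derivative[OF bm d1]
    by (rule curve_in_level_set[OF \<gamma>, of "\<lambda>q. fst q - madj (fst q)" 0, rotated])
       (auto simp: UH3_def H3_def Her2_def)
  then show "\<xi> \<in> Her2" by (simp add: Her2_def)
  have "\<eta> - madj \<eta> = 0"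
    using bounded_linear.has_vector_derivative[OF bm d2]
    by (rule curve_in_level_set[OF \<gamma>, of "\<lambda>q. snd q - madj (snd q)" 0, rotated])
       (auto simp: UH3_def H3_def Her2_def)
  then show "\<eta> \<in> Her2" by (simp add: Her2_def)
  note bil = has_vector_derivative_bilinear[OF bounded_bilinear_lor]
  have "lor x \<xi> + lor \<xi> x = 0"
    using bil[OF d1 d1] unfolding 0 fst_conv
    by (rule curve_in_level_set[OF \<gamma>, of "\<lambda>q. lor (fst q) (fst q)" "- (1 / \<bar>c\<bar>)", rotated])
       (auto simp: UH3_def H3_def lor_self)
  then show "lor x \<xi> = 0" by (simp add: lor_commute[of \<xi>])
  have "lor v \<eta> + lor \<eta> v = 0"
    using bil[OF d2 d2] unfolding 0 snd_conv
    by (rule curve_in_level_set[OF \<gamma>, of "\<lambda>q. lor (snd q) (snd q)" 1, rotated])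
       (auto simp: UH3_def)
  then show "lor v \<eta> = 0" by (simp add: lor_commute[of \<eta>])
  have "lor x \<eta> + lor \<xi> v = 0"
    using bil[OF d1 d2] unfolding 0 fst_conv snd_conv
    by (rule curve_in_level_set[OF \<gamma>, of "\<lambda>q. lor (fst q) (snd q)" 0, rotated])
       (auto simp: UH3_def)
  then show "lor \<xi> v + lor x \<eta> = 0" by simp
qed

definition base_velocity :: "real \<Rightarrow> cmat2 \<Rightarrow> cmat2 \<times> cmat2"
  where "base_velocity c X = (inf_congr X (fst (UH3_base c)), inf_congr X (snd (UH3_base c)))"

lemma base_velocity_mat2:
  "base_velocity c (mat2 a b d (- a)) =
    ((1 / sqrt \<bar>c\<bar>) *\<^sub>R mat2 (2 * Re a) (b + cnj d) (cnj b + d) (- 2 * Re a),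
     mat2 (2 * Re a) (cnj d - b) (d - cnj b) (2 * Re a))"
  by (simp add: base_velocity_def inf_congr_def UH3_base_def e0_def e1_def
      scaleR_add_right[symmetric] complex_add_cnj del: scaleR_add_right)
    (simp add: complex_eq_iff algebra_simps)

text \<open>At the base point the five linearized equations leave a five-dimensional space, which is
  filled out by the matrices with real diagonal: these are Killing-orthogonal to the isotropy
  algebra.\<close>

lemma base_velocity_surj:
  assumes "c < 0" "w \<in> tangent_space (UH3 c) (UH3_base c)"
  obtains a b d where "w = base_velocity c (mat2 (of_real a) b d (- of_real a))"
proof -
  obtain \<xi> \<eta> where w: "w = (\<xi>, \<eta>)" by fastforce
  define s where "s = sqrt \<bar>c\<bar>"
  have s: "s > 0" using assms(1) by (simp add: s_def)
  note t = UH3_tangent_equations[OF assms(2)[unfolded w UH3_base_def]]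
  obtain p1 p2 z where \<xi>: "\<xi> = mat2 (of_real p1) z (cnj z) (of_real p2)" using t(1) by (rule Her2_exhaust)
  obtain q1 q2 y where \<eta>: "\<eta> = mat2 (of_real q1) y (cnj y) (of_real q2)" using t(2) by (rule Her2_exhaust)
  have p2: "p2 = - p1" using t(3) s unfolding s_def[symmetric] by (simp add: \<xi> e0_def lor_mat2 field_simps)
  have q2: "q2 = q1" using t(4) by (simp add: \<eta> e1_def lor_mat2)
  have q1: "q1 = s * p1"
    using t(5) s unfolding s_def[symmetric]
    by (simp add: \<xi> \<eta> p2 q2 e0_def e1_def lor_mat2 field_simps)
  have "w = base_velocity c (mat2 (of_real (q1 / 2)) ((of_real s * z - y) / 2)
      ((of_real s * cnj z + cnj y) / 2) (- of_real (q1 / 2)))"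
    using s unfolding base_velocity_mat2 w \<xi> \<eta> s_def[symmetric]
    by (simp add: p2 q2 q1 complex_eq_iff add_divide_distrib diff_divide_distrib)
  then show ?thesis by (rule that)
qed

lemma tangent_space_UH3_congr2:
  assumes "g \<in> SL2C" "c < 0" "w \<in> tangent_space (UH3 c) p"
  shows "congr2 g w \<in> tangent_space (UH3 c) (congr2 g p)"
  using assms curve_in_linear_image[OF _ bounded_linear_congr2, where M = "UH3 c" and N = "UH3 c" and p = p and v = w]
    UH3_congr2[OF assms(1) _ assms(2)]
  unfolding tangent_space_def by blast

lemma tangent_space_UH3:
  assumes "g \<in> SL2C" "c < 0"
  shows "tangent_space (UH3 c) (congr2 g (UH3_base c)) =
    {congr2 g (base_velocity c (mat2 (of_real a) b d (- of_real a))) | a b d. True}"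
proof (intro equalityI subsetI)
  fix w assume "w \<in> tangent_space (UH3 c) (congr2 g (UH3_base c))"
  from tangent_space_UH3_congr2[OF SL2C_inv(1)[OF assms(1)] assms(2) this]
  have "congr2 (matrix_inv g) w \<in> tangent_space (UH3 c) (UH3_base c)"
    by (simp add: congr2_inv[OF assms(1)])
  then obtain a b d where "congr2 (matrix_inv g) w = base_velocity c (mat2 (of_real a) b d (- of_real a))"
    by (rule base_velocity_surj[OF assms(2)])
  then show "w \<in> {congr2 g (base_velocity c (mat2 (of_real a) b d (- of_real a))) | a b d. True}"
    by (smt (verit, best) mem_Collect_eq congr2_inv(2)[OF assms(1)])
next
  fix w assume "w \<in> {congr2 g (base_velocity c (mat2 (of_real a) b d (- of_real a))) | a b d. True}"
  then obtain a b d where w: "w = congr2 g (base_velocity c (mat2 (of_real a) b d (- of_real a)))"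
    by blast
  obtain \<gamma> where "curve_in SL2C (mat 1) (mat2 (of_real a) b d (- of_real a)) \<gamma>"
    by (rule curve_in_SL2C[of "mat2 (of_real a) b d (- of_real a)"]) auto
  from orbit_curve[OF this assms(2) UH3_base_in[OF assms(2)]]
  have "base_velocity c (mat2 (of_real a) b d (- of_real a)) \<in> tangent_space (UH3 c) (UH3_base c)"
    unfolding tangent_space_def base_velocity_def by blast
  from tangent_space_UH3_congr2[OF assms this]
  show "w \<in> tangent_space (UH3 c) (congr2 g (UH3_base c))" by (simp add: w)
qed

text \<open>The defining map \<open>F\<close> records the skew-Hermitian part of \<open>x\<close> together with \<open>\<langle>x, x\<rangle>\<close>, and the
  skew-Hermitian part of \<open>v\<close> together with \<open>\<langle>v, v\<rangle>\<close> and \<open>\<langle>x, v\<rangle>\<close>; the scalars are stored as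
  multiples of the Hermitian matrices \<open>e0\<close>, \<open>e1\<close>, which are independent of the skew-Hermitian ones. It is
  a submersion onto its range: \<open>x\<close> and \<open>v\<close> are orthogonal to each other and to all skew-Hermitian
  matrices and neither is null, so that multiples of \<open>x\<close> and \<open>v\<close> can be added to a skew-Hermitian
  solution to correct the scalars.\<close>

lemma embedded_submanifold_UH3:
  assumes "c < 0"
  shows "embedded_submanifold (UH3 c)"
proof -
  define U :: "(cmat2 \<times> cmat2) set" where "U = {q. Re (trace (fst q)) > 0}"
  define F :: "cmat2 \<times> cmat2 \<Rightarrow> cmat2 \<times> cmat2" where "F q =
      (fst q - madj (fst q) + (lor (fst q) (fst q) + 1 / \<bar>c\<bar>) *\<^sub>R e0,
       snd q - madj (snd q) + ((lor (snd q) (snd q) - 1) *\<^sub>R e0 + lor (fst q) (snd q) *\<^sub>R e1))" for q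
  define W :: "(cmat2 \<times> cmat2) set" where "W = {(A + a *\<^sub>R e0, B + (b *\<^sub>R e0 + d *\<^sub>R e1)) | A B a b d.
      madj A = - A \<and> madj B = - B}"
  define D where "D q w =
      (fst w - madj (fst w) + (lor (fst q) (fst w) + lor (fst w) (fst q)) *\<^sub>R e0,
       snd w - madj (snd w) + ((lor (snd q) (snd w) + lor (snd w) (snd q)) *\<^sub>R e0 +
         (lor (fst q) (snd w) + lor (fst w) (snd q)) *\<^sub>R e1))" for q w
  have madj_diff: "madj (A - madj A) = - (A - madj A)" for A
    by (cases A rule: mat2_exhaust) simp
  have "continuous_on UNIV (\<lambda>q :: cmat2 \<times> cmat2. Re (trace (fst q)))"
    unfolding trace_def sum_2 by (intro continuous_intros)
  from open_Collect_less[OF continuous_on_const this, of 0] have U: "open U" by (simp add: U_def)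
  have skew: "A = 0 \<and> a = 0" if "A + a *\<^sub>R e0 = 0" "madj A = - A" for A a
  proof -
    obtain a1 a2 a3 a4 where A: "A = mat2 a1 a2 a3 a4" by (rule mat2_exhaust)
    have "Re a1 = 0" using that(2) by (auto simp: A complex_eq_iff)
    with that show ?thesis by (auto simp: A e0_def complex_eq_iff)
  qed
  have skew2: "A = 0 \<and> a = 0 \<and> b = 0" if "A + (a *\<^sub>R e0 + b *\<^sub>R e1) = 0" "madj A = - A" for A a b
  proof -
    obtain a1 a2 a3 a4 where A: "A = mat2 a1 a2 a3 a4" by (rule mat2_exhaust)
    have "Re a1 = 0" "Re a4 = 0" using that(2) by (auto simp: A complex_eq_iff)
    with that show ?thesis by (auto simp: A e0_def e1_def complex_eq_iff)
  qed
  have Her_det: "det x = of_real (Re (det x))" if "x \<in> Her2" for x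
    using that by (rule Her2_exhaust) (simp add: complex_eq_iff)
  have zero: "UH3 c \<inter> U = {q \<in> U. F q = 0}"
  proof (intro equalityI subsetI)
    fix q assume "q \<in> UH3 c \<inter> U"
    then show "q \<in> {q \<in> U. F q = 0}"
      by (auto simp: UH3_def H3_def Her2_def F_def lor_self[of "fst q"] zero_prod_def)
  next
    fix q assume q: "q \<in> {q \<in> U. F q = 0}"
    obtain x v where xv: "q = (x, v)" by fastforce
    have "x - madj x = 0" "lor x x + 1 / \<bar>c\<bar> = 0"
      using skew[OF _ madj_diff, of x "lor x x + 1 / \<bar>c\<bar>"] q by (auto simp: F_def xv zero_prod_def)
    moreover have "v - madj v = 0" "lor v v - 1 = 0" "lor x v = 0"
      using skew2[OF _ madj_diff, of v "lor v v - 1" "lor x v"] q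
      by (auto simp: F_def xv zero_prod_def)
    moreover have "Re (trace x) > 0" using q by (simp add: U_def xv)
    ultimately show "q \<in> UH3 c \<inter> U"
      using Her_det[of x] q by (auto simp: xv UH3_def H3_def Her2_def lor_self[of x] simp del: of_real_divide)
  qed
  have "(F has_derivative D q) (at q)" for q
    unfolding F_def[abs_def] D_def
    by (rule derivative_eq_intros bounded_linear.has_derivative[OF bounded_linear_madj]
        bounded_bilinear.FDERIV[OF bounded_bilinear_lor] refl | simp)+
  then have frechet: "frechet_derivative F (at q) = D q" for q
    using frechet_derivative_at by metis
  have "smooth_on U F" unfolding F_def[abs_def]
    by (intro smooth_on_Pair smooth_on_add smooth_on_diff smooth_on_scaleR
        smooth_on_bilinear[OF bounded_bilinear_lor] smooth_on_linear_compose[OF bounded_linear_madj]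
        smooth_on_linear bounded_linear_fst bounded_linear_snd U smooth_on_const)
  moreover have "subspace W" unfolding subspace_def
  proof (intro conjI ballI allI)
    have "madj 0 = - 0" by (simp add: zero_mat2)
    then show "0 \<in> W" unfolding W_def zero_prod_def
      by (intro CollectI exI[of _ 0]) auto
  next
    fix w w' assume "w \<in> W" "w' \<in> W"
    then obtain A B a b d A' B' a' b' d' where
      "w = (A + a *\<^sub>R e0, B + (b *\<^sub>R e0 + d *\<^sub>R e1))" "madj A = - A" "madj B = - B"
      "w' = (A' + a' *\<^sub>R e0, B' + (b' *\<^sub>R e0 + d' *\<^sub>R e1))" "madj A' = - A'" "madj B' = - B'"
      unfolding W_def by blast
    then show "w + w' \<in> W" unfolding W_def
      by (intro CollectI exI[of _ "A + A'"] exI[of _ "B + B'"] exI[of _ "a + a'"]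
          exI[of _ "b + b'"] exI[of _ "d + d'"]) (simp add: madj_add algebra_simps)
  next
    fix r w assume "w \<in> W"
    then obtain A B a b d where
      "w = (A + a *\<^sub>R e0, B + (b *\<^sub>R e0 + d *\<^sub>R e1))" "madj A = - A" "madj B = - B"
      unfolding W_def by blast
    then show "r *\<^sub>R w \<in> W" unfolding W_def
      by (intro CollectI exI[of _ "r *\<^sub>R A"] exI[of _ "r *\<^sub>R B"] exI[of _ "r * a"]
          exI[of _ "r * b"] exI[of _ "r * d"]) (simp add: madj_scaleR algebra_simps)
  qed
  moreover have FW: "F ` U \<subseteq> W" unfolding F_def W_def using madj_diff by blast
  moreover have "range (frechet_derivative F (at q)) = W" if q: "q \<in> UH3 c \<inter> U" for q
  proof (intro equalityI subsetI)
    fix y assume "y \<in> range (frechet_derivative F (at q))"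
    then show "y \<in> W" unfolding frechet D_def W_def using madj_diff by blast
  next
    fix y assume "y \<in> W"
    then obtain A B a b d where y: "y = (A + a *\<^sub>R e0, B + (b *\<^sub>R e0 + d *\<^sub>R e1))"
      and AB: "madj A = - A" "madj B = - B"
      unfolding W_def by blast
    obtain x v where xv: "q = (x, v)" by fastforce
    have H: "madj x = x" "madj v = v" "x \<in> Her2" "v \<in> Her2"
      and l: "lor x x = - (1 / \<bar>c\<bar>)" "lor v v = 1" "lor x v = 0" "lor v x = 0"
      using q lor_commute[of v x] by (auto simp: xv UH3_def H3_def Her2_def lor_self[of x])
    have l0: "lor x' S = 0" "lor S x' = 0" if S: "madj S = - S" and x': "x' \<in> Her2" for S x'
    proof -
      obtain p q z where x': "x' = mat2 (of_real p) z (cnj z) (of_real q)" using x' by (rule Her2_exhaust)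
      obtain a b c d where SS: "S = mat2 a b c d" by (rule mat2_exhaust)
      have "Re a = 0" "Re d = 0" "Re c = - Re b" "Im c = Im b"
        using arg_cong[OF S, of "\<lambda>A. Re (A $ 1 $ 1)"] arg_cong[OF S, of "\<lambda>A. Re (A $ 2 $ 2)"]
          arg_cong[OF S, of "\<lambda>A. Re (A $ 1 $ 2)"] arg_cong[OF S, of "\<lambda>A. Im (A $ 1 $ 2)"]
        unfolding SS by simp_all
      then show "lor x' S = 0" by (simp add: x' SS lor_mat2)
      then show "lor S x' = 0" by (simp add: lor_commute)
    qed
    define \<xi> where "\<xi> = (1/2) *\<^sub>R A + (- (\<bar>c\<bar> * a / 2)) *\<^sub>R x"
    define \<eta> where "\<eta> = (1/2) *\<^sub>R B + ((b / 2) *\<^sub>R v + (- (\<bar>c\<bar> * d)) *\<^sub>R x)"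
    interpret L: bounded_bilinear lor by (rule bounded_bilinear_lor)
    note Ls = L.add_left L.add_right L.scaleR_left L.scaleR_right l
    have "lor x \<xi> = a / 2" "lor \<xi> x = a / 2" "lor \<xi> v = 0" "lor v \<eta> = b / 2" "lor \<eta> v = b / 2"
      "lor x \<eta> = d"
      using assms l0[OF AB(1) H(3)] l0[OF AB(1) H(4)] l0[OF AB(2) H(3)] l0[OF AB(2) H(4)]
      unfolding \<xi>_def \<eta>_def by (simp_all only: Ls) simp_all
    moreover have "\<xi> - madj \<xi> = A" "\<eta> - madj \<eta> = B"
      unfolding \<xi>_def \<eta>_def madj_add madj_scaleR H AB
      by (simp_all only: add_diff_cancel_right scaleR_minus_right diff_minus_eq_add
          scaleR_add_left[symmetric]) simp_all
    ultimately have "D q (\<xi>, \<eta>) = y"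
      unfolding D_def y xv by simp
    then show "y \<in> range (frechet_derivative F (at q))"
      unfolding frechet by (metis rangeI)
  qed
  ultimately have "open U \<and> smooth_on U F \<and> subspace W \<and> F ` U \<subseteq> W \<and> UH3 c \<inter> U = {q \<in> U. F q = 0} \<and>
      (\<forall>q\<in>UH3 c \<inter> U. range (frechet_derivative F (at q)) = W)"
    using U zero by blast
  moreover have "UH3 c \<subseteq> U" by (auto simp: UH3_def H3_def U_def)
  ultimately show ?thesis unfolding embedded_submanifold_def by blast
qed


section \<open>The Killing form\<close>

text \<open>Expanding the basis vectors in the other basis turns both sums into the same double sum.\<close>

lemma trace_on_basis:
  fixes T :: "'b::euclidean_space \<Rightarrow> 'b"
  assumes T: "linear T" "T ` span B \<subseteq> span B" and B: "independent B" "independent C" "span C = span B"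
  shows "(\<Sum>b\<in>B. representation B (T b) b) = (\<Sum>c\<in>C. representation C (T c) c)"
proof -
  have fin: "finite B" "finite C" using B independent_imp_finite by auto
  have bC: "b \<in> span C" if "b \<in> B" for b using that B(3) span_base by auto
  have cB: "c \<in> span B" if "c \<in> C" for c using that B(3) span_base by auto
  have TB: "T v \<in> span B" if "v \<in> span B" for v using T(2) that by auto
  have 1: "representation B (T b) b = (\<Sum>c\<in>C. representation C b c * representation B (T c) b)" if "b \<in> B" for b
  proof -
    have "b = (\<Sum>c\<in>C. representation C b c *\<^sub>R c)"
      using real_vector.sum_representation_eq[OF B(2) bC[OF that] fin(2) subset_refl] by simp
    then have "T b = T (\<Sum>c\<in>C. representation C b c *\<^sub>R c)" by simp
    also have "\<dots> = (\<Sum>c\<in>C. representation C b c *\<^sub>R T c)"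
      by (simp add: linear_sum[OF T(1)] linear_cmul[OF T(1)])
    finally have "representation B (T b) = representation B (\<Sum>c\<in>C. representation C b c *\<^sub>R T c)" by simp
    also have "\<dots> = (\<lambda>b'. \<Sum>c\<in>C. representation B (representation C b c *\<^sub>R T c) b')"
      by (intro real_vector.representation_sum B span_scale TB cB)
    also have "\<dots> = (\<lambda>b'. \<Sum>c\<in>C. representation C b c * representation B (T c) b')"
      by (intro ext sum.cong refl) (simp add: real_vector.representation_scale[OF B(1) TB[OF cB]])
    finally show ?thesis by simp
  qed
  have 2: "representation C (T c) c = (\<Sum>b\<in>B. representation B (T c) b * representation C b c)" if "c \<in> C" for c
  proof -
    have "T c = (\<Sum>b\<in>B. representation B (T c) b *\<^sub>R b)"
      using real_vector.sum_representation_eq[OF B(1) TB[OF cB[OF that]] fin(1) subset_refl] by simp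
    then have "representation C (T c) = representation C (\<Sum>b\<in>B. representation B (T c) b *\<^sub>R b)" by simp
    also have "\<dots> = (\<lambda>c'. \<Sum>b\<in>B. representation C (representation B (T c) b *\<^sub>R b) c')"
      by (intro real_vector.representation_sum B span_scale bC)
    also have "\<dots> = (\<lambda>c'. \<Sum>b\<in>B. representation B (T c) b * representation C b c')"
      by (intro ext sum.cong refl) (simp add: real_vector.representation_scale[OF B(2) bC])
    finally show ?thesis by simp
  qed
  have "(\<Sum>b\<in>B. representation B (T b) b) = (\<Sum>b\<in>B. \<Sum>c\<in>C. representation B (T c) b * representation C b c)"
    by (intro sum.cong refl) (simp add: 1 mult.commute)
  also have "\<dots> = (\<Sum>c\<in>C. \<Sum>b\<in>B. representation B (T c) b * representation C b c)" by (rule sum.swap)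
  also have "\<dots> = (\<Sum>c\<in>C. representation C (T c) c)" by (intro sum.cong refl) (simp add: 2)
  finally show ?thesis .
qed

lemma trace_on_orthogonal_basis:
  fixes T :: "'b::euclidean_space \<Rightarrow> 'b"
  assumes T: "linear T" "T ` V \<subseteq> V"
    and C: "pairwise orthogonal C" "0 \<notin> C" "span C = V"
  shows "trace_on V T = (\<Sum>c\<in>C. (T c \<bullet> c) / (c \<bullet> c))"
proof -
  have indC: "independent C" using C pairwise_orthogonal_independent by blast
  then have fin: "finite C" by (rule independent_imp_finite)
  define B where "B = (SOME B. independent B \<and> span B = V)"
  have B: "independent B" "span B = V"
    using someI[of "\<lambda>B. independent B \<and> span B = V" C] indC C(3) by (auto simp: B_def)
  have "trace_on V T = (\<Sum>b\<in>B. representation B (T b) b)"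
    by (simp add: trace_on_def B_def Let_def)
  also have "\<dots> = (\<Sum>c\<in>C. representation C (T c) c)"
    using T B C(3) indC by (intro trace_on_basis) auto
  also have "\<dots> = (\<Sum>c\<in>C. (T c \<bullet> c) / (c \<bullet> c))"
  proof (rule sum.cong[OF refl])
    fix c assume c: "c \<in> C"
    have "T c \<in> span C" using T(2) C(3) span_base[OF c] by auto
    then have "T c = (\<Sum>d\<in>C. representation C (T c) d *\<^sub>R d)"
      using real_vector.sum_representation_eq[OF indC _ fin subset_refl] by simp
    then have "T c \<bullet> c = (\<Sum>d\<in>C. representation C (T c) d * (d \<bullet> c))"
      by (metis (no_types, lifting) inner_scaleR_left inner_sum_left sum.cong)
    also have "\<dots> = (\<Sum>d\<in>C. if d = c then representation C (T c) c * (c \<bullet> c) else 0)"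
      using C(1) c by (intro sum.cong refl) (auto simp: pairwise_def orthogonal_def)
    also have "\<dots> = representation C (T c) c * (c \<bullet> c)" using fin c by simp
    finally show "representation C (T c) c = (T c \<bullet> c) / (c \<bullet> c)" using C(2) c by auto
  qed
  finally show ?thesis .
qed

lemma lie_bracket_mat2:
  "lie_bracket (mat2 a b c d) (mat2 a' b' c' d') =
    mat2 (b * c' - b' * c) (a * b' + b * d' - a' * b - b' * d)
      (c * a' + d * c' - c' * a - d' * c) (c * b' - c' * b)"
  by (simp add: lie_bracket_def algebra_simps)

lemma subspace_sl2C: "subspace sl2C"
  unfolding sl2C_def subspace_def by (auto simp: trace_scaleR trace_add) (simp add: zero_mat2)

text \<open>Twice the real part of the complex Killing form \<open>4 tr (X Y)\<close>, as for every complex Lie algebra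
  regarded as a real one. It is computed in an orthogonal real basis.\<close>

lemma killing_form_sl2C:
  assumes "X \<in> sl2C" "Y \<in> sl2C"
  shows "killing_form sl2C X Y = 8 * Re (trace (X ** Y))"
proof -
  obtain a b c where X: "X = mat2 a b c (- a)" using assms(1) by (rule sl2C_exhaust)
  obtain p q r where Y: "Y = mat2 p q r (- p)" using assms(2) by (rule sl2C_exhaust)
  define C where "C = {mat2 1 0 0 (-1), mat2 \<i> 0 0 (-\<i>), mat2 0 1 0 0, mat2 0 \<i> 0 0,
      mat2 0 0 1 0, mat2 0 0 \<i> 0}"
  have "span C = sl2C"
  proof
    show "span C \<subseteq> sl2C" by (intro span_minimal subspace_sl2C) (auto simp: C_def)
    show "sl2C \<subseteq> span C"
    proof
      fix Z assume "Z \<in> sl2C"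
      then obtain x y z where Z: "Z = mat2 x y z (- x)" by (rule sl2C_exhaust)
      have "Z = Re x *\<^sub>R mat2 1 0 0 (-1) + Im x *\<^sub>R mat2 \<i> 0 0 (-\<i>) + Re y *\<^sub>R mat2 0 1 0 0 +
          Im y *\<^sub>R mat2 0 \<i> 0 0 + Re z *\<^sub>R mat2 0 0 1 0 + Im z *\<^sub>R mat2 0 0 \<i> 0"
        by (simp add: Z complex_eq_iff)
      also have "\<dots> \<in> span C"
        by (intro span_add span_scale span_base) (auto simp: C_def)
      finally show "Z \<in> span C" .
    qed
  qed
  moreover have "pairwise orthogonal C" "0 \<notin> C"
    by (auto simp: C_def pairwise_def orthogonal_def inner_complex_def)
  moreover have "linear (\<lambda>Z. lie_bracket X (lie_bracket Y Z))"
  proof (rule linearI)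
    fix Z Z' r
    show "lie_bracket X (lie_bracket Y (Z + Z')) =
        lie_bracket X (lie_bracket Y Z) + lie_bracket X (lie_bracket Y Z')"
      by (cases Z rule: mat2_exhaust; cases Z' rule: mat2_exhaust)
        (simp add: X Y lie_bracket_mat2 algebra_simps)
    show "lie_bracket X (lie_bracket Y (r *\<^sub>R Z)) = r *\<^sub>R lie_bracket X (lie_bracket Y Z)"
      by (cases Z rule: mat2_exhaust)
        (simp add: X Y lie_bracket_mat2 scaleR_conv_of_real[where ?'a = complex] algebra_simps)
  qed
  moreover have "(\<lambda>Z. lie_bracket X (lie_bracket Y Z)) ` sl2C \<subseteq> sl2C"
    by (auto elim!: sl2C_exhaust simp: X Y lie_bracket_mat2)
  ultimately have "killing_form sl2C X Y = (\<Sum>Z\<in>C. (lie_bracket X (lie_bracket Y Z) \<bullet> Z) / (Z \<bullet> Z))"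
    unfolding killing_form_def by (intro trace_on_orthogonal_basis)
  also have "\<dots> = 8 * Re (trace (X ** Y))"
    unfolding C_def by (simp add: complex_eq_iff X Y lie_bracket_mat2 inner_complex_def algebra_simps)
  finally show ?thesis .
qed


section \<open>Semisimplicity\<close>

text \<open>Brackets with the raising and the lowering matrix turn any nonzero element into a nonzero multiple
  of one of these two, and either of them generates the whole algebra as an ideal.\<close>

lemma lie_ideal_sl2C:
  assumes "lie_ideal sl2C \<aa>" "\<aa> \<noteq> {0}"
  shows "\<aa> = sl2C"
proof -
  have I: "lie_bracket X Y \<in> \<aa>" if "X \<in> sl2C" "Y \<in> \<aa>" for X Y
    using assms(1) that by (auto simp: lie_ideal_def)
  have sub: "subspace \<aa>" "\<aa> \<subseteq> sl2C" using assms(1) by (auto simp: lie_ideal_def)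
  have E: "\<aa> = sl2C" if k: "mat2 0 k 0 0 \<in> \<aa>" "k \<noteq> 0" for k
  proof (intro equalityI sub(2) subsetI)
    have E: "mat2 0 z 0 0 \<in> \<aa>" for z
      using I[OF _ k(1), of "mat2 (z / (2 * k)) 0 0 (- (z / (2 * k)))"] k(2)
      by (simp add: lie_bracket_mat2)
    have H: "mat2 z 0 0 (- z) \<in> \<aa>" for z
      using I[OF _ E[of 1], of "mat2 0 0 (- z) 0"] by (simp add: lie_bracket_mat2)
    have F: "mat2 0 0 z 0 \<in> \<aa>" for z
      using I[OF _ H[of 1], of "mat2 0 0 (z / 2) 0"] by (simp add: lie_bracket_mat2)
    fix Z assume "Z \<in> sl2C"
    then obtain x y z where Z: "Z = mat2 x y z (- x)" by (rule sl2C_exhaust)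
    have "mat2 x 0 0 (- x) + mat2 0 y 0 0 + mat2 0 0 z 0 \<in> \<aa>"
      by (intro subspace_add[OF sub(1)] E F H)
    then show "Z \<in> \<aa>" by (simp add: Z)
  qed
  have F: "\<aa> = sl2C" if k: "mat2 0 0 k 0 \<in> \<aa>" "k \<noteq> 0" for k
  proof -
    have "mat2 1 0 0 (- 1) \<in> \<aa>"
      using I[OF _ k(1), of "mat2 0 (1 / k) 0 0"] k(2) by (simp add: lie_bracket_mat2)
    from I[OF _ this, of "mat2 0 1 0 0"] show ?thesis
      by (intro E[of "- 2"]) (simp_all add: lie_bracket_mat2)
  qed
  have "0 \<in> \<aa>" using sub(1) subspace_0 by blast
  then obtain Y where Y: "Y \<in> \<aa>" "Y \<noteq> 0" using assms(2) by blast
  with sub(2) obtain a b c where Yab: "Y = mat2 a b c (- a)" using sl2C_exhaust by blast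
  let ?E = "mat2 0 1 0 0" and ?F = "mat2 0 0 1 0"
  consider "c \<noteq> 0" | "b \<noteq> 0" | "b = 0" "c = 0" "a \<noteq> 0" using Y(2) Yab by auto
  then show ?thesis
  proof cases
    case 1
    have "lie_bracket ?E (lie_bracket ?E Y) \<in> \<aa>" by (intro I Y(1)) auto
    with 1 show ?thesis by (intro E[of "- 2 * c"]) (simp_all add: Yab lie_bracket_mat2)
  next
    case 2
    have "lie_bracket ?F (lie_bracket ?F Y) \<in> \<aa>" by (intro I Y(1)) auto
    with 2 show ?thesis by (intro F[of "- 2 * b"]) (simp_all add: Yab lie_bracket_mat2)
  next
    case 3
    have "lie_bracket ?E Y \<in> \<aa>" by (intro I Y(1)) auto
    with 3 show ?thesis by (intro E[of "- 2 * a"]) (simp_all add: Yab lie_bracket_mat2)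
  qed
qed

lemma derived_algebra_sl2C: "derived_algebra sl2C = sl2C"
proof
  show "derived_algebra sl2C \<subseteq> sl2C" unfolding derived_algebra_def
    by (rule span_minimal[OF _ subspace_sl2C]) (auto elim!: sl2C_exhaust simp: lie_bracket_mat2)
  let ?S = "{lie_bracket X Y | X Y. X \<in> sl2C \<and> Y \<in> sl2C}"
  show "sl2C \<subseteq> derived_algebra sl2C"
  proof
    fix Z assume "Z \<in> sl2C"
    then obtain x y z where Z: "Z = mat2 x y z (- x)" by (rule sl2C_exhaust)
    have "Z = lie_bracket (mat2 0 x 0 0) (mat2 0 0 1 0) + lie_bracket (mat2 1 0 0 (-1)) (mat2 0 (y / 2) 0 0)
        + lie_bracket (mat2 1 0 0 (-1)) (mat2 0 0 (- z / 2) 0)"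
      by (simp add: Z lie_bracket_mat2)
    also have "\<dots> \<in> span ?S"
    proof -
      have "lie_bracket X Y \<in> span ?S" if "X \<in> sl2C" "Y \<in> sl2C" for X Y
        using that by (intro span_base) blast
      then show ?thesis by (intro span_add) simp_all
    qed
    finally show "Z \<in> derived_algebra sl2C" by (simp add: derived_algebra_def)
  qed
qed

lemma semisimple_sl2C: "semisimple_lie_algebra sl2C"
  unfolding semisimple_lie_algebra_def solvable_lie_algebra_def
proof (intro allI impI, elim conjE exE)
  fix \<aa> m assume a: "lie_ideal sl2C \<aa>" "(derived_algebra ^^ m) \<aa> = {0}"
  show "\<aa> = {0}"
  proof (rule ccontr)
    assume "\<aa> \<noteq> {0}"
    then have "\<aa> = sl2C" using lie_ideal_sl2C a(1) by blast
    moreover have "(derived_algebra ^^ m) sl2C = sl2C"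
      by (induction m) (simp_all add: derived_algebra_sl2C)
    ultimately have "sl2C = {0}" using a(2) by simp
    moreover have "mat2 1 0 0 (-1) \<in> sl2C" by simp
    ultimately show False by (metis mat2_eq_0_iff singletonD zero_neq_one)
  qed
qed


section \<open>The homogeneous space and its normal metric\<close>

lemma matrix_lie_group_SL2C: "matrix_lie_group SL2C"
proof -
  have "continuous_on UNIV (\<lambda>g :: cmat2. det g)" unfolding det_2 by (intro continuous_intros)
  then have "closed SL2C" unfolding SL2C_def using continuous_closed_preimage_constant[of UNIV det 1] by simp
  moreover have "SL2C \<subseteq> {g. invertible g}"
    using SL2C_inv unfolding invertible_def by blast
  ultimately have "closedin (top_of_set {g. invertible g}) SL2C" by (rule closed_subset[rotated])
  moreover have "invertible g" if "g \<in> SL2C" for g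
    using SL2C_inv[OF that] unfolding invertible_def by blast
  ultimately show ?thesis
    unfolding matrix_lie_group_def using SL2C_one SL2C_mult SL2C_inv(1) by blast
qed

lemma UH3_isotropy:
  assumes "c < 0"
  shows "U1 = {g \<in> SL2C. congr2 g (UH3_base c) = UH3_base c}"
proof (intro equalityI subsetI)
  fix g assume "g \<in> U1"
  then obtain a where a: "cmod a = 1" "g = mat2 a 0 0 (cnj a)" by (auto simp: U1_iff)
  then have aa: "a * cnj a = 1" by (metis complex_norm_square of_real_1 one_power2)
  then show "g \<in> {g \<in> SL2C. congr2 g (UH3_base c) = UH3_base c}"
    by (simp add: a(2) congr2_def UH3_base_def congr_def e0_def e1_def mult.commute[of "cnj a"])
next
  fix g assume g: "g \<in> {g \<in> SL2C. congr2 g (UH3_base c) = UH3_base c}"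
  then have "congr g e0 = e0" "congr g e1 = e1"
    using assms by (auto simp: congr2_def UH3_base_def congr_scaleR)
  then obtain a where "cmod a = 1" "g = mat2 a 0 0 (cnj a)"
    using g stabilizer_of_base[of g] by (auto simp: e0_def one_mat2)
  then show "g \<in> U1" by (auto simp: U1_iff)
qed

lemma homogeneous_space_UH3:
  assumes "c < 0"
  shows "homogeneous_space SL2C U1 SL2C_act (UH3 c) (UH3_base c)"
  unfolding homogeneous_space_def SL2C_act_congr2
proof (intro conjI matrix_lie_group_SL2C embedded_submanifold_UH3 UH3_base_in assms ballI UH3_congr2
    UH3_isotropy)
  have "smooth_on UNIV (\<lambda>q. (fst q ** fst (snd q) ** madj (fst q), fst q ** snd (snd q) ** madj (fst q)))"
    by (intro smooth_on_Pair smooth_on_bilinear[OF bounded_bilinear_matrix_mult]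
        smooth_on_linear_compose[OF bounded_linear_madj] smooth_on_linear bounded_linear_fst
        bounded_linear_compose[OF bounded_linear_fst bounded_linear_snd]
        bounded_linear_compose[OF bounded_linear_snd bounded_linear_snd] open_UNIV)
  from smooth_map_onI[OF this]
  show "smooth_map_on (SL2C \<times> UH3 c) (\<lambda>(g, y). congr2 g y)"
    by (simp add: case_prod_unfold congr2_def congr_def)
next
  fix p q assume "p \<in> UH3 c" "q \<in> UH3 c"
  then obtain g h where "g \<in> SL2C" "congr2 g (UH3_base c) = p" "h \<in> SL2C" "congr2 h (UH3_base c) = q"
    using UH3_orbit[OF assms] by metis
  then show "\<exists>g\<in>SL2C. congr2 g p = q"
    using SL2C_inv[of g] SL2C_mult[of h "matrix_inv g"] congr2_inv(1)[of g "UH3_base c"]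
    by (intro bexI[of _ "h ** matrix_inv g"]) (auto simp flip: congr2_congr2)
next
  fix p v assume p: "p \<in> UH3 c" and v: "v \<in> tangent_space (UH3 c) p"
  obtain g where g: "g \<in> SL2C" "congr2 g (UH3_base c) = p"
    using UH3_orbit[OF assms p] by metis
  with v obtain a b d where v: "v = congr2 g (base_velocity c (mat2 (of_real a) b d (- of_real a)))"
    using tangent_space_UH3[OF g(1) assms] by auto
  obtain \<gamma> where \<gamma>: "curve_in SL2C (mat 1) (mat2 (of_real a) b d (- of_real a)) \<gamma>"
    by (rule curve_in_SL2C[of "mat2 (of_real a) b d (- of_real a)"]) auto
  let ?L = "\<lambda>A. g ** A ** matrix_inv g"
  have L: "bounded_linear ?L"
    by (rule bounded_linear_compose[OF
          bounded_bilinear.bounded_linear_left[OF bounded_bilinear_matrix_mult]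
          bounded_bilinear.bounded_linear_right[OF bounded_bilinear_matrix_mult]])
  have "curve_in SL2C (?L (mat 1)) (?L (mat2 (of_real a) b d (- of_real a))) (\<lambda>t. ?L (\<gamma> t))"
    using SL2C_mult SL2C_inv(1)[OF g(1)] g(1) by (intro curve_in_linear_image[OF \<gamma> L]) blast
  moreover have "?L (mat 1) = mat 1" using SL2C_inv[OF g(1)] by simp
  moreover have "congr2 (?L A) p = congr2 g (congr2 A (UH3_base c))" for A
    unfolding g(2)[symmetric] by (simp add: congr2_inv[OF g(1)] flip: congr2_congr2)
  then have "((\<lambda>t. congr2 (?L (\<gamma> t)) p) has_vector_derivative v) (at 0)"
    using bounded_linear.has_vector_derivative[OF bounded_linear_congr2
        orbit_has_vector_derivative[OF \<gamma>, of "UH3_base c"]]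
    by (simp add: v base_velocity_def)
  ultimately show "\<exists>X \<gamma>. curve_in SL2C (mat 1) X \<gamma> \<and> ((\<lambda>t. congr2 (\<gamma> t) p) has_vector_derivative v) (at 0)"
    by metis
qed (simp_all add: congr2_congr2)

text \<open>At the base point, if \<open>X\<close> has real diagonal \<open>a, -a\<close> and off-diagonal entries \<open>b\<close>, \<open>d\<close>, the vector
  \<open>(\<xi>, \<eta>)\<close> generated by \<open>X\<close> determines \<open>a\<close> through \<open>\<langle>\<xi>, v\<rangle>\<close> and \<open>b \<plusminus> cnj d\<close> through the remaining
  components of \<open>\<xi>\<close> and \<open>\<eta>\<close>. Polarizing \<open>Re (b d)\<close> as a difference of the squares of \<open>b + cnj d\<close> and
  \<open>b - cnj d\<close> gives the first two terms; these count \<open>a\<^sup>2\<close> twice, once in \<open>\<xi>\<close> and once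
  in \<open>\<eta>\<close>, and the third term corrects this. Written with the scalar product, the expression is
  invariant under the group.\<close>

definition UH3_metric :: "real \<Rightarrow> real \<Rightarrow> cmat2 \<times> cmat2 \<Rightarrow> cmat2 \<times> cmat2 \<Rightarrow> cmat2 \<times> cmat2 \<Rightarrow> real"
  where "UH3_metric c r p w w' = 4 * r *
    (\<bar>c\<bar> * lor (fst w) (fst w') - lor (snd w) (snd w') - \<bar>c\<bar> * (lor (fst w) (snd p) * lor (fst w') (snd p)))"

lemma UH3_metric_congr2:
  "g \<in> SL2C \<Longrightarrow> UH3_metric c r (congr2 g p) (congr2 g w) (congr2 g w') = UH3_metric c r p w w'"
  by (simp add: UH3_metric_def congr2_def lor_congr)

lemma UH3_metric_base:
  assumes "c < 0"
  shows "UH3_metric c r (UH3_base c)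
      (base_velocity c (mat2 (of_real a) b d (- of_real a)))
      (base_velocity c (mat2 (of_real a') b' d' (- of_real a'))) =
    r * (8 * Re (2 * of_real (a * a') + b * d' + d * b'))"
proof -
  define s where "s = sqrt \<bar>c\<bar>"
  have s: "s > 0" "\<bar>c\<bar> = s * s" using assms by (auto simp: s_def)
  interpret L: bounded_bilinear lor by (rule bounded_bilinear_lor)
  show ?thesis
    unfolding UH3_metric_def base_velocity_mat2 UH3_base_def e1_def s_def[symmetric] s(2) fst_conv snd_conv
      L.scaleR_left L.scaleR_right lor_mat2
    using s(1) by (simp add: field_simps)
qed

lemma bilinear_UH3_metric: "bilinear (UH3_metric c r p)"
proof -
  interpret L: bounded_bilinear lor by (rule bounded_bilinear_lor)
  show ?thesis unfolding bilinear_def UH3_metric_def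
    by (auto intro!: linearI simp: L.add_left L.add_right L.scaleR_left L.scaleR_right algebra_simps)
qed

text \<open>The group acts by linear isometries between tangent spaces, so that it carries negative definite
  subspaces to negative definite subspaces of the same dimension.\<close>

lemma metric_index_UH3_le:
  assumes "c < 0" "g \<in> SL2C"
  shows "{dim V | V. subspace V \<and> V \<subseteq> tangent_space (UH3 c) p \<and> (\<forall>v\<in>V. v \<noteq> 0 \<longrightarrow> UH3_metric c r p v v < 0)}
    \<subseteq> {dim V | V. subspace V \<and> V \<subseteq> tangent_space (UH3 c) (congr2 g p) \<and>
        (\<forall>v\<in>V. v \<noteq> 0 \<longrightarrow> UH3_metric c r (congr2 g p) v v < 0)}"
proof clarify
  fix V assume V: "subspace V" "V \<subseteq> tangent_space (UH3 c) p"
    and neg: "\<forall>v\<in>V. v \<noteq> 0 \<longrightarrow> UH3_metric c r p v v < 0"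
  have lin: "linear (congr2 g)" using bounded_linear_congr2 bounded_linear.linear by blast
  have inj: "inj (congr2 g)" using congr2_inv(1)[OF assms(2)] by (metis injI)
  have "dim (congr2 g ` V) = dim V"
    by (rule dim_image_eq[OF lin]) (use inj in \<open>auto intro: inj_on_subset\<close>)
  moreover have "subspace (congr2 g ` V)" using V(1) linear_subspace_image lin by blast
  moreover have "congr2 g ` V \<subseteq> tangent_space (UH3 c) (congr2 g p)"
    using V(2) tangent_space_UH3_congr2[OF assms(2,1)] by blast
  moreover have "\<forall>v\<in>congr2 g ` V. v \<noteq> 0 \<longrightarrow> UH3_metric c r (congr2 g p) v v < 0"
  proof (intro ballI impI)
    fix v' assume "v' \<in> congr2 g ` V" "v' \<noteq> 0"
    then obtain v where v: "v \<in> V" "v' = congr2 g v" by blast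
    with \<open>v' \<noteq> 0\<close> have "v \<noteq> 0" using linear_0[OF lin] by metis
    with neg v(1) show "UH3_metric c r (congr2 g p) v' v' < 0"
      unfolding v(2) UH3_metric_congr2[OF assms(2)] by blast
  qed
  ultimately show "\<exists>W. dim V = dim W \<and> subspace W \<and> W \<subseteq> tangent_space (UH3 c) (congr2 g p) \<and>
      (\<forall>v\<in>W. v \<noteq> 0 \<longrightarrow> UH3_metric c r (congr2 g p) v v < 0)" by metis
qed

lemma metric_index_UH3:
  assumes "c < 0" "g \<in> SL2C"
  shows "metric_index (UH3 c) (UH3_metric c r) (congr2 g p) = metric_index (UH3 c) (UH3_metric c r) p"
proof -
  have "{dim V | V. subspace V \<and> V \<subseteq> tangent_space (UH3 c) (congr2 g p) \<and>
        (\<forall>v\<in>V. v \<noteq> 0 \<longrightarrow> UH3_metric c r (congr2 g p) v v < 0)} =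
    {dim V | V. subspace V \<and> V \<subseteq> tangent_space (UH3 c) p \<and> (\<forall>v\<in>V. v \<noteq> 0 \<longrightarrow> UH3_metric c r p v v < 0)}"
    using metric_index_UH3_le[OF assms, of p r]
      metric_index_UH3_le[OF assms(1) SL2C_inv(1)[OF assms(2)], of "congr2 g p" r]
    by (simp only: congr2_inv[OF assms(2)] subset_antisym)
  then show ?thesis by (simp only: metric_index_def)
qed

text \<open>The metric extends to all of the ambient space by the same formula. It is nondegenerate because
  pairing \<open>X\<close> with its adjoint gives a nonzero multiple of the squared norm of \<open>X\<close>.\<close>

lemma semi_riemannian_UH3:
  assumes "c < 0" "r \<noteq> 0"
  shows "semi_riemannian_metric (UH3 c) (UH3_metric c r)"
  unfolding semi_riemannian_metric_def
proof (intro conjI ballI impI)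
  fix p assume "p \<in> UH3 c"
  have "smooth_on UNIV (\<lambda>q. UH3_metric c r q v w)" for v w
    unfolding UH3_metric_def
    by (intro smooth_on_mult smooth_on_diff smooth_on_const open_UNIV
        smooth_on_bilinear[OF bounded_bilinear_lor] smooth_on_linear[OF bounded_linear_snd])
  then show "\<exists>U B. open U \<and> p \<in> U \<and> (\<forall>q\<in>U. bilinear (B q)) \<and> (\<forall>v w. smooth_on U (\<lambda>q. B q v w)) \<and>
      (\<forall>q\<in>UH3 c \<inter> U. \<forall>v\<in>tangent_space (UH3 c) q. \<forall>w\<in>tangent_space (UH3 c) q. UH3_metric c r q v w = B q v w)"
    using bilinear_UH3_metric by (intro exI[of _ UNIV] exI[of _ "UH3_metric c r"]) auto
next
  fix p v w show "UH3_metric c r p v w = UH3_metric c r p w v"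
    by (simp add: UH3_metric_def lor_commute mult.commute)
next
  fix p v assume p: "p \<in> UH3 c" and v: "v \<in> tangent_space (UH3 c) p"
    and null: "\<forall>w\<in>tangent_space (UH3 c) p. UH3_metric c r p v w = 0"
  obtain g where g: "g \<in> SL2C" "congr2 g (UH3_base c) = p"
    using UH3_orbit[OF assms(1) p] by metis
  with v obtain a b d where v: "v = congr2 g (base_velocity c (mat2 (of_real a) b d (- of_real a)))"
    using tangent_space_UH3[OF g(1) assms(1)] by auto
  have "congr2 g (base_velocity c (mat2 (of_real a) (cnj d) (cnj b) (- of_real a))) \<in> tangent_space (UH3 c) p"
    using tangent_space_UH3[OF g(1) assms(1)] g(2) by auto
  with null have "UH3_metric c r p v (congr2 g (base_velocity c (mat2 (of_real a) (cnj d) (cnj b) (- of_real a)))) = 0"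
    by blast
  then have "Re (2 * of_real (a * a) + b * cnj b + d * cnj d) = 0"
    unfolding v g(2)[symmetric] UH3_metric_congr2[OF g(1)] UH3_metric_base[OF assms(1)]
    using assms(2) by simp
  moreover have "Re (2 * of_real (a * a) + b * cnj b + d * cnj d) = 2 * a\<^sup>2 + (cmod b)\<^sup>2 + (cmod d)\<^sup>2"
    unfolding cmod_power2 by (simp add: power2_eq_square)
  ultimately have "2 * a\<^sup>2 + (cmod b)\<^sup>2 + (cmod d)\<^sup>2 = 0" by simp
  moreover have "a\<^sup>2 \<ge> 0" "(cmod b)\<^sup>2 \<ge> 0" "(cmod d)\<^sup>2 \<ge> 0" by simp_all
  ultimately have "a\<^sup>2 = 0" "(cmod b)\<^sup>2 = 0" "(cmod d)\<^sup>2 = 0" by linarith+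
  then have "a = 0" "b = 0" "d = 0" by simp_all
  then show "v = 0"
    using base_velocity_mat2[of c 0 0 0]
    by (simp add: v congr2_def congr_def zero_prod_def flip: zero_mat2)
next
  fix p q assume "p \<in> UH3 c" "q \<in> UH3 c"
  then obtain g h where "g \<in> SL2C" "congr2 g (UH3_base c) = p" "h \<in> SL2C" "congr2 h (UH3_base c) = q"
    using UH3_orbit[OF assms(1)] by metis
  then show "metric_index (UH3 c) (UH3_metric c r) p = metric_index (UH3 c) (UH3_metric c r) q"
    using metric_index_UH3[OF assms(1)] by metis
qed

text \<open>The Cayley transform gives a rational parametrization of the circle.\<close>

lemma lie_algebra_U1: "mat2 \<i> 0 0 (- \<i>) \<in> lie_algebra U1"
proof -
  define p where "p t = 1 + \<i> * (of_real t / 2)" for t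
  define q where "q t = 1 - \<i> * (of_real t / 2)" for t
  have pq: "p t \<noteq> 0" "q t \<noteq> 0" "cnj (p t) = q t" "cnj (q t) = p t" for t
    by (auto simp: p_def q_def complex_eq_iff)
  define \<gamma> where "\<gamma> t = mat2 (p t * inverse (q t)) 0 0 (q t * inverse (p t))" for t
  let ?S = "{-1<..<1 :: real}"
  have t: "smooth_on ?S (\<lambda>t. complex_of_real t / 2)"
    by (intro smooth_on_linear bounded_linear_divide[THEN bounded_linear_compose] bounded_linear_of_real) auto
  have S: "smooth_on ?S p" "smooth_on ?S q" unfolding p_def[abs_def] q_def[abs_def]
    by (intro smooth_on_add smooth_on_diff smooth_on_mult t smooth_on_const; simp)+
  have "smooth_on ?S \<gamma>" unfolding \<gamma>_def[abs_def]
    by (intro smooth_on_mat2 smooth_on_mult smooth_on_inverse S pq smooth_on_const) auto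
  moreover have "\<gamma> ` ?S \<subseteq> U1"
  proof clarify
    fix t
    have "cmod (p t) = cmod (q t)" by (metis complex_mod_cnj pq(3))
    then show "\<gamma> t \<in> U1" unfolding U1_iff
      using pq[of t] by (intro exI[of _ "p t * inverse (q t)"]) (simp add: \<gamma>_def norm_mult norm_inverse)
  qed
  moreover have "\<gamma> 0 = mat 1" by (simp add: \<gamma>_def p_def q_def one_mat2)
  moreover have "(\<gamma> has_vector_derivative mat2 \<i> 0 0 (- \<i>)) (at 0)"
  proof -
    have dt: "((\<lambda>t. complex_of_real t / 2) has_vector_derivative (1 / 2)) (at 0)"
      using bounded_linear.has_vector_derivative[OF bounded_linear_divide has_vector_derivative_of_real[OF DERIV_ident]]
      by simp
    have dp: "(p has_vector_derivative \<i> / 2) (at 0)" "(q has_vector_derivative - \<i> / 2) (at 0)"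
      unfolding p_def[abs_def] q_def[abs_def] by (rule derivative_eq_intros dt refl | simp)+
    have di: "((\<lambda>t. inverse (p t)) has_vector_derivative - \<i> / 2) (at 0)"
      "((\<lambda>t. inverse (q t)) has_vector_derivative \<i> / 2) (at 0)"
      using Deriv.has_derivative_inverse[of p 0 _ UNIV] Deriv.has_derivative_inverse[of q 0 _ UNIV] dp pq
      by (force simp: has_vector_derivative_def p_def q_def)+
    have "((\<lambda>t. p t * inverse (q t)) has_vector_derivative \<i>) (at 0)"
      "((\<lambda>t. q t * inverse (p t)) has_vector_derivative - \<i>) (at 0)"
      by (rule derivative_eq_intros dp di refl | simp add: p_def q_def)+
    then show ?thesis unfolding \<gamma>_def[abs_def]
      by (intro has_vector_derivative_mat2 has_vector_derivative_const)
  qed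
  ultimately have "curve_in U1 (mat 1) (mat2 \<i> 0 0 (- \<i>)) \<gamma>"
    unfolding curve_in_def by (intro conjI exI[of _ 1]) auto
  then show ?thesis unfolding lie_algebra_def tangent_space_def by blast
qed

text \<open>The Killing product with \<open>diag(i, -i)\<close> is a multiple of the imaginary part of the diagonal
  entry.\<close>

lemma killing_complement_U1:
  assumes "X \<in> killing_complement (lie_algebra SL2C) (lie_algebra U1)"
  obtains a b d where "X = mat2 (of_real a) b d (- of_real a)"
proof -
  have X: "X \<in> sl2C" "killing_form sl2C X (mat2 \<i> 0 0 (- \<i>)) = 0"
    using assms lie_algebra_U1 by (auto simp: killing_complement_def lie_algebra_SL2C)
  obtain a b d where Xab: "X = mat2 a b d (- a)" using X(1) by (rule sl2C_exhaust)
  have "Im a = 0" using X(2) killing_form_sl2C[OF X(1), of "mat2 \<i> 0 0 (- \<i>)"] by (simp add: Xab)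
  then have "X = mat2 (of_real (Re a)) b d (- of_real (Re a))" by (simp add: Xab complex_eq_iff)
  then show ?thesis by (rule that)
qed

lemma normal_homogeneous_space_UH3:
  assumes "c < 0" "r \<noteq> 0"
  shows "normal_homogeneous_space SL2C U1 SL2C_act (UH3 c) (UH3_base c) r (UH3_metric c r)"
  unfolding normal_homogeneous_space_def
proof (intro conjI homogeneous_space_UH3 semi_riemannian_UH3 assms)
  show "semisimple_lie_algebra (lie_algebra SL2C)" by (simp add: lie_algebra_SL2C semisimple_sl2C)
  show "induced_from_killing SL2C U1 SL2C_act (UH3_base c) r (UH3_metric c r)"
    unfolding induced_from_killing_def SL2C_act_congr2
  proof (intro ballI allI impI)
    fix g X Y \<gamma> \<delta>
    assume g: "g \<in> SL2C" and X: "X \<in> killing_complement (lie_algebra SL2C) (lie_algebra U1)"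
      and Y: "Y \<in> killing_complement (lie_algebra SL2C) (lie_algebra U1)"
      and \<gamma>: "curve_in SL2C (mat 1) X \<gamma>" and \<delta>: "curve_in SL2C (mat 1) Y \<delta>"
    have vd: "vector_derivative (\<lambda>t. congr2 (g ** \<gamma> t) (UH3_base c)) (at 0) = congr2 g (base_velocity c X)"
      if "curve_in SL2C (mat 1) X \<gamma>" for X \<gamma>
      using bounded_linear.has_vector_derivative[OF bounded_linear_congr2
          orbit_has_vector_derivative[OF that, of "UH3_base c"]]
      by (intro vector_derivative_at) (simp add: congr2_congr2 base_velocity_def)
    obtain a b d where X: "X = mat2 (of_real a) b d (- of_real a)" using X by (rule killing_complement_U1)
    obtain a' b' d' where Y: "Y = mat2 (of_real a') b' d' (- of_real a')" using Y by (rule killing_complement_U1)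
    have "killing_form (lie_algebra SL2C) X Y = 8 * Re (2 * of_real (a * a') + b * d' + d * b')"
      unfolding lie_algebra_SL2C by (subst killing_form_sl2C) (simp_all add: X Y)
    then show "UH3_metric c r (congr2 g (UH3_base c))
        (vector_derivative (\<lambda>t. congr2 (g ** \<gamma> t) (UH3_base c)) (at 0))
        (vector_derivative (\<lambda>t. congr2 (g ** \<delta> t) (UH3_base c)) (at 0)) =
       r * killing_form (lie_algebra SL2C) X Y"
      unfolding vd[OF \<gamma>] vd[OF \<delta>] UH3_metric_congr2[OF g]
      by (simp only: X Y UH3_metric_base[OF assms(1)])
  qed
qed


section \<open>The automorphism of order four\<close>

lemma tau_group_mat2:
  assumes "a * d - b * c = 1"
  shows "tau_group (mat2 a b c d) = mat2 (cnj d) (\<i> * cnj c) (- \<i> * cnj b) (cnj a)"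
proof -
  define r where "r = csqrt \<i>"
  have r: "r * r = \<i>" using power2_csqrt[of \<i>] by (simp add: r_def power2_eq_square)
  then have r0: "r \<noteq> 0" by auto
  have i: "1 / r * (1 / r) = - \<i>" using r by (simp add: field_simps)
  have R: "R4 = mat2 (1 / r) 0 0 r" by (simp add: R4_def r_def)
  have inv: "matrix_inv R4 = mat2 r 0 0 (1 / r)" unfolding R using r0 by (subst matrix_inv_mat2) simp_all
  have "cnj a * cnj d - cnj c * cnj b = 1"
    using arg_cong[OF assms, of cnj] by (simp add: mult.commute)
  then have "matrix_inv (madj (mat2 a b c d)) = mat2 (cnj d) (- cnj c) (- cnj b) (cnj a)"
    by (simp add: matrix_inv_mat2)
  then have "tau_group (mat2 a b c d) =
      mat2 (cnj d) (- (1 / r * (1 / r)) * cnj c) (- (r * r) * cnj b) (cnj a)"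
    unfolding tau_group_def inv unfolding R using r0 by (simp add: ac_simps)
  then show ?thesis unfolding i r by simp
qed

lemma cnj_det_eq_one:
  assumes "a * d - b * c = 1"
  shows "cnj d * cnj a - (\<i> * cnj c) * (- \<i> * cnj b) = 1"
proof -
  have "cnj d * cnj a - (\<i> * cnj c) * (- \<i> * cnj b) = cnj (a * d - b * c)"
    by (simp add: complex_eq_iff algebra_simps)
  then show ?thesis by (simp only: assms complex_cnj_one)
qed

lemma tau_group_closed:
  assumes "g \<in> SL2C"
  shows "tau_group g \<in> SL2C"
proof -
  obtain a b c d where g: "g = mat2 a b c d" "a * d - b * c = 1" using assms by (rule SL2C_exhaust)
  show ?thesis unfolding g(1) tau_group_mat2[OF g(2)] SL2C_iff by (rule cnj_det_eq_one[OF g(2)])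
qed

text \<open>The square is conjugation by \<open>e1\<close>, an involution whose fixed matrices are the diagonal ones.\<close>

lemma tau_group_twice:
  assumes "a * d - b * c = 1"
  shows "tau_group (tau_group (mat2 a b c d)) = mat2 a (- b) (- c) d"
  unfolding tau_group_mat2[OF assms] tau_group_mat2[OF cnj_det_eq_one[OF assms]] by simp

lemma tau_group_fixed: "{g \<in> SL2C. tau_group g = g} = U1"
proof (intro equalityI subsetI)
  fix g assume g: "g \<in> {g \<in> SL2C. tau_group g = g}"
  then obtain a b c d where gm: "g = mat2 a b c d" "a * d - b * c = 1" by (auto elim: SL2C_exhaust)
  have "mat2 a (- b) (- c) d = mat2 a b c d"
    using g tau_group_twice[OF gm(2)] by (simp add: gm(1))
  then have bc: "b = 0" "c = 0" by (auto simp: complex_eq_iff)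
  have d: "d = cnj a" using g tau_group_mat2[OF gm(2)] by (auto simp: gm(1))
  have "of_real ((cmod a)\<^sup>2) = (1 :: complex)" unfolding complex_norm_square using gm(2) bc d by simp
  then have "(cmod a)\<^sup>2 = 1" using of_real_eq_1_iff by blast
  then have "cmod a = 1" by (metis norm_ge_zero one_power2 power2_eq_imp_eq zero_le_one)
  then show "g \<in> U1" unfolding U1_iff using gm(1) bc d by blast
next
  fix g assume "g \<in> U1"
  then obtain a where a: "cmod a = 1" "g = mat2 a 0 0 (cnj a)" by (auto simp: U1_iff)
  have "a * cnj a - 0 * 0 = 1" using complex_norm_square[of a] a(1) by simp
  then show "g \<in> {g \<in> SL2C. tau_group g = g}" using tau_group_mat2 by (simp add: a(2))
qed

lemma automorphism_tau_group: "automorphism_of_order 4 SL2C tau_group"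
  unfolding automorphism_of_order_def
proof (intro conjI ballI allI impI)
  have four: "tau_group (tau_group (tau_group (tau_group g))) = g" if "g \<in> SL2C" for g
    using that by (rule SL2C_exhaust) (simp add: tau_group_twice)
  then show "(tau_group ^^ 4) g = g" if "g \<in> SL2C" for g
    using that by (simp add: eval_nat_numeral)
  show "bij_betw tau_group SL2C SL2C"
    by (rule bij_betw_byWitness[where f' = "\<lambda>g. tau_group (tau_group (tau_group g))"])
      (auto simp: four tau_group_closed)
  show "tau_group (g ** h) = tau_group g ** tau_group h" if gh: "g \<in> SL2C" "h \<in> SL2C" for g h
  proof -
    obtain a b c d where g: "g = mat2 a b c d" "a * d - b * c = 1" using gh(1) by (rule SL2C_exhaust)
    obtain p q r s where h: "h = mat2 p q r s" "p * s - q * r = 1" using gh(2) by (rule SL2C_exhaust)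
    have "(a * p + b * r) * (c * q + d * s) - (a * q + b * s) * (c * p + d * r) = 1"
      using SL2C_mult[OF gh] by (simp add: g(1) h(1))
    from tau_group_mat2[OF this] show ?thesis
      by (simp add: g(1) h(1) tau_group_mat2[OF g(2)] tau_group_mat2[OF h(2)] algebra_simps)
  qed
  define T where "T A = mat2 (cnj (A $ 2 $ 2)) (\<i> * cnj (A $ 2 $ 1)) (- \<i> * cnj (A $ 1 $ 2)) (cnj (A $ 1 $ 1))"
    for A :: cmat2
  have "bounded_linear T"
    unfolding T_def by (intro linear_conv_bounded_linear[THEN iffD1] linearI)
      (simp_all add: algebra_simps scaleR_conv_of_real[where ?'a = complex])
  from smooth_on_linear[OF this open_UNIV] have "smooth_on UNIV T" .
  moreover have "T g = tau_group g" if "g \<in> SL2C" for g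
    using that by (rule SL2C_exhaust) (simp add: T_def tau_group_mat2)
  ultimately show "smooth_map_on SL2C tau_group"
    unfolding smooth_map_on_def by (intro ballI exI[of _ UNIV] exI[of _ T]) auto
  fix j :: nat assume "0 < j \<and> j < 4"
  then consider "j = 1" | "j = 2" | "j = 3" by fastforce
  then have "(tau_group ^^ j) (mat2 1 1 0 1) \<noteq> mat2 1 1 0 1"
    by cases (simp_all add: eval_nat_numeral tau_group_mat2 complex_eq_iff)
  then show "\<exists>g\<in>SL2C. (tau_group ^^ j) g \<noteq> g" by (intro bexI[of _ "mat2 1 1 0 1"]) auto
qed

lemma UH3_4_symmetric:
  assumes "c < 0" "r \<noteq> 0"
  shows "k_symmetric_space 4 tau_group SL2C U1 SL2C_act (UH3 c) (UH3_base c) r (UH3_metric c r)"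
  unfolding k_symmetric_space_def tau_group_fixed
  using normal_homogeneous_space_UH3[OF assms] automorphism_tau_group connected_component_subset[of U1]
  by simp


section \<open>The eigenspaces of the automorphism\<close>

lemma gC_scale_mat2:
  "gC_scale s (mat2 a b c d, mat2 a' b' c' d') =
    (mat2 (s * a) (s * b) (s * c) (s * d), mat2 (s * a') (s * b') (s * c') (s * d'))"
  by (simp add: gC_scale_def vec_eq_iff forall_2)

lemma g_eig_iff:
  "(mat2 a b c (- a), mat2 a' b' c' (- a')) \<in> g_eig k \<longleftrightarrow>
    - a' = (\<i> powi k) * a \<and> - a = (\<i> powi k) * a' \<and> \<i> * c' = (\<i> powi k) * b \<and> - \<i> * b' = (\<i> powi k) * c \<and>
    - \<i> * c = (\<i> powi k) * b' \<and> \<i> * b = (\<i> powi k) * c'"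
  by (auto simp: g_eig_def tau_hat_def tau_alg_mat2 gC_scale_mat2) (metis minus_minus)+

lemma g_eig_exhaust:
  assumes "Z \<in> g_eig k"
  obtains a b c a' b' c' where "Z = (mat2 a b c (- a), mat2 a' b' c' (- a'))"
proof -
  obtain X Y where Z: "Z = (X, Y)" by fastforce
  with assms have "X \<in> sl2C" "Y \<in> sl2C" by (auto simp: g_eig_def)
  then show ?thesis using that Z by (metis sl2C_exhaust)
qed

lemma i_powi: "\<i> powi 0 = 1" "\<i> powi 1 = \<i>" "\<i> powi 2 = -1" "\<i> powi 3 = - \<i>" "\<i> powi (-1) = - \<i>"
  by (simp_all add: power_int_def eval_nat_numeral)

text \<open>The fixed space consists of the pairs \<open>(D, -D)\<close> of diagonal matrices, so that its complement
  \<open>pC\<close> allows arbitrary off-diagonal entries but equal diagonals.\<close>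

lemma pC_iff:
  "(mat2 a b c (- a), mat2 a' b' c' (- a')) \<in> pC \<longleftrightarrow> a' = a"
proof
  assume "(mat2 a b c (- a), mat2 a' b' c' (- a')) \<in> pC"
  then obtain P Q R where s: "(mat2 a b c (- a), mat2 a' b' c' (- a')) = P + Q + R"
    and P: "P \<in> g_eig 1" and Q: "Q \<in> g_eig 2" and R: "R \<in> g_eig 3"
    by (auto simp: pC_def)
  obtain p1 p2 p3 p4 p5 p6 where P': "P = (mat2 p1 p2 p3 (- p1), mat2 p4 p5 p6 (- p4))"
    using P by (rule g_eig_exhaust)
  obtain q1 q2 q3 q4 q5 q6 where Q': "Q = (mat2 q1 q2 q3 (- q1), mat2 q4 q5 q6 (- q4))"
    using Q by (rule g_eig_exhaust)
  obtain r1 r2 r3 r4 r5 r6 where R': "R = (mat2 r1 r2 r3 (- r1), mat2 r4 r5 r6 (- r4))"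
    using R by (rule g_eig_exhaust)
  have zero: "x = 0 \<and> y = 0" if "- x = k * y" "- y = k * x" "k * k = - 1" for x y k :: complex
  proof -
    have "x = k * k * x" using that(1,2) by (metis minus_minus mult.assoc mult_minus_right)
    then have "2 * x = 0" unfolding that(3) by simp
    with that(2) show ?thesis by simp
  qed
  have e: "- p4 = \<i> * p1" "- p1 = \<i> * p4" "- r4 = - \<i> * r1" "- r1 = - \<i> * r4" and q: "- q4 = - 1 * q1"
    using P Q R unfolding P' Q' R' g_eig_iff i_powi by blast+
  have "p4 = 0 \<and> p1 = 0" "r4 = 0 \<and> r1 = 0" using zero[OF e(1,2)] zero[OF e(3,4)] by simp_all
  moreover have "q4 = q1" using q by simp
  ultimately have "p4 = p1" "r4 = r1" "q4 = q1" by simp_all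
  with s show "a' = a" by (auto simp: P' Q' R')
next
  assume a: "a' = a"
  let ?P = "(mat2 0 ((b + c') / 2) ((c - b') / 2) (- 0), mat2 0 ((b' - c) / 2) ((b + c') / 2) (- 0))"
  let ?Q = "(mat2 a 0 0 (- a), mat2 a 0 0 (- a))"
  let ?R = "(mat2 0 ((b - c') / 2) ((c + b') / 2) (- 0), mat2 0 ((c + b') / 2) ((c' - b) / 2) (- 0))"
  have "?P \<in> g_eig 1" "?Q \<in> g_eig 2" "?R \<in> g_eig 3"
    unfolding g_eig_iff i_powi by (simp_all add: complex_eq_iff field_simps)
  moreover have "(mat2 a b c (- a), mat2 a' b' c' (- a')) = ?P + ?Q + ?R"
    by (simp add: a add_divide_distrib diff_divide_distrib)
  ultimately show "(mat2 a b c (- a), mat2 a' b' c' (- a')) \<in> pC"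
    unfolding pC_def by blast
qed

lemma pC_subset: "Z \<in> pC \<Longrightarrow> Z \<in> sl2C \<times> sl2C"
  unfolding pC_def g_eig_def by (auto simp: sl2C_def trace_add)

text \<open>The component in the fixed space is half the difference of the diagonals.\<close>

lemma p_part_mat2:
  "p_part (mat2 a b c (- a), mat2 a' b' c' (- a')) =
    (mat2 ((a + a') / 2) b c (- ((a + a') / 2)), mat2 ((a + a') / 2) b' c' (- ((a + a') / 2)))"
  (is "_ = ?P")
  unfolding p_part_def
proof (rule the_equality)
  have "(mat2 a b c (- a), mat2 a' b' c' (- a')) - ?P =
      (mat2 ((a - a') / 2) 0 0 (- ((a - a') / 2)), mat2 ((a' - a) / 2) 0 0 (- ((a' - a) / 2)))"
    by (simp add: field_simps)
  also have "\<dots> \<in> g_eig 0"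
    unfolding g_eig_iff i_powi by (simp add: field_simps)
  finally show "?P \<in> pC \<and> (mat2 a b c (- a), mat2 a' b' c' (- a')) - ?P \<in> g_eig 0"
    by (simp add: pC_iff)
next
  fix P assume P: "P \<in> pC \<and> (mat2 a b c (- a), mat2 a' b' c' (- a')) - P \<in> g_eig 0"
  then obtain X Y where XY: "P = (X, Y)" "X \<in> sl2C" "Y \<in> sl2C" using pC_subset by blast
  obtain p q r where X: "X = mat2 p q r (- p)" using XY(2) by (rule sl2C_exhaust)
  obtain p' q' r' where Y: "Y = mat2 p' q' r' (- p')" using XY(3) by (rule sl2C_exhaust)
  have p: "p' = p" using P by (simp add: XY(1) X Y pC_iff)
  have "(mat2 (a - p) (b - q) (c - r) (- (a - p)), mat2 (a' - p') (b' - q') (c' - r') (- (a' - p'))) \<in> g_eig 0"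
    using P by (simp add: XY(1) X Y)
  then have eq: "- (a' - p') = a - p" "\<i> * (c' - r') = b - q" "- \<i> * (b' - q') = c - r"
    "- \<i> * (c - r) = b' - q'" "\<i> * (b - q) = c' - r'"
    unfolding g_eig_iff i_powi by simp_all
  have "\<i> * (\<i> * (b - q)) = b - q" "- \<i> * (- \<i> * (c - r)) = c - r"
    unfolding eq(4,5) eq(2,3) by (rule refl)+
  then have "b - q = 0" "c - r = 0" by (simp_all add: complex_eq_iff)
  moreover from this have "b' - q' = 0" "c' - r' = 0" using eq(4,5) by simp_all
  ultimately have "q = b" "r = c" "q' = b'" "r' = c'" by simp_all
  moreover have "a + a' = 2 * p" using eq(1) unfolding p by algebra
  then have "p = (a + a') / 2" by simp
  ultimately show "P = ?P" unfolding XY(1) X Y p by simp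
qed

text \<open>The \<open>(1,0)\<close>-part of a real-linear form is complex linear, so that it is enough to look at its
  value at 1.\<close>

lemma primitive_at_iff:
  assumes lin: "linear \<alpha>"
    and \<alpha>: "\<alpha> 1 = mat2 a1 b1 c1 (- a1)" "\<alpha> \<i> = mat2 a2 b2 c2 (- a2)"
  shows "(\<forall>v. part10 (\<lambda>w. p_part (\<alpha> w, mcnj (\<alpha> w))) v \<in> g_eig (-1)) \<longleftrightarrow>
    Re a1 = 0 \<and> Re a2 = 0 \<and> b1 + cnj c1 = \<i> * (b2 + cnj c2) \<and> cnj c1 - b1 = - \<i> * (cnj c2 - b2)"
proof -
  define A B C where "A w = Re w *\<^sub>R a1 + Im w *\<^sub>R a2" and "B w = Re w *\<^sub>R b1 + Im w *\<^sub>R b2"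
    and "C w = Re w *\<^sub>R c1 + Im w *\<^sub>R c2" for w
  have \<alpha>w: "\<alpha> w = mat2 (A w) (B w) (C w) (- A w)" for w
  proof -
    have "w = Re w *\<^sub>R 1 + Im w *\<^sub>R \<i>" by (simp add: complex_eq_iff)
    then have "\<alpha> w = Re w *\<^sub>R \<alpha> 1 + Im w *\<^sub>R \<alpha> \<i>"
      by (metis linear_add[OF lin] linear_cmul[OF lin])
    then show ?thesis by (simp add: \<alpha> A_def B_def C_def)
  qed
  have p: "p_part (\<alpha> w, mcnj (\<alpha> w)) =
      (mat2 (of_real (Re (A w))) (B w) (C w) (- of_real (Re (A w))),
       mat2 (of_real (Re (A w))) (cnj (B w)) (cnj (C w)) (- of_real (Re (A w))))" for w
  proof -
    have "(A w + cnj (A w)) / 2 = of_real (Re (A w))" by (simp add: complex_add_cnj)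
    moreover have "(\<alpha> w, mcnj (\<alpha> w)) = (mat2 (A w) (B w) (C w) (- A w),
        mat2 (cnj (A w)) (cnj (B w)) (cnj (C w)) (- cnj (A w)))" by (simp add: \<alpha>w)
    ultimately show ?thesis by (simp only: p_part_mat2)
  qed
  define M where "M = (of_real (Re a1) - \<i> * of_real (Re a2)) / 2"
  define Q where "Q = (b1 - \<i> * b2) / 2"
  define R where "R = (c1 - \<i> * c2) / 2"
  define Q' where "Q' = (cnj b1 - \<i> * cnj b2) / 2"
  define R' where "R' = (cnj c1 - \<i> * cnj c2) / 2"
  have "part10 (\<lambda>w. p_part (\<alpha> w, mcnj (\<alpha> w))) v =
      (mat2 (v * M) (v * Q) (v * R) (- (v * M)), mat2 (v * M) (v * Q') (v * R') (- (v * M)))" for v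
    unfolding part10_def p gC_scale_mat2
    by (simp add: A_def B_def C_def M_def Q_def R_def Q'_def R'_def complex_eq_iff field_simps)
  then have "(\<forall>v. part10 (\<lambda>w. p_part (\<alpha> w, mcnj (\<alpha> w))) v \<in> g_eig (-1)) \<longleftrightarrow>
      (\<forall>v. - (v * M) = - \<i> * (v * M) \<and> \<i> * (v * R') = - \<i> * (v * Q) \<and> - \<i> * (v * Q') = - \<i> * (v * R) \<and>
        - \<i> * (v * R) = - \<i> * (v * Q') \<and> \<i> * (v * Q) = - \<i> * (v * R'))"
    by (simp only: g_eig_iff i_powi) blast
  also have "\<dots> \<longleftrightarrow> M = 0 \<and> R' = - Q \<and> Q' = R" (is "?l \<longleftrightarrow> ?r")
  proof
    assume ?l
    from spec[OF this, of 1] have 1: "- M = - \<i> * M" "\<i> * R' = - \<i> * Q" "- \<i> * Q' = - \<i> * R"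
      unfolding mult_1 by blast+
    have "Re M = - Im M" "Im M = Re M" using arg_cong[OF 1(1), of Re] arg_cong[OF 1(1), of Im] by simp_all
    then have "M = 0" by (intro complex_eqI) simp_all
    moreover have "\<i> * R' = \<i> * (- Q)" "\<i> * Q' = \<i> * R" using 1(2,3) by simp_all
    then have "R' = - Q" "Q' = R" unfolding mult_cancel_left by simp_all
    ultimately show ?r by simp
  next
    assume ?r then show ?l by simp
  qed
  also have "\<dots> \<longleftrightarrow> Re a1 = 0 \<and> Re a2 = 0 \<and> b1 + cnj c1 = \<i> * (b2 + cnj c2) \<and> cnj c1 - b1 = - \<i> * (cnj c2 - b2)"
    unfolding M_def Q_def R_def Q'_def R'_def complex_eq_iff
    by (intro iffI; elim conjE; intro conjI) (simp_all add: field_simps)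
  finally show ?thesis .
qed


section \<open>Orientation\<close>

lemma det_4:
  "det (A::'a::comm_ring_1^4^4) =
    A$1$1 * A$2$2 * A$3$3 * A$4$4
    - A$1$1 * A$2$2 * A$3$4 * A$4$3
    - A$1$1 * A$2$3 * A$3$2 * A$4$4
    + A$1$1 * A$2$3 * A$3$4 * A$4$2
    + A$1$1 * A$2$4 * A$3$2 * A$4$3
    - A$1$1 * A$2$4 * A$3$3 * A$4$2
    - A$1$2 * A$2$1 * A$3$3 * A$4$4
    + A$1$2 * A$2$1 * A$3$4 * A$4$3
    + A$1$2 * A$2$3 * A$3$1 * A$4$4
    - A$1$2 * A$2$3 * A$3$4 * A$4$1
    - A$1$2 * A$2$4 * A$3$1 * A$4$3
    + A$1$2 * A$2$4 * A$3$3 * A$4$1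
    + A$1$3 * A$2$1 * A$3$2 * A$4$4
    - A$1$3 * A$2$1 * A$3$4 * A$4$2
    - A$1$3 * A$2$2 * A$3$1 * A$4$4
    + A$1$3 * A$2$2 * A$3$4 * A$4$1
    + A$1$3 * A$2$4 * A$3$1 * A$4$2
    - A$1$3 * A$2$4 * A$3$2 * A$4$1
    - A$1$4 * A$2$1 * A$3$2 * A$4$3
    + A$1$4 * A$2$1 * A$3$3 * A$4$2
    + A$1$4 * A$2$2 * A$3$1 * A$4$3
    - A$1$4 * A$2$2 * A$3$3 * A$4$1
    - A$1$4 * A$2$3 * A$3$1 * A$4$2
    + A$1$4 * A$2$3 * A$3$2 * A$4$1"
proof -
  have f1: "finite {2::4, 3, 4}" "1 \<notin> {2::4, 3, 4}" by auto
  have f2: "finite {3::4, 4}" "2 \<notin> {3::4, 4}" by auto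
  have f3: "finite {4::4}" "3 \<notin> {4::4}" by auto
  show ?thesis
    unfolding det_def UNIV_4
    unfolding sum_over_permutations_insert[OF f1]
    unfolding sum_over_permutations_insert[OF f2]
    unfolding sum_over_permutations_insert[OF f3]
    unfolding permutes_sing
    by (simp add: sign_swap_id permutation_swap_id permutation_compose sign_compose sign_id swap_id_eq)
qed

definition adj2 :: "cmat2 \<Rightarrow> cmat2"
  where "adj2 A = mat2 (A $ 2 $ 2) (- A $ 1 $ 2) (- A $ 2 $ 1) (A $ 1 $ 1)"

lemma adj2_mat2 [simp]: "adj2 (mat2 a b c d) = mat2 d (- b) (- c) a"
  by (simp add: adj2_def)

lemma adj2_mult: "adj2 (A ** B) = adj2 B ** adj2 A"
  by (cases A rule: mat2_exhaust; cases B rule: mat2_exhaust) (simp add: algebra_simps)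

lemma adj2_inverse:
  assumes "g \<in> SL2C"
  shows "g ** adj2 g = mat 1" "adj2 g ** g = mat 1"
  using assms by (auto elim!: SL2C_exhaust simp: one_mat2 algebra_simps)

lemma congr_adj2_congr:
  assumes "g \<in> SL2C"
  shows "congr g A ** adj2 (congr g B) = g ** (A ** adj2 B) ** adj2 g"
proof -
  have cancel: "madj g ** (adj2 (madj g) ** X) = X" for X :: cmat2
    using adj2_inverse[OF SL2C_madj[OF assms]] by (simp add: matrix_mul_assoc)
  show ?thesis
    unfolding congr_def adj2_mult by (simp only: matrix_mul_assoc[symmetric] cancel)
qed

text \<open>The adjugate of \<open>g B g\<^sup>*\<close> begins with the inverse of \<open>g\<^sup>*\<close> and ends with that of \<open>g\<close>, so that the inner
  factors cancel.\<close>

lemma congr_triple: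
  assumes "g \<in> SL2C"
  shows "congr g A ** adj2 (congr g B) ** congr g C = congr g (A ** adj2 B ** C)"
proof -
  have cancel: "adj2 g ** (g ** X) = X" for X :: cmat2
    using adj2_inverse[OF assms] by (simp add: matrix_mul_assoc)
  show ?thesis
    unfolding congr_adj2_congr[OF assms] by (simp only: congr_def matrix_mul_assoc[symmetric] cancel)
qed

text \<open>On Hermitian matrices the imaginary part is a multiple of the determinant of the coordinates; unlike
  that determinant, this expression is visibly invariant under the action.\<close>

definition volume_trace :: "cmat2 \<Rightarrow> cmat2 \<Rightarrow> cmat2 \<Rightarrow> cmat2 \<Rightarrow> complex"
  where "volume_trace A B C D = trace (A ** adj2 B ** C ** adj2 D)"

lemma volume_trace_congr:
  assumes "g \<in> SL2C"
  shows "volume_trace (congr g A) (congr g B) (congr g C) (congr g D) = volume_trace A B C D"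
proof -
  have "volume_trace (congr g A) (congr g B) (congr g C) (congr g D) =
      trace (g ** ((A ** adj2 B ** C ** adj2 D) ** adj2 g))"
    unfolding volume_trace_def congr_triple[OF assms] unfolding congr_adj2_congr[OF assms]
    by (simp only: matrix_mul_assoc[symmetric])
  also have "\<dots> = trace ((A ** adj2 B ** C ** adj2 D) ** adj2 g ** g)" by (rule trace_mul_sym)
  also have "\<dots> = volume_trace A B C D"
    unfolding volume_trace_def
    by (simp only: matrix_mul_assoc[symmetric] adj2_inverse[OF assms] matrix_mul_rid)
  finally show ?thesis .
qed

lemma vector_4_nth:
  "(vector [x, y, z, w] :: 'a::zero^4) $ 1 = x" "(vector [x, y, z, w] :: 'a::zero^4) $ 2 = y"
  "(vector [x, y, z, w] :: 'a::zero^4) $ 3 = z" "(vector [x, y, z, w] :: 'a::zero^4) $ 4 = w"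
  by (simp_all add: vector_def)

text \<open>The trace of an alternating product of four Pauli matrices contains the Levi-Civita symbol
  as its imaginary part.\<close>

lemma volume_trace_oriented:
  assumes "in_SO13_plus (vector [E1, E2, E3, E4])"
  shows "Im (volume_trace E1 E2 E3 E4) = - 2"
proof -
  obtain A where A: "A \<in> SO13_plus"
    "\<And>j. (vector [E1, E2, E3, E4] :: cmat2^4) $ j = (\<Sum>i\<in>UNIV. A $ i $ j *\<^sub>R her_basis $ i)"
    using assms by (auto simp: in_SO13_plus_def)
  have col: "(\<Sum>i\<in>UNIV. A $ i $ j *\<^sub>R her_basis $ i) =
      mat2 (of_real (A $ 1 $ j + A $ 2 $ j)) (Complex (A $ 4 $ j) (- A $ 3 $ j))
        (Complex (A $ 4 $ j) (A $ 3 $ j)) (of_real (A $ 1 $ j - A $ 2 $ j))" for j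
    by (simp add: sum_4 her_basis_def vector_4_nth e0_def e1_def e2_def e3_def complex_eq_iff)
  have E: "E1 = mat2 (of_real (A $ 1 $ 1 + A $ 2 $ 1)) (Complex (A $ 4 $ 1) (- A $ 3 $ 1))
        (Complex (A $ 4 $ 1) (A $ 3 $ 1)) (of_real (A $ 1 $ 1 - A $ 2 $ 1))"
    "E2 = mat2 (of_real (A $ 1 $ 2 + A $ 2 $ 2)) (Complex (A $ 4 $ 2) (- A $ 3 $ 2))
        (Complex (A $ 4 $ 2) (A $ 3 $ 2)) (of_real (A $ 1 $ 2 - A $ 2 $ 2))"
    "E3 = mat2 (of_real (A $ 1 $ 3 + A $ 2 $ 3)) (Complex (A $ 4 $ 3) (- A $ 3 $ 3))
        (Complex (A $ 4 $ 3) (A $ 3 $ 3)) (of_real (A $ 1 $ 3 - A $ 2 $ 3))"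
    "E4 = mat2 (of_real (A $ 1 $ 4 + A $ 2 $ 4)) (Complex (A $ 4 $ 4) (- A $ 3 $ 4))
        (Complex (A $ 4 $ 4) (A $ 3 $ 4)) (of_real (A $ 1 $ 4 - A $ 2 $ 4))"
    using A(2)[of 1] A(2)[of 2] A(2)[of 3] A(2)[of 4] unfolding vector_4_nth col by blast+
  have "Im (volume_trace E1 E2 E3 E4) = - 2 * det A"
    unfolding E volume_trace_def det_4 by (simp add: algebra_simps)
  then show ?thesis using A(1) by (simp add: SO13_plus_def)
qed


section \<open>Moving frames along a surface\<close>

lemma frame_derivative:
  assumes "open D" "z \<in> D" "frame_of c D F \<Phi>" "smooth_on D (\<lambda>z. fst (F z))" "smooth_on D (\<lambda>z. snd (F z))"
  shows "\<Phi> z \<in> SL2C" "linear (maurer_cartan \<Phi> z)" "maurer_cartan \<Phi> z v \<in> sl2C"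
    "sqrt \<bar>c\<bar> *\<^sub>R frechet_derivative (\<lambda>z. fst (F z)) (at z) v =
       congr (\<Phi> z) (inf_congr (maurer_cartan \<Phi> z v) (mat 1))"
    "frechet_derivative (\<lambda>z. snd (F z)) (at z) v = congr (\<Phi> z) (inf_congr (maurer_cartan \<Phi> z v) e1)"
proof -
  define \<Phi>' where "\<Phi>' = frechet_derivative \<Phi> (at z)"
  have S: "\<Phi> y \<in> SL2C" if "y \<in> D" for y using assms(3) that by (auto simp: frame_of_def)
  show g: "\<Phi> z \<in> SL2C" by (rule S[OF assms(2)])
  have \<Phi>: "(\<Phi> has_derivative \<Phi>') (at z)"
    unfolding \<Phi>'_def using assms(2,3) by (intro smooth_on_has_derivative) (auto simp: frame_of_def)
  have mc: "maurer_cartan \<Phi> z v = matrix_inv (\<Phi> z) ** \<Phi>' v" for v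
    by (simp add: maurer_cartan_def \<Phi>'_def)
  have "bounded_linear (\<lambda>v. matrix_inv (\<Phi> z) ** \<Phi>' v)"
    by (rule bounded_linear_compose[OF bounded_bilinear.bounded_linear_right[OF bounded_bilinear_matrix_mult]
          has_derivative_bounded_linear[OF \<Phi>]])
  then show "linear (maurer_cartan \<Phi> z)" unfolding mc[abs_def] by (rule bounded_linear.linear)
  have g\<alpha>: "\<Phi>' v = \<Phi> z ** maurer_cartan \<Phi> z v" for v
    unfolding mc matrix_mul_assoc SL2C_inv(2)[OF g] by simp
  show "maurer_cartan \<Phi> z v \<in> sl2C"
  proof -
    have entry: "((\<lambda>y. \<Phi> y $ i $ j) has_derivative (\<lambda>v. \<Phi>' v $ i $ j)) (at z)" for i j
      by (rule bounded_linear.has_derivative[OF bounded_linear_entry \<Phi>])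
    have 1: "((\<lambda>y. det (\<Phi> y)) has_derivative (\<lambda>v. (\<Phi> z $ 1 $ 1 * \<Phi>' v $ 2 $ 2 + \<Phi>' v $ 1 $ 1 * \<Phi> z $ 2 $ 2) -
        (\<Phi> z $ 1 $ 2 * \<Phi>' v $ 2 $ 1 + \<Phi>' v $ 1 $ 2 * \<Phi> z $ 2 $ 1))) (at z)"
      unfolding det_2 by (intro has_derivative_diff has_derivative_mult entry)
    have 2: "((\<lambda>y. det (\<Phi> y)) has_derivative (\<lambda>v. 0)) (at z)"
      by (rule has_derivative_transform_within_open[OF has_derivative_const[of 1] assms(1,2)])
        (use S in \<open>auto simp: SL2C_def\<close>)
    have "(\<Phi> z $ 1 $ 1 * \<Phi>' v $ 2 $ 2 + \<Phi>' v $ 1 $ 1 * \<Phi> z $ 2 $ 2) -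
        (\<Phi> z $ 1 $ 2 * \<Phi>' v $ 2 $ 1 + \<Phi>' v $ 1 $ 2 * \<Phi> z $ 2 $ 1) = 0"
      using fun_cong[OF has_derivative_unique[OF 1 2], of v] .
    moreover obtain a b d e where "\<Phi> z = mat2 a b d e" "a * e - b * d = 1" using g by (rule SL2C_exhaust)
    moreover obtain p q r s where "\<Phi>' v = mat2 p q r s" by (rule mat2_exhaust)
    ultimately show ?thesis unfolding mc by (simp add: matrix_inv_mat2 sl2C_def algebra_simps)
  qed
  have deriv: "frechet_derivative (\<lambda>y. congr (\<Phi> y) \<xi>) (at z) v = congr (\<Phi> z) (inf_congr (maurer_cartan \<Phi> z v) \<xi>)" for \<xi>
  proof (rule frechet_derivative_eqI[where D = "\<lambda>v. congr (\<Phi> z) (inf_congr (maurer_cartan \<Phi> z v) \<xi>)"])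
    have 1: "((\<lambda>y. \<Phi> y ** \<xi>) has_derivative (\<lambda>v. \<Phi>' v ** \<xi>)) (at z)"
      by (rule bounded_linear.has_derivative[OF
            bounded_bilinear.bounded_linear_left[OF bounded_bilinear_matrix_mult] \<Phi>])
    have 2: "((\<lambda>y. madj (\<Phi> y)) has_derivative (\<lambda>v. madj (\<Phi>' v))) (at z)"
      by (rule bounded_linear.has_derivative[OF bounded_linear_madj \<Phi>])
    have "\<Phi> z ** \<xi> ** madj (\<Phi>' v) + \<Phi>' v ** \<xi> ** madj (\<Phi> z) =
        congr (\<Phi> z) (inf_congr (maurer_cartan \<Phi> z v) \<xi>)" for v
      unfolding g\<alpha> congr_def inf_congr_def madj_mult
      by (simp add: bounded_bilinear.add_left[OF bounded_bilinear_matrix_mult]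
          bounded_bilinear.add_right[OF bounded_bilinear_matrix_mult] matrix_mul_assoc add.commute)
    with bounded_bilinear.FDERIV[OF bounded_bilinear_matrix_mult 1 2]
    show "((\<lambda>y. congr (\<Phi> y) \<xi>) has_derivative (\<lambda>v. congr (\<Phi> z) (inf_congr (maurer_cartan \<Phi> z v) \<xi>))) (at z)"
      by (simp add: congr_def)
  qed
  have F: "sqrt \<bar>c\<bar> *\<^sub>R fst (F y) = congr (\<Phi> y) (mat 1)" "snd (F y) = congr (\<Phi> y) e1" if "y \<in> D" for y
    using assms(3) that by (simp_all add: frame_of_def congr_def)
  have "sqrt \<bar>c\<bar> *\<^sub>R frechet_derivative (\<lambda>z. fst (F z)) (at z) v =
      frechet_derivative (\<lambda>y. sqrt \<bar>c\<bar> *\<^sub>R fst (F y)) (at z) v"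
    by (rule frechet_derivative_eqI[symmetric])
      (intro has_derivative_scaleR_right smooth_on_has_derivative[OF assms(4,2)])
  also have "\<dots> = frechet_derivative (\<lambda>y. congr (\<Phi> y) (mat 1)) (at z) v"
    by (simp only: frechet_derivative_cong_open[OF assms(1,2) F(1)])
  finally show "sqrt \<bar>c\<bar> *\<^sub>R frechet_derivative (\<lambda>z. fst (F z)) (at z) v =
       congr (\<Phi> z) (inf_congr (maurer_cartan \<Phi> z v) (mat 1))" by (simp only: deriv)
  have "frechet_derivative (\<lambda>z. snd (F z)) (at z) v = frechet_derivative (\<lambda>y. congr (\<Phi> y) e1) (at z) v"
    by (simp only: frechet_derivative_cong_open[OF assms(1,2) F(2)])
  then show "frechet_derivative (\<lambda>z. snd (F z)) (at z) v = congr (\<Phi> z) (inf_congr (maurer_cartan \<Phi> z v) e1)"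
    by (simp only: deriv)
qed

lemma derivative_of_constant_product:
  assumes "open D" "z \<in> D" "smooth_on D g" "smooth_on D h" "\<And>y. y \<in> D \<Longrightarrow> lor (g y) (h y) = k"
  shows "lor (frechet_derivative g (at z) v) (h z) = - lor (g z) (frechet_derivative h (at z) v)"
proof -
  have 1: "((\<lambda>y. lor (g y) (h y)) has_derivative
      (\<lambda>v. lor (g z) (frechet_derivative h (at z) v) + lor (frechet_derivative g (at z) v) (h z))) (at z)"
    by (intro bounded_bilinear.FDERIV[OF bounded_bilinear_lor]
        smooth_on_has_derivative[OF assms(3,2)] smooth_on_has_derivative[OF assms(4,2)])
  have 2: "((\<lambda>y. lor (g y) (h y)) has_derivative (\<lambda>v. 0)) (at z)"
    by (rule has_derivative_transform_within_open[OF has_derivative_const[of k] assms(1,2)])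
      (use assms(5) in auto)
  have "lor (g z) (frechet_derivative h (at z) v) + lor (frechet_derivative g (at z) v) (h z) = 0"
    using fun_cong[OF has_derivative_unique[OF 1 2], of v] .
  then show ?thesis by simp
qed

text \<open>In a frame, \<open>df\<close> and \<open>dn\<close> are given by the combinations \<open>p = b + cnj c\<close> and \<open>q = cnj c - b\<close> of the
  off-diagonal entries of the Maurer-Cartan form, at 1 and at \<open>i\<close>. Primitivity amounts to \<open>Re a = 0\<close>,
  \<open>p1 = i p2\<close> and \<open>q1 = - i q2\<close>. The first two conditions always hold: the one because \<open>n\<close> is normal,
  the other because \<open>f\<close> is conformal and the coordinate frame is positively oriented. Since
  \<open>p2 cnj (q2 - i q1)\<close> has a nonzero real multiple of the trace of the second fundamental form as real
  part, and vanishing imaginary part by symmetry of that form, the third condition is the vanishing of the mean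
  curvature.\<close>

lemma minimal_at_iff_primitive_at:
  assumes "c < 0" "open D" "z \<in> D" and surf: "surface c D f n u"
    and fr: "frame_of c D (\<lambda>z. (f z, n z)) \<Phi>"
  shows "mean_curvature f n z = 0 \<longleftrightarrow>
    (\<forall>v. part10 (\<lambda>w. p_part (maurer_cartan_C \<Phi> z w)) v \<in> g_eig (-1))"
proof -
  define s where "s = sqrt \<bar>c\<bar>"
  have s: "s > 0" using assms(1) by (simp add: s_def)
  have sm: "smooth_on D f" "smooth_on D n" using surf by (auto simp: surface_def)
  have dx: "smooth_on D (d_x f)" and dy: "smooth_on D (d_y f)"
    using smooth_on_frechet_derivative[OF sm(1)] by (simp_all add: d_x_def[abs_def] d_y_def[abs_def])
  note fd = frame_derivative[OF assms(2,3) fr, unfolded fst_conv snd_conv, OF sm, folded s_def]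
  define g where "g = \<Phi> z"
  have g: "g \<in> SL2C" "congr g (mat 1) = s *\<^sub>R f z" "congr g e1 = n z"
    using fd(1) fr assms(3) by (auto simp: g_def s_def frame_of_def congr_def)
  interpret L: bounded_bilinear lor by (rule bounded_bilinear_lor)
  obtain a1 b1 c1 where \<alpha>1: "maurer_cartan \<Phi> z 1 = mat2 a1 b1 c1 (- a1)" using fd(3)[of 1] by (rule sl2C_exhaust)
  obtain a2 b2 c2 where \<alpha>2: "maurer_cartan \<Phi> z \<i> = mat2 a2 b2 c2 (- a2)" using fd(3)[of \<i>] by (rule sl2C_exhaust)
  define p1 q1 p2 q2 where pq: "p1 = b1 + cnj c1" "q1 = cnj c1 - b1" "p2 = b2 + cnj c2" "q2 = cnj c2 - b2"
  have T: "inf_congr (mat2 a b d (- a)) (mat 1) = mat2 (of_real (2 * Re a)) (b + cnj d) (cnj (b + cnj d)) (- of_real (2 * Re a))"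
    "inf_congr (mat2 a b d (- a)) e1 = mat2 (of_real (2 * Re a)) (cnj d - b) (cnj (cnj d - b)) (of_real (2 * Re a))" for a b d
    by (simp_all add: inf_congr_def one_mat2 e1_def complex_eq_iff)
  have fx: "s *\<^sub>R d_x f z = congr g (mat2 (of_real (2 * Re a1)) p1 (cnj p1) (- of_real (2 * Re a1)))"
    and fy: "s *\<^sub>R d_y f z = congr g (mat2 (of_real (2 * Re a2)) p2 (cnj p2) (- of_real (2 * Re a2)))"
    and nx: "d_x n z = congr g (mat2 (of_real (2 * Re a1)) q1 (cnj q1) (of_real (2 * Re a1)))"
    and ny: "d_y n z = congr g (mat2 (of_real (2 * Re a2)) q2 (cnj q2) (of_real (2 * Re a2)))"
    unfolding d_x_def d_y_def fd(4) fd(5) \<alpha>1 \<alpha>2 T pq g_def by simp_all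
  have sz: "lor (d_x f z) (d_x f z) = exp (u z)" "lor (d_y f z) (d_y f z) = exp (u z)"
    "lor (d_x f z) (d_y f z) = 0"
    and perp: "\<And>y. y \<in> D \<Longrightarrow> lor (n y) (d_x f y) = 0" "\<And>y. y \<in> D \<Longrightarrow> lor (n y) (d_y f y) = 0"
    and ori: "in_SO13_plus (vector [s *\<^sub>R f z, n z, exp (- u z / 2) *\<^sub>R d_y f z, exp (- u z / 2) *\<^sub>R d_x f z])"
    using surf assms(3) by (auto simp: surface_def s_def)
  have "lor (n z) (s *\<^sub>R d_x f z) = 0" "lor (n z) (s *\<^sub>R d_y f z) = 0"
    using perp assms(3) by (simp_all add: L.scaleR_right)
  then have a: "Re a1 = 0" "Re a2 = 0"
    unfolding fx fy g(3)[symmetric] lor_congr[OF g(1)] by (simp_all add: e1_def lor_mat2)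
  note fx = fx[unfolded a, simplified] and fy = fy[unfolded a, simplified]
    and nx = nx[unfolded a, simplified] and ny = ny[unfolded a, simplified]
  have lm: "lor (mat2 0 p (cnj p) 0) (mat2 0 q (cnj q) 0) = Re (p * cnj q)" for p q
    by (simp add: lor_mat2)
  define k where "k = exp (- u z / 2) / s"
  have k: "k > 0" using s by (simp add: k_def)
  have ek: "s\<^sup>2 * exp (u z) = 1 / k\<^sup>2"
    using s by (simp add: k_def power_divide field_simps flip: exp_double exp_add)
  \<comment> \<open>Conformality determines \<open>p1\<close> from \<open>p2\<close> up to sign, and the orientation decides the sign.\<close>
  have "lor (s *\<^sub>R d_x f z) (s *\<^sub>R d_x f z) = s\<^sup>2 * exp (u z)"
    "lor (s *\<^sub>R d_x f z) (s *\<^sub>R d_y f z) = 0"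
    using sz by (simp_all add: L.scaleR_left L.scaleR_right power2_eq_square)
  then have n1: "Re (p1 * cnj p1) = 1 / k\<^sup>2" and n12: "Re (p1 * cnj p2) = 0"
    unfolding fx fy lor_congr[OF g(1)] lm ek by auto
  have "exp (- u z / 2) *\<^sub>R d_y f z = congr g (k *\<^sub>R mat2 0 p2 (cnj p2) 0)"
    "exp (- u z / 2) *\<^sub>R d_x f z = congr g (k *\<^sub>R mat2 0 p1 (cnj p1) 0)"
    unfolding congr_scaleR fx[symmetric] fy[symmetric] using s by (simp_all add: k_def)
  with volume_trace_oriented[OF ori]
  have "Im (volume_trace (mat 1) e1 (k *\<^sub>R mat2 0 p2 (cnj p2) 0) (k *\<^sub>R mat2 0 p1 (cnj p1) 0)) = - 2"
    by (simp only: g(2,3)[symmetric] volume_trace_congr[OF g(1)])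
  then have "k\<^sup>2 * Im (p2 * cnj p1) = - 1"
    by (simp add: volume_trace_def one_mat2 e1_def power2_eq_square algebra_simps)
  then have i21: "Im (p2 * cnj p1) = - (1 / k\<^sup>2)" using k by (simp add: field_simps)
  have "p2 * cnj p1 = - \<i> * (p1 * cnj p1)"
    using n1 n12 i21 by (simp add: complex_eq_iff algebra_simps)
  moreover have p10: "p1 \<noteq> 0" using n1 k by auto
  ultimately have "p2 = - \<i> * p1" by (metis complex_cnj_zero_iff mult.assoc mult_right_cancel)
  then have p12: "p1 = \<i> * p2" by simp
  with p10 have p20: "p2 \<noteq> 0" by auto
  \<comment> \<open>The second fundamental form is \<open>- \<langle>df, dn\<rangle>\<close>; its symmetry and its trace concern the imaginary and the
    real part of the same complex number.\<close>
  have lorx: "s * lor (frechet_derivative (d_x f) (at z) v) (n z) = - lor (s *\<^sub>R d_x f z) (frechet_derivative n (at z) v)"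
    and lory: "s * lor (frechet_derivative (d_y f) (at z) v) (n z) = - lor (s *\<^sub>R d_y f z) (frechet_derivative n (at z) v)" for v
    using derivative_of_constant_product[OF assms(2,3) dx sm(2)] derivative_of_constant_product[OF assms(2,3) dy sm(2)] perp
    by (simp_all add: L.scaleR_left lor_commute[of _ "n _"])
  have II: "s * lor (d_x (d_x f) z) (n z) = - Re (p1 * cnj q1)" "s * lor (d_y (d_y f) z) (n z) = - Re (p2 * cnj q2)"
    "s * lor (d_x (d_y f) z) (n z) = - Re (p2 * cnj q1)" "s * lor (d_y (d_x f) z) (n z) = - Re (p1 * cnj q2)"
    using lorx[of 1] lory[of \<i>] lory[of 1] lorx[of \<i>]
    unfolding fx fy by (fold d_x_def d_y_def) (simp_all only: nx ny lor_congr[OF g(1)] lm)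
  have "d_x (d_y f) z = d_y (d_x f) z"
    unfolding d_x_def[abs_def] d_y_def[abs_def] by (rule frechet_derivative_symmetric[OF assms(2,3) sm(1)])
  then have sym: "Re (p1 * cnj q2) = Re (p2 * cnj q1)" using II(3,4) by simp
  have "mean_curvature f n z = (lor (d_x (d_x f) z) (n z) + lor (d_y (d_y f) z) (n z)) / (2 * exp (u z))"
    unfolding mean_curvature_def Let_def sz by (simp add: field_simps power2_eq_square)
  then have "mean_curvature f n z = 0 \<longleftrightarrow> s * lor (d_x (d_x f) z) (n z) + s * lor (d_y (d_y f) z) (n z) = 0"
    using s by (simp flip: distrib_left)
  also have "\<dots> \<longleftrightarrow> Re (p2 * cnj (q2 - \<i> * q1)) = 0"
    unfolding II p12 by (auto simp: algebra_simps)
  also have "\<dots> \<longleftrightarrow> p2 * cnj (q2 - \<i> * q1) = 0"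
    using sym unfolding p12 by (auto simp: complex_eq_iff algebra_simps)
  also have "\<dots> \<longleftrightarrow> q2 = \<i> * q1" using p20 by (metis complex_cnj_zero_iff eq_iff_diff_eq_0 mult_eq_0_iff)
  also have "\<dots> \<longleftrightarrow> q1 = - \<i> * q2" by (auto simp: complex_eq_iff)
  also have "\<dots> \<longleftrightarrow> (\<forall>v. part10 (\<lambda>w. p_part (maurer_cartan_C \<Phi> z w)) v \<in> g_eig (-1))"
    unfolding maurer_cartan_C_def using primitive_at_iff[OF fd(2) \<alpha>1 \<alpha>2] a p12 by (simp add: pq)
  finally show ?thesis .
qed


section \<open>Lifting through a two-fold covering\<close>

text \<open>The quadratic map \<open>w \<mapsto> w w\<^sup>T\<close>, whose value determines \<open>w\<close> up to sign.\<close>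

definition rank_one :: "'a::euclidean_space \<Rightarrow> 'a \<Rightarrow>\<^sub>L 'a"
  where "rank_one w = Blinfun (\<lambda>v. (w \<bullet> v) *\<^sub>R w)"

lemma rank_one_apply [simp]: "blinfun_apply (rank_one w) v = (w \<bullet> v) *\<^sub>R w"
proof -
  have "bounded_linear (\<lambda>v. (w \<bullet> v) *\<^sub>R w)"
    by (intro bounded_linear_scaleR_const bounded_linear_inner_right)
  then show ?thesis unfolding rank_one_def by (simp add: bounded_linear_Blinfun_apply)
qed

lemma rank_one_eq_iff: "rank_one w = rank_one w' \<longleftrightarrow> w = w' \<or> w = - w'"
proof
  assume eq: "rank_one w = rank_one w'"
  have e: "(w \<bullet> v) *\<^sub>R w = (w' \<bullet> v) *\<^sub>R w'" for v
    using arg_cong[OF eq, of "\<lambda>T. blinfun_apply T v"] by simp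
  show "w = w' \<or> w = - w'"
  proof (cases "w = 0")
    case True
    then show ?thesis using e[of w'] by auto
  next
    case False
    define r where "r = (w' \<bullet> w) / (w \<bullet> w)"
    have w: "w = r *\<^sub>R w'" using e[of w] False by (simp add: r_def divide_inverse_commute)
       (metis inner_eq_zero_iff left_inverse scaleR_one scaleR_scaleR)
    have "w' \<noteq> 0" "(r * r) *\<^sub>R w' = 1 *\<^sub>R w'"
    proof -
      show "w' \<noteq> 0" using w False by auto
      then show "(r * r) *\<^sub>R w' = 1 *\<^sub>R w'"
        using e[of w'] unfolding w by (simp add: mult.left_commute)
    qed
    then have "r * r = 1" by (simp del: scaleR_one add: scaleR_cancel_right)
    then have "r = 1 \<or> r = - 1" by (simp add: square_eq_1_iff)
    then show ?thesis using w by auto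
  qed
qed (auto intro!: blinfun_eqI)

text \<open>Near the operator of \<open>w0\<close> the two square roots of an operator of rank one are told apart by
  the sign of their product with \<open>w0\<close>.\<close>

lemma covering_space_rank_one:
  "covering_space (- {0 :: 'a::euclidean_space}) rank_one (rank_one ` (- {0}))"
proof
  show cont: "continuous_on (- {0 :: 'a}) rank_one"
    by (rule continuous_on_blinfun_componentwise) (auto intro!: continuous_intros)
  show "rank_one ` (- {0 :: 'a}) = rank_one ` (- {0})" ..
  fix T0 :: "'a \<Rightarrow>\<^sub>L 'a" assume "T0 \<in> rank_one ` (- {0})"
  then obtain w0 :: 'a where w0: "w0 \<noteq> 0" "T0 = rank_one w0" by auto
  let ?S = "rank_one ` (- {0 :: 'a})"
  define N where "N = {T \<in> ?S. w0 \<bullet> blinfun_apply T w0 > 0}"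
  define V where "V \<sigma> = {w. \<sigma> * (w \<bullet> w0) > 0}" for \<sigma> :: real
  define q where "q \<sigma> T = (\<sigma> / sqrt (w0 \<bullet> blinfun_apply T w0)) *\<^sub>R blinfun_apply T w0" for \<sigma> T
  have "T0 \<in> N" using w0 by (auto simp: N_def)
  have "open {T :: 'a \<Rightarrow>\<^sub>L 'a. 0 < w0 \<bullet> blinfun_apply T w0}"
    by (intro open_Collect_less continuous_intros)
  then have openN: "openin (top_of_set ?S) N"
    unfolding N_def openin_open by (intro exI[of _ "{T. 0 < w0 \<bullet> blinfun_apply T w0}"]) auto
  have openV: "open (V \<sigma>)" for \<sigma> unfolding V_def by (intro open_Collect_less continuous_intros)
  have V0: "V \<sigma> \<subseteq> - {0}" for \<sigma> by (auto simp: V_def)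
  have qp: "q \<sigma> (rank_one w) = w" if "w \<in> V \<sigma>" "\<sigma> \<in> {1, -1}" for \<sigma> w
    using that by (auto simp: V_def q_def inner_commute real_sqrt_mult_self)
  have sq: "w0 \<bullet> blinfun_apply (rank_one w) w0 = (w \<bullet> w0) * (w \<bullet> w0)" for w
    by (simp add: inner_commute)
  have sheet: "w \<in> V \<sigma> \<or> - w \<in> V \<sigma>" if "w \<bullet> w0 \<noteq> 0" "\<sigma> \<in> {1, -1}" for w and \<sigma> :: real
    using that by (auto simp: V_def)
  have homeo: "homeomorphism (V \<sigma>) N rank_one (q \<sigma>)" if \<sigma>: "\<sigma> \<in> {1, -1}" for \<sigma>
  proof (rule homeomorphismI)
    show "continuous_on (V \<sigma>) rank_one" using cont V0 continuous_on_subset by blast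
    show "continuous_on N (q \<sigma>)" unfolding q_def N_def by (intro continuous_intros) auto
    show "rank_one ` V \<sigma> \<subseteq> N"
    proof (intro image_subsetI)
      fix w assume "w \<in> V \<sigma>"
      then have "w \<noteq> 0" "w \<bullet> w0 \<noteq> 0" by (auto simp: V_def)
      then show "rank_one w \<in> N" unfolding N_def mem_Collect_eq sq
        by (metis ComplI imageI not_real_square_gt_zero singletonD)
    qed
    have N: "\<exists>w\<in>V \<sigma>. T = rank_one w" if "T \<in> N" for T
    proof -
      obtain w where w: "T = rank_one w" using \<open>T \<in> N\<close> by (auto simp: N_def)
      with \<open>T \<in> N\<close> have "(w \<bullet> w0) * (w \<bullet> w0) > 0" by (simp only: N_def mem_Collect_eq sq)
      then have "w \<bullet> w0 \<noteq> 0" by auto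
      moreover have "rank_one (- w) = rank_one w" by (simp add: rank_one_eq_iff)
      ultimately show ?thesis using sheet[of w, OF _ \<sigma>] w by metis
    qed
    show "q \<sigma> ` N \<subseteq> V \<sigma>" using N qp \<sigma> by force
    show "q \<sigma> (rank_one w) = w" if "w \<in> V \<sigma>" for w using qp that \<sigma> by blast
    show "rank_one (q \<sigma> T) = T" if "T \<in> N" for T using N[OF that] qp \<sigma> by force
  qed
  have "\<Union>{V 1, V (-1)} = - {0} \<inter> rank_one -` N"
  proof (intro equalityI subsetI)
    fix w assume "w \<in> \<Union>{V 1, V (-1)}"
    then obtain \<sigma> where "\<sigma> \<in> {1, -1}" "w \<in> V \<sigma>" by auto
    then show "w \<in> - {0} \<inter> rank_one -` N"
      using homeo[of \<sigma>] V0 unfolding homeomorphism_def by blast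
  next
    fix w assume "w \<in> - {0} \<inter> rank_one -` N"
    then have "(w \<bullet> w0) * (w \<bullet> w0) > 0" by (simp only: N_def Int_iff vimage_eq mem_Collect_eq sq)
    then have "w \<bullet> w0 \<noteq> 0" by auto
    then show "w \<in> \<Union>{V 1, V (-1)}" by (auto simp: V_def)
  qed
  moreover have "pairwise disjnt {V 1, V (-1)}"
    by (auto simp: pairwise_def disjnt_def V_def)
  moreover have "\<forall>u\<in>{V 1, V (-1)}. openin (top_of_set (- {0})) u"
    using openV V0 by (auto intro!: open_subset)
  ultimately show "\<exists>T. T0 \<in> T \<and> openin (top_of_set ?S) T \<and>
      (\<exists>v. \<Union>v = - {0} \<inter> rank_one -` T \<and> (\<forall>u\<in>v. openin (top_of_set (- {0})) u) \<and> pairwise disjnt v \<and>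
        (\<forall>u\<in>v. \<exists>q. homeomorphism u T rank_one q))"
    using \<open>T0 \<in> N\<close> openN homeo by (intro exI[of _ N] conjI exI[of _ "{V 1, V (-1)}"]) blast+
qed

text \<open>The squares form a continuous map into the base of the covering, which lifts. Locally the lift is
  recovered from the square by dividing \<open>(w \<bullet> w0) w\<close> by \<open>w \<bullet> w0\<close>, the square root of a smooth positive
  function; this makes it smooth.\<close>

lemma smooth_sign_choice:
  fixes \<psi> :: "'b::real_normed_vector \<Rightarrow> 'a::euclidean_space"
  assumes D: "open D" "simply_connected D" "locally path_connected D"
    and sm: "\<And>v. smooth_on D (\<lambda>z. (\<psi> z \<bullet> v) *\<^sub>R \<psi> z)" and nz: "\<And>z. z \<in> D \<Longrightarrow> \<psi> z \<noteq> 0"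
  obtains w where "smooth_on D w" "\<And>z. z \<in> D \<Longrightarrow> w z = \<psi> z \<or> w z = - \<psi> z"
proof -
  have "continuous_on D (\<lambda>z. rank_one (\<psi> z))"
    by (rule continuous_on_blinfun_componentwise) (simp add: smooth_on_imp_continuous_on[OF sm])
  moreover have "(\<lambda>z. rank_one (\<psi> z)) \<in> D \<rightarrow> rank_one ` (- {0})" using nz by auto
  ultimately obtain w where w: "continuous_on D w" "\<And>z. z \<in> D \<Longrightarrow> rank_one (w z) = rank_one (\<psi> z)"
    using covering_space_lift[OF covering_space_rank_one D(2,3)] by metis
  have sign: "w z = \<psi> z \<or> w z = - \<psi> z" if "z \<in> D" for z
    using w(2)[OF that] by (simp add: rank_one_eq_iff)
  have "smooth_on D w"
  proof (rule smooth_on_local)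
    fix z0 assume z0: "z0 \<in> D"
    define w0 where "w0 = w z0"
    define U where "U = {z \<in> D. w z \<bullet> w0 > 0}"
    have "open (D \<inter> (\<lambda>z. w z \<bullet> w0) -` {0<..})"
      by (rule continuous_open_preimage) (auto intro!: continuous_intros w(1) D(1))
    then have U: "open U" by (simp add: U_def vimage_def Int_def)
    have "w0 \<noteq> 0" using sign[OF z0] nz[OF z0] by (auto simp: w0_def)
    then have "z0 \<in> U" using z0 by (simp add: U_def w0_def)
    let ?P = "\<lambda>z. (\<psi> z \<bullet> w0) *\<^sub>R \<psi> z"
    have sm': "smooth_on U ?P" by (rule smooth_on_subset[OF sm]) (auto simp: U_def)
    have eq: "?P z = (w z \<bullet> w0) *\<^sub>R w z" if "z \<in> U" for z
      using sign[of z] that by (auto simp: U_def)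
    have pos: "?P z \<bullet> w0 > 0" if "z \<in> U" for z
      using eq[OF that] that by (simp add: U_def)
    have "smooth_on U (\<lambda>z. inverse (sqrt (?P z \<bullet> w0)) *\<^sub>R ?P z)"
      by (intro smooth_on_scaleR smooth_on_inverse_sqrt U sm' pos
          smooth_on_linear_compose[OF bounded_linear_inner_left])
    moreover have "inverse (sqrt (?P z \<bullet> w0)) *\<^sub>R ?P z = w z" if "z \<in> U" for z
      using that unfolding eq[OF that] by (simp add: U_def)
    ultimately have "smooth_on U w"
      using smooth_on_cong[OF U, of "\<lambda>z. inverse (sqrt (?P z \<bullet> w0)) *\<^sub>R ?P z" w] by blast
    with U \<open>z0 \<in> U\<close> show "\<exists>U. open U \<and> z0 \<in> U \<and> smooth_on U w" by blast
  qed
  with sign show ?thesis using that by blast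
qed


section \<open>Existence of frames\<close>

text \<open>Transitivity on the bundle moves \<open>x\<close>, \<open>v\<close> to the base point and \<open>t\<close> to an off-diagonal matrix with
  unimodular entry \<open>y\<close>; the isotropy group then rotates \<open>e3\<close> to it, by a square root of \<open>y\<close>.\<close>

lemma orthonormal_triple_lift:
  assumes "c < 0" "(x, v) \<in> UH3 c" "t \<in> Her2" "lor t t = 1" "lor x t = 0" "lor v t = 0"
  obtains g where "g \<in> SL2C" "congr g (mat 1) = sqrt \<bar>c\<bar> *\<^sub>R x" "congr g e1 = v" "congr g e3 = t"
proof -
  obtain g where g: "g \<in> SL2C" "congr g (mat 1) = sqrt \<bar>c\<bar> *\<^sub>R x" "congr g e1 = v"
    using UH3_transitive[OF assms(1,2)] .
  interpret L: bounded_bilinear lor by (rule bounded_bilinear_lor)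
  define w where "w = congr (matrix_inv g) t"
  have gw: "congr g w = t" by (simp add: w_def congr_inv[OF g(1)])
  have "w \<in> Her2" using Her2_congr_iff[OF g(1), of w] assms(3) by (simp add: gw)
  then obtain p q y where w: "w = mat2 (of_real p) y (cnj y) (of_real q)" by (rule Her2_exhaust)
  have "lor (mat 1) w = 0" "lor e1 w = 0" "lor w w = 1"
    using lor_congr[OF g(1), of "mat 1" w] lor_congr[OF g(1), of e1 w] lor_congr[OF g(1), of w w] assms(4,5,6)
    by (simp_all add: gw g(2,3) L.scaleR_left)
  then have "p + q = 0" "q - p = 0" and l: "Re (y * cnj y) - p * q = 1"
    by (simp_all add: w one_mat2 e1_def lor_mat2)
  then have pq: "p = 0" "q = 0" by linarith+
  define a where "a = csqrt y"
  have a: "a * a = y" by (simp add: a_def flip: power2_eq_square)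
  have "(cmod y)\<^sup>2 = 1" using l unfolding pq cmod_power2 by (simp add: power2_eq_square)
  then have "cmod y = 1" by (metis norm_ge_zero one_power2 power2_eq_imp_eq zero_le_one)
  then have "cmod a * cmod a = 1" using a by (metis norm_mult)
  then have "(cmod a)\<^sup>2 = 1" by (simp only: power2_eq_square)
  then have aa: "a * cnj a = 1" using complex_norm_square[of a] by simp
  let ?h = "mat2 a 0 0 (cnj a)"
  have h: "?h \<in> SL2C" "congr ?h (mat 1) = mat 1" "congr ?h e1 = e1" "congr ?h e3 = w"
    using aa a by (simp_all add: congr_def one_mat2 e1_def e3_def w pq mult.commute[of "cnj a" a] flip: complex_cnj_mult)
  show ?thesis
    by (rule that[of "g ** ?h"])
      (simp_all only: SL2C_mult[OF g(1) h(1)] congr_congr[symmetric] h(2-4) g(2,3) gw)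
qed

text \<open>The right-hand side contains only products of the form \<open>g\<^sub>i\<^sub>j cnj g\<^sub>k\<^sub>l\<close>, which are entries of images of
  matrices under \<open>congr g\<close>. The products of two entries without conjugation, which occur when the real inner
  product is written out, are brought to this form by multiplying with \<open>cnj (det g) = 1\<close>.\<close>

lemma square_of_SL2C:
  assumes "g \<in> SL2C"
  shows "((g \<bullet> v) *\<^sub>R g) $ i $ j = (1/2) *\<^sub>R (\<Sum>k\<in>UNIV. \<Sum>l\<in>UNIV.
    v $ k $ l * (g $ i $ j * cnj (g $ k $ l)) + cnj (v $ k $ l) *
      ((g $ k $ l * cnj (g $ 1 $ 1)) * (g $ i $ j * cnj (g $ 2 $ 2)) -
       (g $ k $ l * cnj (g $ 1 $ 2)) * (g $ i $ j * cnj (g $ 2 $ 1))))"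
proof -
  have det: "cnj (g $ 1 $ 1) * cnj (g $ 2 $ 2) - cnj (g $ 1 $ 2) * cnj (g $ 2 $ 1) = 1"
    using assms by (simp add: SL2C_def det_2 flip: complex_cnj_mult complex_cnj_diff)
  have "g $ k $ l * cnj (g $ 1 $ 1) * (g $ i $ j * cnj (g $ 2 $ 2)) -
      g $ k $ l * cnj (g $ 1 $ 2) * (g $ i $ j * cnj (g $ 2 $ 1)) =
      g $ k $ l * g $ i $ j * (cnj (g $ 1 $ 1) * cnj (g $ 2 $ 2) - cnj (g $ 1 $ 2) * cnj (g $ 2 $ 1))" for k l
    by (simp add: algebra_simps)
  then have eq: "g $ k $ l * cnj (g $ 1 $ 1) * (g $ i $ j * cnj (g $ 2 $ 2)) -
      g $ k $ l * cnj (g $ 1 $ 2) * (g $ i $ j * cnj (g $ 2 $ 1)) = g $ k $ l * g $ i $ j" for k l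
    unfolding det by simp
  have re: "complex_of_real (x \<bullet> y) = (y * cnj x + cnj y * x) / 2" for x y
    by (simp add: complex_eq_iff inner_complex_def)
  have "((g \<bullet> v) *\<^sub>R g) $ i $ j = complex_of_real (g \<bullet> v) * g $ i $ j"
    by (simp add: scaleR_conv_of_real[where ?'a = complex])
  also have "\<dots> = (\<Sum>k\<in>UNIV. \<Sum>l\<in>UNIV. (v $ k $ l * cnj (g $ k $ l) + cnj (v $ k $ l) * g $ k $ l) / 2 * g $ i $ j)"
    by (simp add: inner_vec_def re sum_distrib_right)
  also have "\<dots> = (1/2) *\<^sub>R (\<Sum>k\<in>UNIV. \<Sum>l\<in>UNIV.
      v $ k $ l * (g $ i $ j * cnj (g $ k $ l)) + cnj (v $ k $ l) * (g $ k $ l * g $ i $ j))"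
    unfolding scaleR_sum_right
    by (intro sum.cong refl) (simp add: scaleR_conv_of_real field_simps)
  finally show ?thesis unfolding eq .
qed

text \<open>The matrices \<open>1\<close>, \<open>e1\<close>, \<open>e3\<close> and \<open>e1 e3\<close> span all real matrices, and the image of the last one is a
  product of the images of the others and an adjugate.\<close>

lemma smooth_square_of_frame:
  assumes D: "open D" and S: "\<And>z. z \<in> D \<Longrightarrow> \<psi> z \<in> SL2C"
    and sm: "smooth_on D (\<lambda>z. congr (\<psi> z) (mat 1))" "smooth_on D (\<lambda>z. congr (\<psi> z) e1)"
      "smooth_on D (\<lambda>z. congr (\<psi> z) e3)"
  shows "smooth_on D (\<lambda>z. (\<psi> z \<bullet> v) *\<^sub>R \<psi> z)"
proof -
  have adj: "bounded_linear adj2"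
  proof (intro linear_conv_bounded_linear[THEN iffD1] linearI)
    show "adj2 (A + B) = adj2 A + adj2 B" "adj2 (r *\<^sub>R A) = r *\<^sub>R adj2 A" for A B r
      by (cases A rule: mat2_exhaust; cases B rule: mat2_exhaust; simp)+
  qed
  have "smooth_on D (\<lambda>z. congr (\<psi> z) e1 ** adj2 (congr (\<psi> z) (mat 1)) ** congr (\<psi> z) e3)"
    by (intro smooth_on_bilinear[OF bounded_bilinear_matrix_mult] D sm smooth_on_linear_compose[OF adj])
  moreover have "congr (\<psi> z) e1 ** adj2 (congr (\<psi> z) (mat 1)) ** congr (\<psi> z) e3 =
      congr (\<psi> z) (mat2 0 1 (- 1) 0)" if "z \<in> D" for z
    unfolding congr_triple[OF S[OF that]] by (simp add: e1_def e3_def one_mat2)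
  ultimately have s4: "smooth_on D (\<lambda>z. congr (\<psi> z) (mat2 0 1 (- 1) 0))"
    using smooth_on_cong[OF D, of "\<lambda>z. congr (\<psi> z) e1 ** adj2 (congr (\<psi> z) (mat 1)) ** congr (\<psi> z) e3"
        "\<lambda>z. congr (\<psi> z) (mat2 0 1 (- 1) 0)"] by blast
  have comb: "smooth_on D (\<lambda>z. congr (\<psi> z) ((1/2) *\<^sub>R (A + r *\<^sub>R B)))"
    if "smooth_on D (\<lambda>z. congr (\<psi> z) A)" "smooth_on D (\<lambda>z. congr (\<psi> z) B)" for A B and r :: real
    unfolding congr_scaleR congr_add by (intro smooth_on_scaleR smooth_on_add D that smooth_on_const)
  have unit: "smooth_on D (\<lambda>z. congr (\<psi> z) (mat2 1 0 0 0))" "smooth_on D (\<lambda>z. congr (\<psi> z) (mat2 0 0 0 1))"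
    "smooth_on D (\<lambda>z. congr (\<psi> z) (mat2 0 1 0 0))" "smooth_on D (\<lambda>z. congr (\<psi> z) (mat2 0 0 1 0))"
    using comb[OF sm(1,2), of 1] comb[OF sm(1,2), of "- 1"] comb[OF sm(3) s4, of 1] comb[OF sm(3) s4, of "- 1"]
    by (simp_all add: one_mat2 e1_def e3_def scaleR_conv_of_real[where ?'a = complex])
  have prod: "smooth_on D (\<lambda>z. \<psi> z $ i $ j * cnj (\<psi> z $ k $ l))" for i j k l
  proof -
    have e: "congr g (mat2 1 0 0 0) $ i $ k = g $ i $ 1 * cnj (g $ k $ 1)"
      "congr g (mat2 0 0 0 1) $ i $ k = g $ i $ 2 * cnj (g $ k $ 2)"
      "congr g (mat2 0 1 0 0) $ i $ k = g $ i $ 1 * cnj (g $ k $ 2)"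
      "congr g (mat2 0 0 1 0) $ i $ k = g $ i $ 2 * cnj (g $ k $ 1)" for g
      by (simp_all add: congr_def matrix_matrix_mult_def sum_2 madj_def)
    have "j = 1 \<or> j = 2" "l = 1 \<or> l = 2" using exhaust_2 by auto
    then show ?thesis
      using unit[THEN smooth_on_linear_compose[OF bounded_linear_entry D], of i k] unfolding e by auto
  qed
  have entry: "smooth_on D (\<lambda>z. ((\<psi> z \<bullet> v) *\<^sub>R \<psi> z) $ i $ j)" for i j
  proof -
    have summand: "smooth_on D (\<lambda>z.
      v $ k $ l * (\<psi> z $ i $ j * cnj (\<psi> z $ k $ l)) + cnj (v $ k $ l) *
      ((\<psi> z $ k $ l * cnj (\<psi> z $ 1 $ 1)) * (\<psi> z $ i $ j * cnj (\<psi> z $ 2 $ 2)) -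
       (\<psi> z $ k $ l * cnj (\<psi> z $ 1 $ 2)) * (\<psi> z $ i $ j * cnj (\<psi> z $ 2 $ 1))))" for k l
      by (rule smooth_on_add[OF D smooth_on_mult[OF D smooth_on_const prod] smooth_on_mult[OF D smooth_on_const
            smooth_on_diff[OF D smooth_on_mult[OF D prod prod] smooth_on_mult[OF D prod prod]]]])
    have "smooth_on D (\<lambda>z. (1/2) *\<^sub>R (\<Sum>k\<in>UNIV. \<Sum>l\<in>UNIV.
      v $ k $ l * (\<psi> z $ i $ j * cnj (\<psi> z $ k $ l)) + cnj (v $ k $ l) *
      ((\<psi> z $ k $ l * cnj (\<psi> z $ 1 $ 1)) * (\<psi> z $ i $ j * cnj (\<psi> z $ 2 $ 2)) -
       (\<psi> z $ k $ l * cnj (\<psi> z $ 1 $ 2)) * (\<psi> z $ i $ j * cnj (\<psi> z $ 2 $ 1)))))"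
      unfolding sum_2
      by (rule smooth_on_scaleR[OF D smooth_on_const smooth_on_add[OF D
            smooth_on_add[OF D summand summand] smooth_on_add[OF D summand summand]]])
    then show ?thesis
      by (rule iffD2[OF smooth_on_cong[OF D square_of_SL2C], rotated]) (rule S)
  qed
  have "smooth_on D (\<lambda>z. mat2 (((\<psi> z \<bullet> v) *\<^sub>R \<psi> z) $ 1 $ 1) (((\<psi> z \<bullet> v) *\<^sub>R \<psi> z) $ 1 $ 2)
      (((\<psi> z \<bullet> v) *\<^sub>R \<psi> z) $ 2 $ 1) (((\<psi> z \<bullet> v) *\<^sub>R \<psi> z) $ 2 $ 2))"
    by (intro smooth_on_mat2 entry D)
  moreover have "mat2 (A $ 1 $ 1) (A $ 1 $ 2) (A $ 2 $ 1) (A $ 2 $ 2) = A" for A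
    by (simp add: vec_eq_iff forall_2)
  ultimately show ?thesis by (simp only:)
qed

text \<open>The pair \<open>(f, n)\<close> alone determines a frame only up to a phase, which leaves no canonical choice. Together with
  the unit vector in the direction of \<open>f\<^sub>x\<close> it determines the frame up to sign, and over a simply
  connected domain the sign can be chosen consistently.\<close>

lemma frame_exists:
  assumes "c < 0" "open D" "simply_connected D" and surf: "surface c D f n u"
  obtains \<Phi> where "frame_of c D (\<lambda>z. (f z, n z)) \<Phi>"
proof -
  have sm: "smooth_on D f" "smooth_on D n" using surf by (auto simp: surface_def)
  have dx: "smooth_on D (d_x f)"
    using smooth_on_frechet_derivative[OF sm(1)] by (simp add: d_x_def[abs_def])
  have H: "(f z, n z) \<in> UH3 c" "lor (d_x f z) (d_x f z) = exp (u z)" "lor (n z) (d_x f z) = 0"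
    and fH: "f z \<in> Her2" "lor (f z) (f z) = - (1 / \<bar>c\<bar>)" if "z \<in> D" for z
  proof -
    show "(f z, n z) \<in> UH3 c" "lor (d_x f z) (d_x f z) = exp (u z)" "lor (n z) (d_x f z) = 0"
      "f z \<in> Her2" "lor (f z) (f z) = - (1 / \<bar>c\<bar>)"
      using surf that by (auto simp: surface_def H3_def lor_self[of "f z"])
  qed
  have dxH: "d_x f z \<in> Her2" "lor (f z) (d_x f z) = 0" if "z \<in> D" for z
  proof -
    have "frechet_derivative (\<lambda>y. madj (f y)) (at z) 1 = madj (d_x f z)" unfolding d_x_def
      by (rule frechet_derivative_eqI) (intro bounded_linear.has_derivative[OF bounded_linear_madj]
          smooth_on_has_derivative[OF sm(1) that])
    moreover have "frechet_derivative (\<lambda>y. madj (f y)) (at z) = frechet_derivative f (at z)"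
      using fH(1) by (intro frechet_derivative_cong_open[OF assms(2) that]) (simp add: Her2_def)
    ultimately show "d_x f z \<in> Her2" by (simp add: Her2_def d_x_def)
    have "lor (d_x f z) (f z) = - lor (f z) (d_x f z)"
      unfolding d_x_def by (rule derivative_of_constant_product[OF assms(2) that sm(1) sm(1) fH(2)])
    then show "lor (f z) (d_x f z) = 0" by (simp add: lor_commute[of _ "f z"])
  qed
  interpret L: bounded_bilinear lor by (rule bounded_bilinear_lor)
  define t where "t z = inverse (sqrt (lor (d_x f z) (d_x f z))) *\<^sub>R d_x f z" for z
  have smt: "smooth_on D t" unfolding t_def
    by (intro smooth_on_scaleR smooth_on_inverse_sqrt smooth_on_bilinear[OF bounded_bilinear_lor] assms(2) dx)
      (simp add: H(2))
  have "\<exists>g. g \<in> SL2C \<and> congr g (mat 1) = sqrt \<bar>c\<bar> *\<^sub>R f z \<and> congr g e1 = n z \<and> congr g e3 = t z" if "z \<in> D" for z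
  proof -
    have "t z \<in> Her2" using dxH(1)[OF that] by (simp add: t_def Her2_def madj_scaleR)
    moreover have "lor (t z) (t z) = 1"
      using H(2)[OF that] unfolding t_def L.scaleR_left L.scaleR_right
      by (simp add: field_simps)
    moreover have "lor (f z) (t z) = 0" "lor (n z) (t z) = 0"
      using H(3)[OF that] dxH(2)[OF that] by (simp_all add: t_def L.scaleR_right)
    ultimately show ?thesis
      using orthonormal_triple_lift[OF assms(1) H(1)[OF that]] by metis
  qed
  then obtain \<psi> where \<psi>: "\<psi> z \<in> SL2C" "congr (\<psi> z) (mat 1) = sqrt \<bar>c\<bar> *\<^sub>R f z" "congr (\<psi> z) e1 = n z"
    "congr (\<psi> z) e3 = t z" if "z \<in> D" for z by metis
  have "smooth_on D (\<lambda>z. sqrt \<bar>c\<bar> *\<^sub>R f z)" by (intro smooth_on_scaleR assms(2) sm smooth_on_const)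
  moreover have "smooth_on D (\<lambda>z. congr (\<psi> z) (mat 1)) \<longleftrightarrow> smooth_on D (\<lambda>z. sqrt \<bar>c\<bar> *\<^sub>R f z)"
    "smooth_on D (\<lambda>z. congr (\<psi> z) e1) \<longleftrightarrow> smooth_on D n" "smooth_on D (\<lambda>z. congr (\<psi> z) e3) \<longleftrightarrow> smooth_on D t"
    by (rule smooth_on_cong[OF assms(2)]; rule \<psi>; assumption)+
  ultimately have "smooth_on D (\<lambda>z. congr (\<psi> z) (mat 1))" "smooth_on D (\<lambda>z. congr (\<psi> z) e1)"
    "smooth_on D (\<lambda>z. congr (\<psi> z) e3)"
    using sm(2) smt by simp_all
  then have sq: "smooth_on D (\<lambda>z. (\<psi> z \<bullet> v) *\<^sub>R \<psi> z)" for v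
    by (intro smooth_square_of_frame assms(2) \<psi>(1))
  have nz: "\<psi> z \<noteq> 0" if "z \<in> D" for z using \<psi>(1)[OF that] by (auto simp: zero_mat2)
  obtain w where w: "smooth_on D w" "\<And>z. z \<in> D \<Longrightarrow> w z = \<psi> z \<or> w z = - \<psi> z"
    using smooth_sign_choice[OF assms(2,3) open_imp_locally_path_connected[OF assms(2)] sq nz] by blast
  have neg: "- g \<in> SL2C" "congr (- g) \<xi> = congr g \<xi>" if gS: "g \<in> SL2C" for g \<xi>
  proof -
    obtain a b d e where g: "g = mat2 a b d e" "a * e - b * d = 1" using gS by (rule SL2C_exhaust)
    then show "- g \<in> SL2C" by simp
    show "congr (- g) \<xi> = congr g \<xi>"
      by (cases \<xi> rule: mat2_exhaust) (simp add: g(1) congr_def algebra_simps)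
  qed
  have wz: "w z \<in> SL2C" "congr (w z) \<xi> = congr (\<psi> z) \<xi>" if "z \<in> D" for z \<xi>
    using w(2)[OF that] \<psi>(1)[OF that] neg by auto
  have "sqrt \<bar>c\<bar> *\<^sub>R f z = w z ** madj (w z)" "n z = w z ** e1 ** madj (w z)" if "z \<in> D" for z
    using wz(2)[OF that, of "mat 1"] wz(2)[OF that, of e1] \<psi>(2,3)[OF that]
    by (simp_all add: congr_def)
  then have "frame_of c D (\<lambda>z. (f z, n z)) w"
    unfolding frame_of_def fst_conv snd_conv using w(1) wz(1) by blast
  then show ?thesis by (rule that)
qed

lemma minimal_iff_primitive:
  assumes "c < 0" "open D" "simply_connected D" "surface c D f n u"
  shows "minimal_surface D f n \<longleftrightarrow> primitive_map c D (\<lambda>z. (f z, n z))"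
proof -
  obtain \<Phi> where "frame_of c D (\<lambda>z. (f z, n z)) \<Phi>" using frame_exists[OF assms] .
  then show ?thesis
    unfolding minimal_surface_def primitive_map_def
    using minimal_at_iff_primitive_at[OF assms(1,2) _ assms(4)] by blast
qed

theorem proposition7p3:
  fixes c :: real
  assumes "c < 0"
  shows "(\<forall>r. r \<noteq> 0 \<longrightarrow>
            (\<exists>g. k_symmetric_space 4 tau_group SL2C U1 SL2C_act (UH3 c) (UH3_base c) r g)) \<and>
         (\<forall>D f n u. open D \<and> D \<noteq> {} \<and> simply_connected D \<and> surface c D f n u \<longrightarrow>
            (minimal_surface D f n \<longleftrightarrow> primitive_map c D (\<lambda>z. (f z, n z))))"
  using UH3_4_symmetric[OF assms] minimal_iff_primitive[OF assms] by blast

end
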